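(* Let $\Omega\subset\mathbb{R}^2$ be a domain, $\vec F\in C^1(\Omega)$ a vector field, $H\in C^0(\Omega)$, and let $u\in C^1(\Omega)$ be a weak solution to $\operatorname{div}\frac{\nabla u+\vec F}{|\nabla u+\vec F|}=H$. Assume further that $N^\perp(\operatorname{curl}\vec F)$ and $N(H)$ exist and are continuous (extended over singular points) in $\Omega$. Let $p\in\Omega$ be a singular point. Let $\Gamma:[0,\bar\rho)\to\Omega$ be $C^1$ such that $\Gamma(0)=p$ and $\Gamma((0,\bar\rho))$ is a characteristic curve with unit-speed parameter $\rho\in(0,\bar\rho)$. Suppose $\operatorname{curl}\vec F(p)\ne0$. Then the following statements hold. (a) Either $$\lim_{\rho\to0}D'(\Gamma(\rho))=\frac{\operatorname{curl}\vec F(p)}{2}\quad\text{or}\quad \lim_{\rho\to0}D'(\Gamma(\rho))=\operatorname{curl}\vec F(p).$$ (b) The sign of $\operatorname{curl}\vec F(p)$ determines the direction of $N^\perp$: if $\operatorname{curl}\vec F(p)>0$, then $N^\perp=\frac{\partial}{\partial\rho}$ (along $\Gamma$), while if $\operatorname{curl}\vec F(p)<0$, then $N^\perp=-\frac{\partial}{\partial\rho}$. (c) Let $p,q$ be two distinct singular points in $\Omega$. Suppose $\operatorname{curl}\vec F\ne0$ in $\Omega$. Then there does not exist a $C^1$ curve $\Gamma:[0,\bar\rho]\to\Omega$ which is a characteristic curve on $(0,\bar\rho)$ with $\Gamma(0)=p$ and $\Gamma(\bar\rho)=q$.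
   Context: A domain is an open connected set. For $u\in C^1(\Omega)$ the singular set $S_{\vec F}(u)$ is the set of points (singular points) where $\nabla u+\vec F=0$; other points are nonsingular. $u\in C^1(\Omega)$ is a weak solution to $\operatorname{div}\frac{\nabla u+\vec F}{|\nabla u+\vec F|}=H$ if for every $\varphi\in C_0^\infty(\Omega)$ $$\int_{S_{\vec F}(u)}|\nabla\varphi|+\int_{\Omega\setminus S_{\vec F}(u)}\frac{\nabla u+\vec F}{|\nabla u+\vec F|}\cdot\nabla\varphi+\int_\Omega H\varphi\ge 0 .$$ For $\vec F=(F_1,F_2)$, $\operatorname{curl}\vec F:=(F_2)_x-(F_1)_y$. $D:=|\nabla u+\vec F|$. At nonsingular points $N:=\frac{\nabla u+\vec F}{|\nabla u+\vec F|}=(\cos\theta,\sin\theta)$ and $N^\perp:=(\sin\theta,-\cos\theta)$. $N(f)$, $N^\perp(f)$ denote the derivatives of $f$ in the directions $N$, $N^\perp$; "exist and are continuous (extended over singular points) in $\Omega$" means they exist at nonsingular points and extend to continuous functions on $\Omega$. $D':=N^\perp D$. A characteristic curve is an integral curve of $N^\perp$ (in the nonsingular set), considered up to orientation. *)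

theory Defs
  imports "HOL-Analysis.Analysis"
begin

definition grad :: "(real^2 \<Rightarrow> real) \<Rightarrow> real^2 \<Rightarrow> real^2" where
  "grad f x = (THE D. GDERIV f x :> D)"

primrec Ck_on :: "nat \<Rightarrow> (real^2) set \<Rightarrow> (real^2 \<Rightarrow> real) \<Rightarrow> bool" where
  "Ck_on 0 S f \<longleftrightarrow> continuous_on S f"
| "Ck_on (Suc k) S f \<longleftrightarrow>
     (\<forall>x\<in>S. f differentiable (at x)) \<and> (\<forall>i. Ck_on k S (\<lambda>x. grad f x $ i))"

definition C1_on :: "(real^2) set \<Rightarrow> (real^2 \<Rightarrow> real) \<Rightarrow> bool" where
  "C1_on S f \<longleftrightarrow> Ck_on 1 S f"

definition C1_field_on :: "(real^2) set \<Rightarrow> (real^2 \<Rightarrow> real^2) \<Rightarrow> bool" where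
  "C1_field_on S F \<longleftrightarrow> (\<forall>i. C1_on S (\<lambda>x. F x $ i))"

definition test_function :: "(real^2) set \<Rightarrow> (real^2 \<Rightarrow> real) \<Rightarrow> bool" where
  "test_function S \<phi> \<longleftrightarrow>
     (\<forall>k. Ck_on k UNIV \<phi>) \<and> compact (closure {x. \<phi> x \<noteq> 0}) \<and> closure {x. \<phi> x \<noteq> 0} \<subseteq> S"

definition curl :: "(real^2 \<Rightarrow> real^2) \<Rightarrow> real^2 \<Rightarrow> real" where
  "curl F x = grad (\<lambda>z. F z $ 2) x $ 1 - grad (\<lambda>z. F z $ 1) x $ 2"

definition singular_set ::
    "(real^2) set \<Rightarrow> (real^2 \<Rightarrow> real^2) \<Rightarrow> (real^2 \<Rightarrow> real) \<Rightarrow> (real^2) set" where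
  "singular_set \<Omega> F u = {x \<in> \<Omega>. grad u x + F x = 0}"

definition D_fun :: "(real^2 \<Rightarrow> real^2) \<Rightarrow> (real^2 \<Rightarrow> real) \<Rightarrow> real^2 \<Rightarrow> real" where
  "D_fun F u x = norm (grad u x + F x)"

definition N_field :: "(real^2 \<Rightarrow> real^2) \<Rightarrow> (real^2 \<Rightarrow> real) \<Rightarrow> real^2 \<Rightarrow> real^2" where
  "N_field F u x = (grad u x + F x) /\<^sub>R norm (grad u x + F x)"

text \<open>With \<open>N = (cos \<theta>, sin \<theta>)\<close>, this is \<open>(sin \<theta>, - cos \<theta>)\<close>.\<close>
definition Nperp_field :: "(real^2 \<Rightarrow> real^2) \<Rightarrow> (real^2 \<Rightarrow> real) \<Rightarrow> real^2 \<Rightarrow> real^2" where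
  "Nperp_field F u x = vector [N_field F u x $ 2, - (N_field F u x $ 1)]"

definition weak_solution ::
    "(real^2) set \<Rightarrow> (real^2 \<Rightarrow> real^2) \<Rightarrow> (real^2 \<Rightarrow> real) \<Rightarrow> (real^2 \<Rightarrow> real) \<Rightarrow> bool" where
  "weak_solution \<Omega> F H u \<longleftrightarrow>
     (\<forall>\<phi>. test_function \<Omega> \<phi> \<longrightarrow>
        (LINT x:singular_set \<Omega> F u|lborel. norm (grad \<phi> x))
        + (LINT x:\<Omega> - singular_set \<Omega> F u|lborel. N_field F u x \<bullet> grad \<phi> x)
        + (LINT x:\<Omega>|lborel. H x * \<phi> x) \<ge> 0)"

definition integral_curve ::
    "(real^2 \<Rightarrow> real^2) \<Rightarrow> (real^2) set \<Rightarrow> real set \<Rightarrow> (real \<Rightarrow> real^2) \<Rightarrow> bool" where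
  "integral_curve V U I \<gamma> \<longleftrightarrow>
     (\<forall>t\<in>I. \<gamma> t \<in> U \<and> (\<gamma> has_vector_derivative V (\<gamma> t)) (at t))"

text \<open>
  Derivative of \<open>f\<close> at \<open>q\<close> in the direction of the vector field \<open>V\<close>, for functions \<open>f\<close> that need
  not be differentiable: the derivative of \<open>f\<close> along the integral curves of \<open>V\<close> in \<open>U\<close> through
  \<open>q\<close>.  It is not the derivative along the straight line through \<open>q\<close> with direction \<open>V q\<close>, which may
  fail to exist when \<open>f\<close> is merely continuous across the curves.  The existence clause makes the value
  \<open>d\<close> unique; it always holds (Peano) if \<open>U\<close> is open, \<open>q \<in> U\<close>, and \<open>V\<close> is continuous on \<open>U\<close>.
\<close>
definition has_deriv_along ::
    "(real^2 \<Rightarrow> real) \<Rightarrow> (real^2 \<Rightarrow> real^2) \<Rightarrow> (real^2) set \<Rightarrow> real^2 \<Rightarrow> real \<Rightarrow> bool" where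
  "has_deriv_along f V U q d \<longleftrightarrow>
     (\<exists>\<gamma> \<epsilon>. \<epsilon> > 0 \<and> integral_curve V U {-\<epsilon><..<\<epsilon>} \<gamma> \<and> \<gamma> 0 = q) \<and>
     (\<forall>\<gamma> \<epsilon>. \<epsilon> > 0 \<and> integral_curve V U {-\<epsilon><..<\<epsilon>} \<gamma> \<and> \<gamma> 0 = q \<longrightarrow>
        ((\<lambda>t. f (\<gamma> t)) has_real_derivative d) (at 0))"

definition deriv_along_extends ::
    "(real^2 \<Rightarrow> real) \<Rightarrow> (real^2 \<Rightarrow> real^2) \<Rightarrow> (real^2) set \<Rightarrow> (real^2) set \<Rightarrow> bool" where
  "deriv_along_extends f V U \<Omega> \<longleftrightarrow>
     (\<exists>g. continuous_on \<Omega> g \<and> (\<forall>q\<in>U. has_deriv_along f V U q (g q)))"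

text \<open>Characteristic curves carry their unit-speed parameter; either orientation is allowed.\<close>
definition characteristic_curve ::
    "(real^2) set \<Rightarrow> (real^2 \<Rightarrow> real^2) \<Rightarrow> (real^2 \<Rightarrow> real) \<Rightarrow> real set \<Rightarrow> (real \<Rightarrow> real^2) \<Rightarrow> bool" where
  "characteristic_curve \<Omega> F u I \<gamma> \<longleftrightarrow>
     integral_curve (Nperp_field F u) (\<Omega> - singular_set \<Omega> F u) I \<gamma> \<or>
     integral_curve (\<lambda>x. - Nperp_field F u x) (\<Omega> - singular_set \<Omega> F u) I \<gamma>"

text \<open>One-sided derivatives at endpoints of \<open>I\<close>, unlike \<open>C1_differentiable_on\<close>.\<close>
definition C1_curve_on :: "real set \<Rightarrow> (real \<Rightarrow> real^2) \<Rightarrow> bool" where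
  "C1_curve_on I \<gamma> \<longleftrightarrow>
     (\<exists>\<gamma>'. continuous_on I \<gamma>' \<and> (\<forall>t\<in>I. (\<gamma> has_vector_derivative \<gamma>' t) (at t within I)))"

end

theory Submission
  imports Defs "HOL-Complex_Analysis.Great_Picard"
begin

text \<open>
  At nonsingular points the hypotheses amount to \<open>div N = H\<close> and \<open>curl (D N) = curl F\<close> in integrated form.
  Comparing the flux of \<open>N\<close> through a characteristic curve and its translates, where it is extremal, shows
  that the direction of \<open>N\<close> is differentiable along the curve, with derivative given by \<open>H\<close>.
  The flux of \<open>D N\<close>, rotated, between two characteristic curves is controlled by \<open>curl F\<close>; this gives uniqueness
  and a two-sided bound for the distance of neighbouring curves. Since \<open>N(H)\<close> exists, also
  \<open>div (H N) = K\<close> with \<open>K = N(H) + H\<^sup>2\<close>, and a limit of the distances produces a positive Jacobi field \<open>j\<close> along the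
  curve with \<open>j'' = - K j\<close> and \<open>(D j)' = j curl F\<close>.
  At a singular end point \<open>j\<close> extends with \<open>(j, j') \<noteq> 0\<close> and \<open>D j\<close> vanishes. If \<open>j \<noteq> 0\<close> there, then \<open>D' = curl F - D j' / j\<close>
  tends to \<open>curl F\<close>; if \<open>j = 0\<close>, then \<open>j\<close> vanishes to first order and \<open>D'\<close> tends to \<open>curl F / 2\<close>. Since \<open>D > 0\<close>,
  the sign of \<open>curl F\<close> fixes the orientation, and a curve joining two singular points would need both orientations.
\<close>

section \<open>One-dimensional tools\<close>

text \<open>The obstacle is regularity. Since \<open>u\<close> is only C^1, \<open>N\<close> and
  \<open>D\<close> are merely continuous: the equation cannot be differentiated, integral curves of
  \<open>N\<close> and of its rotation come from Peano's theorem without uniqueness, and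
  \<open>D'\<close> is not known to exist. Hence every equation is kept as a flux balance over
  rectangles, in coordinates whose second axis is \<open>N\<close> at the point considered, and
  regularity is gained only along curves. Jacobi fields are obtained only on short pieces of a curve
  and need not agree on overlaps. Their logarithmic derivative \<open>(curl F - D') / D\<close>
  involves no choice and solves a Riccati equation on the whole curve. Its solution may be unbounded
  near the singular point, which is why it is exponentiated back into the linear system. There the
  coefficient \<open>K\<close> stays bounded, because \<open>H\<close> and the extension of
  \<open>N(H)\<close> are continuous at the singular point, and an energy estimate run in both
  directions keeps the limit of the Jacobi field and its derivative finite and nonzero.\<close>

lemma nondecreasing_within:
  fixes f :: "real \<Rightarrow> real"
  assumes der: "\<And>x. x \<in> {a..b} \<Longrightarrow> (f has_real_derivative f' x) (at x within {a..b})"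
    and nn: "\<And>x. x \<in> {a..b} \<Longrightarrow> 0 \<le> f' x"
    and uv: "u \<in> {a..b}" "v \<in> {a..b}" "u \<le> v"
  shows "f u \<le> f v"
proof (rule DERIV_nonneg_imp_increasing_open[OF uv(3)])
  fix x assume x: "u < x" "x < v"
  then have "x \<in> {a<..<b}" using uv by auto
  then have "(f has_real_derivative f' x) (at x)"
    using der[of x] by (simp add: at_within_Icc_at)
  then show "\<exists>y. (f has_real_derivative y) (at x) \<and> 0 \<le> y"
    using nn[of x] x uv by auto
next
  have "continuous_on {a..b} f"
    using der DERIV_continuous_on by blast
  then show "continuous_on {u..v} f"
    by (rule continuous_on_subset) (use uv in auto)
qed

lemma gronwall_abs:
  fixes f :: "real \<Rightarrow> real"
  assumes der: "\<And>x. x \<in> {a..b} \<Longrightarrow> (f has_real_derivative f' x) (at x within {a..b})"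
    and bd: "\<And>x. x \<in> {a..b} \<Longrightarrow> \<bar>f' x\<bar> \<le> C * \<bar>f x\<bar>"
    and uv: "u \<in> {a..b}" "v \<in> {a..b}"
  shows "\<bar>f v\<bar> \<le> \<bar>f u\<bar> * exp (C * \<bar>v - u\<bar>)"
proof -
  have key: "\<bar>f x * f' x\<bar> \<le> C * (f x)\<^sup>2" if "x \<in> {a..b}" for x
    using mult_left_mono[OF bd[OF that], of "\<bar>f x\<bar>"]
    by (simp add: abs_mult power2_eq_square algebra_simps)
  have "(f v)\<^sup>2 \<le> (f u)\<^sup>2 * exp (2 * C * \<bar>v - u\<bar>)"
  proof (cases "u \<le> v")
    case True
    have "- ((f u)\<^sup>2 * exp (- 2 * C * u)) \<le> - ((f v)\<^sup>2 * exp (- 2 * C * v))"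
    proof (rule nondecreasing_within[where f = "\<lambda>x. - ((f x)\<^sup>2 * exp (- 2 * C * x))"
          and f' = "\<lambda>x. (2 * C * (f x)\<^sup>2 - 2 * f x * f' x) * exp (- 2 * C * x)"])
      fix x assume x: "x \<in> {a..b}"
      show "((\<lambda>x. - ((f x)\<^sup>2 * exp (- 2 * C * x))) has_real_derivative
        (2 * C * (f x)\<^sup>2 - 2 * f x * f' x) * exp (- 2 * C * x)) (at x within {a..b})"
        by (rule derivative_eq_intros der[OF x] refl | simp add: algebra_simps power2_eq_square)+
      show "0 \<le> (2 * C * (f x)\<^sup>2 - 2 * f x * f' x) * exp (- 2 * C * x)"
        using key[OF x] by (simp add: abs_le_iff)
    qed (use uv True in auto)
    then have "(f v)\<^sup>2 * exp (- 2 * C * v) * exp (2 * C * v) \<le> (f u)\<^sup>2 * exp (- 2 * C * u) * exp (2 * C * v)"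
      by (intro mult_right_mono) auto
    then show ?thesis using True by (simp add: mult.assoc flip: exp_add) (simp add: algebra_simps)
  next
    case False
    have "((f v)\<^sup>2 * exp (2 * C * v)) \<le> ((f u)\<^sup>2 * exp (2 * C * u))"
    proof (rule nondecreasing_within[where f = "\<lambda>x. ((f x)\<^sup>2 * exp (2 * C * x))"
          and f' = "\<lambda>x. (2 * C * (f x)\<^sup>2 + 2 * f x * f' x) * exp (2 * C * x)"])
      fix x assume x: "x \<in> {a..b}"
      show "((\<lambda>x. ((f x)\<^sup>2 * exp (2 * C * x))) has_real_derivative
        (2 * C * (f x)\<^sup>2 + 2 * f x * f' x) * exp (2 * C * x)) (at x within {a..b})"
        by (rule derivative_eq_intros der[OF x] refl | simp add: algebra_simps power2_eq_square)+
      show "0 \<le> (2 * C * (f x)\<^sup>2 + 2 * f x * f' x) * exp (2 * C * x)"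
        using key[OF x] by (simp add: abs_le_iff)
    qed (use uv False in auto)
    then have "(f v)\<^sup>2 * exp (2 * C * v) * exp (- 2 * C * v) \<le> (f u)\<^sup>2 * exp (2 * C * u) * exp (- 2 * C * v)"
      by (intro mult_right_mono) auto
    then show ?thesis using False by (simp add: mult.assoc flip: exp_add) (simp add: algebra_simps)
  qed
  also have "\<dots> = (\<bar>f u\<bar> * exp (C * \<bar>v - u\<bar>))\<^sup>2"
    by (simp add: power_mult_distrib mult.assoc flip: exp_double)
  finally have "\<bar>f v\<bar>\<^sup>2 \<le> (\<bar>f u\<bar> * exp (C * \<bar>v - u\<bar>))\<^sup>2" by simp
  then show ?thesis by (rule power2_le_imp_le) simp
qed

section \<open>Oriented integrals on the line\<close>

text \<open>The interval integral is zero for reversed limits. The oriented version stays additive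
  in its limits, so the flux between two graphs needs no information on which of them lies
  above.\<close>

definition SI :: "(real \<Rightarrow> real) \<Rightarrow> real \<Rightarrow> real \<Rightarrow> real" where
  "SI f u v = (if u \<le> v then integral {u..v} f else - integral {v..u} f)"

lemma SI_cong:
  assumes "\<And>t. t \<in> closed_segment u v \<Longrightarrow> f t = g t"
  shows "SI f u v = SI g u v"
  using assms unfolding SI_def closed_segment_eq_real_ivl
  by (auto intro!: integral_cong split: if_splits)

lemma SI_eq_diff:
  assumes "continuous_on {a..b} f" "u \<in> {a..b}" "v \<in> {a..b}"
  shows "SI f u v = integral {a..v} f - integral {a..u} f"
proof -
  have *: "integral {a..x} f + integral {x..y} f = integral {a..y} f"
    if "x \<le> y" "x \<in> {a..b}" "y \<in> {a..b}" for x y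
  proof (rule Henstock_Kurzweil_Integration.integral_combine)
    have "continuous_on {a..y} f"
      by (rule continuous_on_subset[OF assms(1)]) (use that in auto)
    then show "f integrable_on {a..y}" by (rule integrable_continuous_real)
  qed (use that in auto)
  show ?thesis using *[of u v] *[of v u] assms by (auto simp: SI_def)
qed

lemma SI_same [simp]: "SI f u u = 0"
  by (simp add: SI_def)

lemma SI_const [simp]: "SI (\<lambda>_. k) u v = k * (v - u)"
  by (auto simp: SI_def algebra_simps)

lemma SI_swap: "SI f u v = - SI f v u"
  by (auto simp: SI_def)

lemma SI_integrable:
  fixes f :: "real \<Rightarrow> real"
  assumes "continuous_on (closed_segment u v) f"
  shows "u \<le> v \<Longrightarrow> f integrable_on {u..v}" "\<not> u \<le> v \<Longrightarrow> f integrable_on {v..u}"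
  using assms by (auto simp: closed_segment_eq_real_ivl intro!: integrable_continuous_real split: if_splits)

lemma SI_diff:
  assumes "continuous_on (closed_segment u v) f" "continuous_on (closed_segment u v) g"
  shows "SI (\<lambda>t. f t - g t) u v = SI f u v - SI g u v"
  using SI_integrable[OF assms(1)] SI_integrable[OF assms(2)]
  by (auto simp: SI_def integral_diff)

lemma SI_add:
  assumes "continuous_on (closed_segment u v) f" "continuous_on (closed_segment u v) g"
  shows "SI (\<lambda>t. f t + g t) u v = SI f u v + SI g u v"
  using SI_integrable[OF assms(1)] SI_integrable[OF assms(2)]
  by (auto simp: SI_def integral_add)

lemma SI_cmult: "SI (\<lambda>t. k * f t) u v = k * SI f u v"
  by (auto simp: SI_def)

lemma SI_abs_le:
  assumes "continuous_on (closed_segment u v) f"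
    and "\<And>t. t \<in> closed_segment u v \<Longrightarrow> \<bar>f t\<bar> \<le> C"
  shows "\<bar>SI f u v\<bar> \<le> C * \<bar>v - u\<bar>"
proof -
  have *: "\<bar>integral {x..y} f\<bar> \<le> C * (y - x)"
    if "x \<le> y" "closed_segment u v = {x..y}" for x y
    using integral_bound[of x y f C] that assms by (auto simp: closed_segment_eq_real_ivl)
  show ?thesis
    using *[of u v] *[of v u] by (auto simp: SI_def closed_segment_eq_real_ivl split: if_splits)
qed

lemma SI_approx:
  assumes "continuous_on (closed_segment u v) f"
    and "\<And>t. t \<in> closed_segment u v \<Longrightarrow> \<bar>f t - k\<bar> \<le> C"
  shows "\<bar>SI f u v - k * (v - u)\<bar> \<le> C * \<bar>v - u\<bar>"
proof -
  have "SI f u v - k * (v - u) = SI (\<lambda>t. f t - k) u v"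
    using SI_diff[OF assms(1), of "\<lambda>_. k"] by simp
  also have "\<bar>\<dots>\<bar> \<le> C * \<bar>v - u\<bar>"
    by (rule SI_abs_le) (use assms in \<open>auto intro!: continuous_intros\<close>)
  finally show ?thesis .
qed

lemma SI_lower:
  assumes "continuous_on (closed_segment u v) f"
    and "\<And>t. t \<in> closed_segment u v \<Longrightarrow> k \<le> f t" and "0 \<le> k"
  shows "k * \<bar>v - u\<bar> \<le> \<bar>SI f u v\<bar>"
proof -
  have *: "k * (y - x) \<le> integral {x..y} f"
    if "x \<le> y" "closed_segment u v = {x..y}" for x y
  proof -
    have "integral {x..y} (\<lambda>_. k) \<le> integral {x..y} f"
      by (rule integral_le) (use that assms in \<open>auto intro!: integrable_continuous_real\<close>)
    then show ?thesis using that by (simp add: mult.commute)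
  qed
  show ?thesis
    using *[of u v] *[of v u] by (auto simp: SI_def closed_segment_eq_real_ivl split: if_splits)
qed

lemma SI_combine:
  assumes "continuous_on {a..b} f" "u \<in> {a..b}" "v \<in> {a..b}" "w \<in> {a..b}"
  shows "SI f u v + SI f v w = SI f u w"
  using SI_eq_diff[OF assms(1)] assms by simp

lemma SI_has_real_derivative:
  assumes "continuous_on {a..b} f" "u \<in> {a..b}" "x \<in> {a..b}"
  shows "(SI f u has_real_derivative f x) (at x within {a..b})"
proof -
  have "((\<lambda>x. integral {a..x} f - integral {a..u} f) has_real_derivative f x) (at x within {a..b})"
    using integral_has_real_derivative[OF assms(1,3)] by (auto intro!: derivative_eq_intros)
  then show ?thesis
    by (rule has_field_derivative_transform_within[where d=1])
       (use SI_eq_diff[OF assms(1,2)] assms in auto)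
qed

lemma closed_segment_subset_Icc:
  "u \<in> {a..b::real} \<Longrightarrow> v \<in> {a..b} \<Longrightarrow> closed_segment u v \<subseteq> {a..b}"
  by (auto simp: closed_segment_eq_real_ivl split: if_splits)

lemma continuous_on_pairI:
  assumes "continuous_on S (f :: real \<times> real \<Rightarrow> real)" "continuous_on T g" "continuous_on T h"
    "\<And>t. t \<in> T \<Longrightarrow> (g t, h t) \<in> S"
  shows "continuous_on T (\<lambda>t. f (g t, h t))"
  by (rule continuous_on_compose2[OF assms(1)]) (use assms in \<open>auto intro!: continuous_intros\<close>)

lemma SI_tendsto:
  fixes F :: "nat \<Rightarrow> real \<Rightarrow> real"
  assumes cF: "\<And>n. continuous_on (closed_segment u v) (F n)"
    and bd: "\<And>n t. t \<in> closed_segment u v \<Longrightarrow> \<bar>F n t\<bar> \<le> C"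
    and lim: "\<And>t. t \<in> closed_segment u v \<Longrightarrow> (\<lambda>n. F n t) \<longlonglongrightarrow> G t"
  shows "(\<lambda>n. SI (F n) u v) \<longlonglongrightarrow> SI G u v"
proof -
  have *: "(\<lambda>n. integral {x..y} (F n)) \<longlonglongrightarrow> integral {x..y} G" if "closed_segment u v = {x..y}" for x y
    by (rule dominated_convergence(2)[where h="\<lambda>_. C"])
       (use cF bd lim that in \<open>auto intro!: integrable_continuous_real\<close>)
  show ?thesis
    using *[of u v] *[of v u] by (auto simp: SI_def closed_segment_eq_real_ivl intro!: tendsto_intros)
qed

text \<open>Tonelli's delay: the value at \<open>x\<close> depends only on values at points closer to \<open>0\<close> by \<open>d\<close>, so the
  iterates of the delayed Picard operator stabilise after finitely many steps on bounded intervals.\<close>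

definition delay :: "real \<Rightarrow> real \<Rightarrow> real" where
  "delay d x = max (x - d) 0 + min (x + d) 0"

primrec tonelli :: "(real \<times> real \<Rightarrow> real) \<Rightarrow> real \<Rightarrow> real \<Rightarrow> nat \<Rightarrow> real \<Rightarrow> real" where
  "tonelli f d y0 0 = (\<lambda>_. y0)"
| "tonelli f d y0 (Suc k) = (\<lambda>x. y0 + SI (\<lambda>t. f (t, tonelli f d y0 k t)) 0 (delay d x))"

lemma abs_delay:
  assumes "0 \<le> d" shows "\<bar>delay d x\<bar> \<le> max (\<bar>x\<bar> - d) 0"
  using assms unfolding delay_def by linarith

lemma delay_lipschitz:
  assumes "0 \<le> d" shows "\<bar>delay d x - delay d y\<bar> \<le> \<bar>x - y\<bar>"
  using assms unfolding delay_def by linarith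

lemma delay_close:
  assumes "0 \<le> d" shows "\<bar>delay d x - x\<bar> \<le> d"
  using assms unfolding delay_def by linarith

lemma lipschitz_continuous:
  fixes g :: "real \<Rightarrow> real"
  assumes "\<And>x y. x \<in> S \<Longrightarrow> y \<in> S \<Longrightarrow> \<bar>g x - g y\<bar> \<le> L * \<bar>x - y\<bar>"
  shows "continuous_on S g"
proof -
  have "(max L 0)-lipschitz_on S g"
  proof (rule lipschitz_onI)
    fix x y assume "x \<in> S" "y \<in> S"
    then have "\<bar>g x - g y\<bar> \<le> L * \<bar>x - y\<bar>" by (rule assms)
    also have "\<dots> \<le> max L 0 * \<bar>x - y\<bar>" by (rule mult_right_mono) auto
    finally show "dist (g x) (g y) \<le> max L 0 * dist x y" by (simp add: dist_real_def)
  qed simp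
  then show ?thesis by (rule lipschitz_on_continuous_on)
qed

lemma SI_lipschitz:
  assumes c: "continuous_on UNIV F" and b: "\<And>t. \<bar>F t\<bar> \<le> L"
  shows "\<bar>SI F a u - SI F a v\<bar> \<le> L * \<bar>u - v\<bar>"
proof -
  have "SI F a v + SI F v u = SI F a u"
    by (rule SI_combine[where a="min a (min u v)" and b="max a (max u v)"])
       (auto intro: continuous_on_subset[OF c])
  moreover have "\<bar>SI F v u\<bar> \<le> L * \<bar>u - v\<bar>"
    by (rule SI_abs_le) (auto intro: continuous_on_subset[OF c] b)
  ultimately show ?thesis by simp
qed

lemma tonelli_lipschitz:
  assumes c: "continuous_on UNIV f" and b: "\<And>p. \<bar>f p\<bar> \<le> L" and d: "0 \<le> d"
  shows "\<bar>tonelli f d y0 k x - tonelli f d y0 k y\<bar> \<le> L * \<bar>x - y\<bar>"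
proof (induction k arbitrary: x y)
  case 0
  have "0 \<le> L" using b[of undefined] by linarith
  then show ?case by simp
next
  case (Suc k)
  have L0: "0 \<le> L" using b[of undefined] by linarith
  have ck: "continuous_on UNIV (tonelli f d y0 k)"
    using Suc by (intro lipschitz_continuous) auto
  have "continuous_on UNIV (\<lambda>t. f (t, tonelli f d y0 k t))"
    by (rule continuous_on_pairI[OF c _ ck]) auto
  then have "\<bar>tonelli f d y0 (Suc k) x - tonelli f d y0 (Suc k) y\<bar> \<le> L * \<bar>delay d x - delay d y\<bar>"
    using SI_lipschitz[of "\<lambda>t. f (t, tonelli f d y0 k t)" L 0] b by simp
  also have "\<dots> \<le> L * \<bar>x - y\<bar>"
    by (rule mult_left_mono[OF delay_lipschitz[OF d] L0])
  finally show ?case .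
qed

lemma tonelli_stable:
  assumes d: "0 < d" and x: "\<bar>x\<bar> \<le> real (Suc k) * d"
  shows "tonelli f d y0 (Suc k) x = tonelli f d y0 k x"
  using x
proof (induction k arbitrary: x)
  case 0
  then have "delay d x = 0" using d by (simp add: delay_def)
  then show ?case by simp
next
  case (Suc k)
  have "tonelli f d y0 (Suc k) t = tonelli f d y0 k t" if "t \<in> closed_segment 0 (delay d x)" for t
  proof (rule Suc.IH)
    have "\<bar>t\<bar> \<le> \<bar>delay d x\<bar>"
      using that by (auto simp: closed_segment_eq_real_ivl split: if_splits)
    also have "\<dots> \<le> real (Suc k) * d"
      using Suc.prems d abs_delay[of d x] by (simp add: algebra_simps max_def split: if_splits)
    finally show "\<bar>t\<bar> \<le> real (Suc k) * d" .
  qed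
  then have "SI (\<lambda>t. f (t, tonelli f d y0 (Suc k) t)) 0 (delay d x)
      = SI (\<lambda>t. f (t, tonelli f d y0 k t)) 0 (delay d x)"
    by (intro SI_cong) (simp del: tonelli.simps)
  then show ?case
    unfolding tonelli.simps(2)[of f d y0 "Suc k"] tonelli.simps(2)[of f d y0 k] by simp
qed

text \<open>An iterate that has stabilised solves the equation with delayed upper limit exactly. All
  iterates are \<open>L\<close>-Lipschitz with value \<open>y0\<close> at \<open>0\<close>, so
  Arzela-Ascoli gives a uniform limit along a subsequence as the delay tends to \<open>0\<close>.
  The delay changes the integral by at most \<open>L * d n\<close>, and dominated convergence yields
  the undelayed integral equation.\<close>

lemma peano_bounded0:
  assumes c: "continuous_on UNIV (f :: real \<times> real \<Rightarrow> real)" and b: "\<And>p. \<bar>f p\<bar> \<le> L" and a: "0 \<le> a"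
  shows "\<exists>g. g 0 = y0 \<and> (\<forall>t\<in>{-a..a}. (g has_real_derivative f (t, g t)) (at t within {-a..a}))"
proof -
  have L0: "0 \<le> L" using b[of undefined] by linarith
  define d where "d n = 1 / real (Suc n)" for n
  have d0: "0 < d n" for n by (simp add: d_def)
  have dlim: "d \<longlonglongrightarrow> 0" unfolding d_def by real_asymp
  \<comment> \<open>\<open>K n\<close> iterations suffice for stabilisation on the whole of
    \<open>{-a..a}\<close> with delay \<open>d n\<close>.\<close>
  obtain K where K: "\<And>n. a \<le> real (Suc (K n)) * d n"
  proof -
    have "\<exists>k. a \<le> real (Suc k) * d n" for n
    proof -
      obtain k where "a / d n < real k" using reals_Archimedean2 by blast
      then have "a \<le> real (Suc k) * d n" using d0[of n] by (simp add: field_simps)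
      then show ?thesis ..
    qed
    then show ?thesis using that by metis
  qed
  define z where "z n = tonelli f (d n) y0 (K n)" for n
  have lip: "\<bar>z n x - z n y\<bar> \<le> L * \<bar>x - y\<bar>" for n x y
    unfolding z_def by (rule tonelli_lipschitz[OF c b]) (use d0[of n] in simp)
  have zc: "continuous_on UNIV (z n)" for n
    by (rule lipschitz_continuous[OF lip])
  have Fc: "continuous_on UNIV (\<lambda>t. f (t, z n t))" for n
    by (rule continuous_on_pairI[OF c _ zc]) auto
  have zeq: "z n x = y0 + SI (\<lambda>t. f (t, z n t)) 0 (delay (d n) x)" if "x \<in> {-a..a}" for n x
  proof -
    have "tonelli f (d n) y0 (Suc (K n)) x = tonelli f (d n) y0 (K n) x"
      by (rule tonelli_stable[OF d0]) (use that K[of n] in auto)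
    then show ?thesis unfolding z_def tonelli.simps(2) by simp
  qed
  have z0: "z n 0 = y0" for n
  proof -
    have "delay (d n) 0 = 0" unfolding delay_def using d0[of n] by linarith
    then show ?thesis using zeq[of 0 n] a by simp
  qed
  obtain g k where g: "continuous_on {-a..a} g" "strict_mono (k :: nat \<Rightarrow> nat)"
    and conv: "\<And>e. 0 < e \<Longrightarrow> \<exists>N. \<forall>n x. n \<ge> N \<and> x \<in> {-a..a} \<longrightarrow> norm (z (k n) x - g x) < e"
  proof (rule Arzela_Ascoli[of "{-a..a}" z "\<bar>y0\<bar> + L * a"])
    fix n x assume x: "x \<in> {-a..a}"
    have "\<bar>z n x - z n 0\<bar> \<le> L * a"
      by (rule order_trans[OF lip]) (use x L0 in \<open>auto intro!: mult_left_mono\<close>)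
    then show "norm (z n x) \<le> \<bar>y0\<bar> + L * a" by (simp add: z0)
  next
    fix x e :: real assume "0 < e"
    have "norm (z n x - z n y) < e" if "norm (x - y) < e / (L + 1)" for n y
    proof -
      have "\<bar>z n x - z n y\<bar> \<le> L * \<bar>x - y\<bar>" by (rule lip)
      also have "\<dots> \<le> (L + 1) * \<bar>x - y\<bar>" by (rule mult_right_mono) auto
      also have "\<dots> < e" using that L0 by (simp add: field_simps)
      finally show ?thesis by simp
    qed
    then show "\<exists>d>0. \<forall>n y. y \<in> {-a..a} \<and> norm (x - y) < d \<longrightarrow> norm (z n x - z n y) < e"
      using \<open>0 < e\<close> L0 by (intro exI[of _ "e / (L + 1)"]) auto
  qed auto
  have pt: "(\<lambda>n. z (k n) x) \<longlonglongrightarrow> g x" if "x \<in> {-a..a}" for x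
    unfolding lim_sequentially dist_norm using conv that by meson
  have geq: "g x = y0 + SI (\<lambda>t. f (t, g t)) 0 x" if x: "x \<in> {-a..a}" for x
  proof -
    have seg: "closed_segment 0 x \<subseteq> {-a..a}"
      using x a by (intro closed_segment_subset_Icc) auto
    have "(\<lambda>n. SI (\<lambda>t. f (t, z (k n) t)) 0 x) \<longlonglongrightarrow> SI (\<lambda>t. f (t, g t)) 0 x"
    proof (rule SI_tendsto[where C=L])
      show "continuous_on (closed_segment 0 x) (\<lambda>t. f (t, z (k n) t))" for n
        by (rule continuous_on_subset[OF Fc]) auto
      fix t assume "t \<in> closed_segment 0 x"
      then have "(\<lambda>n. (t, z (k n) t)) \<longlonglongrightarrow> (t, g t)"
        using pt seg by (intro tendsto_intros) auto
      then show "(\<lambda>n. f (t, z (k n) t)) \<longlonglongrightarrow> f (t, g t)"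
        using c by (intro isCont_tendsto_compose[of "(t, g t)" f]) (auto simp: continuous_on_eq_continuous_at)
    qed (rule b)
    moreover have "(\<lambda>n. SI (\<lambda>t. f (t, z (k n) t)) 0 x - SI (\<lambda>t. f (t, z (k n) t)) 0 (delay (d (k n)) x)) \<longlonglongrightarrow> 0"
    proof (rule Lim_null_comparison)
      show "\<forall>\<^sub>F n in sequentially. norm (SI (\<lambda>t. f (t, z (k n) t)) 0 x - SI (\<lambda>t. f (t, z (k n) t)) 0 (delay (d (k n)) x)) \<le> L * d (k n)"
      proof (rule always_eventually, rule allI)
        fix n
        have "\<bar>SI (\<lambda>t. f (t, z (k n) t)) 0 x - SI (\<lambda>t. f (t, z (k n) t)) 0 (delay (d (k n)) x)\<bar>
           \<le> L * \<bar>x - delay (d (k n)) x\<bar>"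
          by (rule SI_lipschitz[OF Fc b])
        also have "\<dots> \<le> L * d (k n)"
          using delay_close[of "d (k n)" x] d0[of "k n"] L0 by (intro mult_left_mono) (auto simp: abs_minus_commute)
        finally show "norm (SI (\<lambda>t. f (t, z (k n) t)) 0 x - SI (\<lambda>t. f (t, z (k n) t)) 0 (delay (d (k n)) x)) \<le> L * d (k n)" by simp
      qed
      show "(\<lambda>n. L * d (k n)) \<longlonglongrightarrow> 0"
        using LIMSEQ_subseq_LIMSEQ[OF dlim g(2)] by (auto simp: o_def intro!: tendsto_mult_right_zero)
    qed
    ultimately have "(\<lambda>n. y0 + SI (\<lambda>t. f (t, z (k n) t)) 0 (delay (d (k n)) x)) \<longlonglongrightarrow> y0 + SI (\<lambda>t. f (t, g t)) 0 x"
      using tendsto_diff[of "\<lambda>n. SI (\<lambda>t. f (t, z (k n) t)) 0 x" "SI (\<lambda>t. f (t, g t)) 0 x" sequentially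
        "\<lambda>n. SI (\<lambda>t. f (t, z (k n) t)) 0 x - SI (\<lambda>t. f (t, z (k n) t)) 0 (delay (d (k n)) x)" 0]
      by (intro tendsto_add) auto
    then have "(\<lambda>n. z (k n) x) \<longlonglongrightarrow> y0 + SI (\<lambda>t. f (t, g t)) 0 x"
      by (simp flip: zeq[OF x])
    then show ?thesis using pt[OF x] by (rule LIMSEQ_unique[OF _ , symmetric])
  qed
  have gc: "continuous_on {-a..a} (\<lambda>t. f (t, g t))"
    by (rule continuous_on_pairI[OF c _ g(1)]) auto
  have "(g has_real_derivative f (t, g t)) (at t within {-a..a})" if t: "t \<in> {-a..a}" for t
  proof -
    have "((\<lambda>x. y0 + SI (\<lambda>t. f (t, g t)) 0 x) has_real_derivative 0 + f (t, g t)) (at t within {-a..a})"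
      by (intro DERIV_add DERIV_const SI_has_real_derivative[OF gc]) (use t a in auto)
    then have "((\<lambda>x. y0 + SI (\<lambda>t. f (t, g t)) 0 x) has_real_derivative f (t, g t)) (at t within {-a..a})"
      by simp
    then show ?thesis
      by (rule has_field_derivative_transform_within[where d=1]) (use t in \<open>simp_all add: geq[symmetric]\<close>)
  qed
  moreover have "g 0 = y0" using geq[of 0] a by simp
  ultimately show ?thesis by blast
qed

text \<open>Clamping both arguments to the box extends \<open>f\<close> to a bounded continuous
  function on the plane. A solution moves by at most \<open>2 * a * L\<close> within the window, so
  the last hypothesis keeps it in the box, where clamping does nothing.\<close>

lemma peano_box:
  assumes c: "continuous_on ({-r..r} \<times> {-r..r}) (f :: real \<times> real \<Rightarrow> real)"
    and b: "\<And>p. p \<in> {-r..r} \<times> {-r..r} \<Longrightarrow> \<bar>f p\<bar> \<le> L"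
    and a: "0 \<le> a" "a \<le> r" and t0: "t0 \<in> {-a..a}" and y0: "\<bar>y0\<bar> + 2 * a * L \<le> r"
  shows "\<exists>g. g t0 = y0 \<and> (\<forall>t\<in>{-a..a}. g t \<in> {-r..r} \<and> (g has_real_derivative f (t, g t)) (at t within {-a..a}))"
proof -
  define cl where "cl x = max (-r) (min r x)" for x
  have r0: "0 \<le> r" using a by simp
  have clin: "cl x \<in> {-r..r}" for x using r0 by (auto simp: cl_def)
  have clid: "cl x = x" if "x \<in> {-r..r}" for x using that by (auto simp: cl_def)
  have clc: "continuous_on UNIV cl" unfolding cl_def[abs_def] by (intro continuous_intros)
  define F where "F p = f (cl (fst p + t0), cl (snd p))" for p :: "real \<times> real"
  have Fc: "continuous_on UNIV F"
    unfolding F_def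
    by (rule continuous_on_pairI[OF c])
       (use clin in \<open>auto intro!: continuous_on_compose2[OF clc] continuous_intros\<close>)
  have Fb: "\<bar>F p\<bar> \<le> L" for p unfolding F_def by (rule b) (use clin in auto)
  have L0: "0 \<le> L" using Fb[of undefined] by linarith
  \<comment> \<open>The bounded version starts at time \<open>0\<close>, while \<open>t0\<close> may
    be anywhere in \<open>{-a..a}\<close>; after the shift by \<open>t0\<close> the window fits into
    one of twice the length.\<close>
  obtain g1 where g1: "g1 0 = y0"
    and dg1: "\<And>t. t \<in> {-(2*a)..2*a} \<Longrightarrow> (g1 has_real_derivative F (t, g1 t)) (at t within {-(2*a)..2*a})"
    using peano_bounded0[OF Fc Fb, of "2*a" y0] a by auto
  define g where "g t = g1 (t - t0)" for t
  have dg: "(g has_real_derivative F (t - t0, g t)) (at t within {-a..a})" if t: "t \<in> {-a..a}" for t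
  proof -
    have "(g1 has_real_derivative F (t - t0, g1 (t - t0))) (at (t - t0) within ((\<lambda>t. t - t0) ` {-a..a}))"
      by (rule DERIV_subset[OF dg1]) (use t t0 in auto)
    moreover have "((\<lambda>t. t - t0) has_real_derivative 1) (at t within {-a..a})"
      by (auto intro!: derivative_eq_intros)
    ultimately have "(g1 \<circ> (\<lambda>t. t - t0) has_real_derivative F (t - t0, g1 (t - t0)) * 1) (at t within {-a..a})"
      by (rule DERIV_image_chain)
    then show ?thesis by (simp add: o_def g_def[abs_def])
  qed
  have gin: "g t \<in> {-r..r}" if t: "t \<in> {-a..a}" for t
  proof -
    have "norm (g t - g t0) \<le> L * norm (t - t0)"
      by (rule field_differentiable_bound[OF _ dg]) (use t t0 Fb in auto)
    also have "\<dots> \<le> L * (2 * a)" using t t0 L0 by (intro mult_left_mono) auto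
    finally show ?thesis using y0 g1 by (auto simp: g_def abs_le_iff algebra_simps)
  qed
  have "F (t - t0, g t) = f (t, g t)" if "t \<in> {-a..a}" for t
    using gin[OF that] clid[of t] clid[of "g t"] that a by (auto simp: F_def)
  then show ?thesis
    using dg gin g1 by (intro exI[of _ g]) (auto simp: g_def)
qed

text \<open>The inverse function theorem in one variable, used to pass between unit-speed parameters
  and graphs. The new variable is \<open>x t\<close> and \<open>T\<close> recovers the old one.
  Halving the interval makes it compact, as the intermediate value argument and the continuity of
  the inverse require.\<close>

lemma reparam:
  fixes x x' :: "real \<Rightarrow> real"
  assumes e: "e > 0" and der: "\<And>t. t \<in> {-e<..<e} \<Longrightarrow> (x has_real_derivative x' t) (at t)"
    and pos: "\<And>t. t \<in> {-e<..<e} \<Longrightarrow> x' t > 0"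
  obtains d T where "d > 0" "T (x 0) = 0"
    "\<And>s. \<bar>s - x 0\<bar> < d \<Longrightarrow> T s \<in> {-e<..<e} \<and> x (T s) = s \<and> (T has_real_derivative 1 / x' (T s)) (at s)"
    "\<And>t. t \<in> {-e/2..e/2} \<Longrightarrow> T (x t) = t"
proof -
  let ?I = "{-e/2..e/2}"
  have sub: "?I \<subseteq> {-e<..<e}" using e by auto
  have mono: "x s < x t" if "s \<in> ?I" "t \<in> ?I" "s < t" for s t
  proof (rule DERIV_pos_imp_increasing[OF that(3)])
    fix u assume "s \<le> u" "u \<le> t"
    then have "u \<in> {-e<..<e}" using that sub by auto
    then show "\<exists>y. (x has_real_derivative y) (at u) \<and> 0 < y" using der pos by blast
  qed
  have inj: "inj_on x ?I"
    by (rule inj_onI) (metis mono less_irrefl linorder_neqE_linordered_idom)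
  have cont: "continuous_on ?I x"
  proof (rule DERIV_continuous_on)
    fix t assume "t \<in> ?I"
    then have "t \<in> {-e<..<e}" using sub by blast
    then show "(x has_real_derivative x' t) (at t within ?I)"
      by (rule has_field_derivative_at_within[OF der])
  qed
  define T where "T = the_inv_into ?I x"
  have Tx: "T (x t) = t" if "t \<in> ?I" for t
    unfolding T_def by (rule the_inv_into_f_f[OF inj that])
  define d where "d = min (x (e/2) - x 0) (x 0 - x (-e/2))"
  have d: "d > 0" unfolding d_def using mono[of 0 "e/2"] mono[of "-e/2" 0] e by auto
  have main: "T s \<in> {-e<..<e} \<and> x (T s) = s \<and> (T has_real_derivative 1 / x' (T s)) (at s)" if s: "\<bar>s - x 0\<bar> < d" for s
  proof -
    have ss: "x (-e/2) < s" "s < x (e/2)" using s unfolding d_def by auto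
    have ivt: "\<exists>t\<ge>-e/2. t \<le> e/2 \<and> x t = y" if "x (-e/2) \<le> y" "y \<le> x (e/2)" for y
      by (rule IVT'[OF _ _ _ cont]) (use that e in auto)
    then have xT: "T y \<in> ?I \<and> x (T y) = y" if "x (-e/2) \<le> y" "y \<le> x (e/2)" for y
      using that Tx by (metis atLeastAtMost_iff)
    have Ts: "T s \<in> ?I" "x (T s) = s" using xT[of s] ss by auto
    have Ts': "-e/2 < T s" "T s < e/2"
      using Ts ss by (metis atLeastAtMost_iff less_eq_real_def less_irrefl)+
    have "isCont T (x (T s))"
    proof (rule isCont_inverse_function2[OF Ts'])
      fix z assume "-e/2 \<le> z" "z \<le> e/2"
      then have z: "z \<in> ?I" by auto
      show "T (x z) = z" by (rule Tx[OF z])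
      show "isCont x z" by (rule DERIV_isCont[OF der]) (use z sub in blast)
    qed
    then have ct: "isCont T s" using Ts by simp
    have "(T has_real_derivative inverse (x' (T s))) (at s)"
    proof (rule DERIV_inverse_function[OF _ _ ss _ ct])
      show "(x has_real_derivative x' (T s)) (at (T s))" by (rule der) (use Ts sub in blast)
      show "x' (T s) \<noteq> 0" using pos[of "T s"] Ts sub by fastforce
      show "x (T y) = y" if "x (-e/2) < y" "y < x (e/2)" for y using xT[of y] that by auto
    qed
    moreover have "T s \<in> {-e<..<e}" using Ts(1) sub by blast
    ultimately show ?thesis using Ts(2) by (simp only: inverse_eq_divide simp_thms)
  qed
  show ?thesis by (rule that[OF d _ main Tx]) (use Tx[of 0] e in simp_all)
qed

section \<open>Asymptotics of a linear system at an end point\<close>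

text \<open>A bounded derivative makes \<open>f\<close> Lipschitz, hence uniformly continuous on the
  half-open interval, so it extends continuously to \<open>0\<close>.\<close>

lemma bounded_deriv_limit_at_right_0:
  fixes f :: "real \<Rightarrow> real"
  assumes s: "s > 0" and der: "\<And>x. x \<in> {0<..s} \<Longrightarrow> (f has_real_derivative f' x) (at x)"
    and bd: "\<And>x. x \<in> {0<..s} \<Longrightarrow> \<bar>f' x\<bar> \<le> C"
  obtains l where "(f \<longlongrightarrow> l) (at_right 0)"
proof -
  have C: "0 \<le> C" using bd[of s] s by auto
  have "C-lipschitz_on {0<..s} f"
  proof (rule lipschitz_onI[OF _ C])
    fix x y assume xy: "x \<in> {0<..s}" "y \<in> {0<..s}"
    have "norm (f x - f y) \<le> C * norm (x - y)"
    proof (rule field_differentiable_bound[of "{0<..s}" f f'])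
      show "(f has_real_derivative f' z) (at z within {0<..s})" if "z \<in> {0<..s}" for z
        by (rule has_field_derivative_at_within[OF der[OF that]])
    qed (use xy bd in auto)
    then show "dist (f x) (f y) \<le> C * dist x y" by (simp add: dist_real_def)
  qed
  then have "uniformly_continuous_on {0<..s} f" by (rule lipschitz_on_uniformly_continuous)
  then obtain g where g: "uniformly_continuous_on (closure {0<..s}) g" "\<And>x. x \<in> {0<..s} \<Longrightarrow> f x = g x"
    by (rule uniformly_continuous_on_extension_on_closure) metis
  have "continuous_on {0..s} g"
    using uniformly_continuous_imp_continuous[OF g(1)] s by simp
  then have "(g \<longlongrightarrow> g 0) (at_right 0)"
    using s by (simp add: continuous_on_Icc_at_rightD)
  then have "(f \<longlongrightarrow> g 0) (at_right 0)"
    by (rule Lim_transform_eventually)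
       (use s g(2) in \<open>auto simp: eventually_at_right_field intro!: exI[of _ s]\<close>)
  then show ?thesis by (rule that)
qed

text \<open>The energy \<open>E = J\<^sup>2 + V\<^sup>2\<close> satisfies
  \<open>\<bar>E'\<bar> \<le> (1 + M) * E\<close>, and Gronwall from \<open>s\<close> to
  \<open>x\<close> and back gives both bounds with a constant independent of \<open>x\<close>. The
  second bound is what forbids \<open>J\<close> and \<open>V\<close> to tend to \<open>0\<close>
  together. The sign \<open>\<sigma>\<close> records whether the variable runs with or against the
  parameter in which \<open>J' = V\<close>.\<close>

lemma linear_ode_energy_bounds:
  fixes J V K :: "real \<Rightarrow> real"
  assumes s: "s > 0" and sg: "\<bar>\<sigma>\<bar> = 1"
    and dJ: "\<And>x. x \<in> {0<..s} \<Longrightarrow> (J has_real_derivative \<sigma> * V x) (at x)"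
    and dV: "\<And>x. x \<in> {0<..s} \<Longrightarrow> (V has_real_derivative - \<sigma> * K x * J x) (at x)"
    and K: "\<And>x. x \<in> {0<..s} \<Longrightarrow> \<bar>K x\<bar> \<le> M"
  obtains C where "C > 0" "\<And>x. x \<in> {0<..s} \<Longrightarrow> (J x)\<^sup>2 + (V x)\<^sup>2 \<le> C * ((J s)\<^sup>2 + (V s)\<^sup>2)"
    "\<And>x. x \<in> {0<..s} \<Longrightarrow> (J s)\<^sup>2 + (V s)\<^sup>2 \<le> C * ((J x)\<^sup>2 + (V x)\<^sup>2)"
proof -
  define E where "E x = (J x)\<^sup>2 + (V x)\<^sup>2" for x
  define E' where "E' x = 2 * \<sigma> * J x * V x * (1 - K x)" for x
  have M0: "0 \<le> M" using K[of s] s by auto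
  have dE: "(E has_real_derivative E' x) (at x)" if "x \<in> {0<..s}" for x
    unfolding E_def[abs_def] E'_def
    by (rule derivative_eq_intros dJ[OF that] dV[OF that] refl | simp add: algebra_simps)+
  have bE: "\<bar>E' x\<bar> \<le> (1 + M) * \<bar>E x\<bar>" if "x \<in> {0<..s}" for x
  proof -
    have "\<bar>E' x\<bar> = (2 * \<bar>J x\<bar> * \<bar>V x\<bar>) * \<bar>1 - K x\<bar>" by (simp add: E'_def abs_mult sg)
    also have "\<dots> \<le> E x * (1 + M)"
    proof (rule mult_mono)
      have "0 \<le> (\<bar>J x\<bar> - \<bar>V x\<bar>)\<^sup>2" by simp
      then show "2 * \<bar>J x\<bar> * \<bar>V x\<bar> \<le> E x" by (simp add: E_def power2_diff)
      show "\<bar>1 - K x\<bar> \<le> 1 + M" using K[OF that] by auto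
    qed (auto simp: E_def)
    finally show ?thesis by (simp add: E_def mult.commute)
  qed
  have g: "\<bar>E v\<bar> \<le> \<bar>E u\<bar> * exp ((1 + M) * s)" if "u \<in> {0<..s}" "v \<in> {0<..s}" for u v
  proof -
    have "\<bar>E v\<bar> \<le> \<bar>E u\<bar> * exp ((1 + M) * \<bar>v - u\<bar>)"
    proof (rule gronwall_abs[where a="min u v" and b=s and f'=E'])
      fix x assume "x \<in> {min u v..s}"
      then have x: "x \<in> {0<..s}" using that by auto
      show "(E has_real_derivative E' x) (at x within {min u v..s})"
        by (rule has_field_derivative_at_within[OF dE[OF x]])
      show "\<bar>E' x\<bar> \<le> (1 + M) * \<bar>E x\<bar>" by (rule bE[OF x])
    qed (use that in auto)
    also have "\<dots> \<le> \<bar>E u\<bar> * exp ((1 + M) * s)"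
      using that M0 by (intro mult_left_mono) auto
    finally show ?thesis .
  qed
  show ?thesis
  proof (rule that[of "exp ((1 + M) * s)"])
    fix x assume x: "x \<in> {0<..s}"
    show "(J x)\<^sup>2 + (V x)\<^sup>2 \<le> exp ((1 + M) * s) * ((J s)\<^sup>2 + (V s)\<^sup>2)"
      using g[of s x] x s by (simp add: E_def mult.commute)
    show "(J s)\<^sup>2 + (V s)\<^sup>2 \<le> exp ((1 + M) * s) * ((J x)\<^sup>2 + (V x)\<^sup>2)"
      using g[of x s] x s by (simp add: E_def mult.commute)
  qed simp
qed

text \<open>By the energy bounds \<open>J\<close> and \<open>V\<close> have limits \<open>J0\<close>
  and \<open>V0\<close>, not both zero. L'Hopital's rule for \<open>D * J\<close> gives
  \<open>D / x\<close> the limit \<open>\<sigma> * c0\<close> if \<open>J0 \<noteq> 0\<close>, and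
  \<open>\<sigma> * c0 / 2\<close> if \<open>J0 = 0\<close>, since then \<open>J\<close> is of order
  \<open>x\<close> and \<open>D * J\<close> of order \<open>x\<^sup>2\<close>. As
  \<open>D > 0\<close> and \<open>c0 \<noteq> 0\<close>, either limit fixes the sign of
  \<open>\<sigma> * c0\<close>.\<close>

lemma endpoint_asymptotics:
  fixes J V K D c :: "real \<Rightarrow> real"
  assumes s: "s > 0" and sg: "\<bar>\<sigma>\<bar> = 1"
    and dJ: "\<And>x. x \<in> {0<..s} \<Longrightarrow> (J has_real_derivative \<sigma> * V x) (at x)"
    and dV: "\<And>x. x \<in> {0<..s} \<Longrightarrow> (V has_real_derivative - \<sigma> * K x * J x) (at x)"
    and dDJ: "\<And>x. x \<in> {0<..s} \<Longrightarrow> ((\<lambda>x. D x * J x) has_real_derivative \<sigma> * c x * J x) (at x)"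
    and K: "\<And>x. x \<in> {0<..s} \<Longrightarrow> \<bar>K x\<bar> \<le> M"
    and Jpos: "\<And>x. x \<in> {0<..s} \<Longrightarrow> J x > 0" and Dpos: "\<And>x. x \<in> {0<..s} \<Longrightarrow> D x > 0"
    and c: "(c \<longlongrightarrow> c0) (at_right 0)" "c0 \<noteq> 0" and D: "(D \<longlongrightarrow> 0) (at_right 0)"
  shows "\<sigma> * c0 > 0"
    "((\<lambda>x. c x - D x * V x / J x) \<longlongrightarrow> c0 / 2) (at_right 0) \<or>
     ((\<lambda>x. c x - D x * V x / J x) \<longlongrightarrow> c0) (at_right 0)"
proof -
  obtain C where C: "C > 0" "\<And>x. x \<in> {0<..s} \<Longrightarrow> (J x)\<^sup>2 + (V x)\<^sup>2 \<le> C * ((J s)\<^sup>2 + (V s)\<^sup>2)"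
    "\<And>x. x \<in> {0<..s} \<Longrightarrow> (J s)\<^sup>2 + (V s)\<^sup>2 \<le> C * ((J x)\<^sup>2 + (V x)\<^sup>2)"
    using linear_ode_energy_bounds[OF s sg dJ dV K] by metis
  define G where "G = sqrt (C * ((J s)\<^sup>2 + (V s)\<^sup>2))"
  have Jb: "\<bar>J x\<bar> \<le> G" and Vb: "\<bar>V x\<bar> \<le> G" if "x \<in> {0<..s}" for x
  proof -
    have "(J x)\<^sup>2 \<le> C * ((J s)\<^sup>2 + (V s)\<^sup>2)" "(V x)\<^sup>2 \<le> C * ((J s)\<^sup>2 + (V s)\<^sup>2)"
      using C(2)[OF that] zero_le_power2[of "J x"] zero_le_power2[of "V x"] by linarith+
    then show "\<bar>J x\<bar> \<le> G" "\<bar>V x\<bar> \<le> G" unfolding G_def by (auto intro!: real_le_rsqrt)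
  qed
  have ev: "eventually (\<lambda>x. x \<in> {0<..s}) (at_right 0)"
    using s by (auto simp: eventually_at_right_field intro!: exI[of _ s])
  obtain J0 where J0: "(J \<longlongrightarrow> J0) (at_right 0)"
    by (rule bounded_deriv_limit_at_right_0[OF s dJ, of G]) (use Vb sg in \<open>auto simp: abs_mult\<close>)
  have "\<bar>- \<sigma> * K x * J x\<bar> \<le> M * G" if "x \<in> {0<..s}" for x
    using Jb[OF that] K[OF that] sg by (auto simp: abs_mult intro!: mult_mono)
  from bounded_deriv_limit_at_right_0[OF s dV this]
  obtain V0 where V0: "(V \<longlongrightarrow> V0) (at_right 0)" by metis
  have "(J s)\<^sup>2 + (V s)\<^sup>2 \<le> C * (J0\<^sup>2 + V0\<^sup>2)"
  proof (rule tendsto_lowerbound)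
    show "((\<lambda>x. C * ((J x)\<^sup>2 + (V x)\<^sup>2)) \<longlongrightarrow> C * (J0\<^sup>2 + V0\<^sup>2)) (at_right 0)"
      by (intro tendsto_intros J0 V0)
    show "\<forall>\<^sub>F x in at_right 0. (J s)\<^sup>2 + (V s)\<^sup>2 \<le> C * ((J x)\<^sup>2 + (V x)\<^sup>2)"
      using ev by eventually_elim (rule C(3))
  qed simp
  moreover have "0 < (J s)\<^sup>2 + (V s)\<^sup>2"
    using Jpos[of s] s by (simp add: add_pos_nonneg)
  ultimately have nz: "\<not> (J0 = 0 \<and> V0 = 0)" by auto
  have DJ0: "((\<lambda>x. D x * J x) \<longlongrightarrow> 0) (at_right 0)"
    using tendsto_mult[OF D J0] by simp
  have cJ: "((\<lambda>x. \<sigma> * c x * J x) \<longlongrightarrow> \<sigma> * c0 * J0) (at_right 0)"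
    by (intro tendsto_intros J0 c)
  have id0: "((\<lambda>x::real. x) \<longlongrightarrow> 0) (at_right 0)" by (simp add: tendsto_ident_at)
  have evd: "eventually (\<lambda>x. ((\<lambda>x. D x * J x) has_real_derivative \<sigma> * c x * J x) (at x)) (at_right 0)"
    using ev by eventually_elim (rule dDJ)
  have Dx: "eventually (\<lambda>x. 0 \<le> D x / x) (at_right 0)"
    using ev by eventually_elim (use Dpos in \<open>auto intro!: divide_nonneg_nonneg less_imp_le\<close>)
  have "\<sigma> * c0 > 0 \<and> (((\<lambda>x. c x - D x * V x / J x) \<longlongrightarrow> c0 / 2) (at_right 0) \<or>
     ((\<lambda>x. c x - D x * V x / J x) \<longlongrightarrow> c0) (at_right 0))"
  proof (cases "J0 = 0")
    case False
    have "((\<lambda>x. (D x * J x) / x) \<longlongrightarrow> \<sigma> * c0 * J0) (at_right 0)"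
      by (rule lhopital_right_0[OF DJ0 id0 _ _ evd, where g'="\<lambda>_. 1"])
         (use cJ ev in \<open>auto elim!: eventually_mono\<close>)
    then have "((\<lambda>x. (D x * J x) / x / J x) \<longlongrightarrow> \<sigma> * c0 * J0 / J0) (at_right 0)"
      by (rule tendsto_divide[OF _ J0 False])
    then have "((\<lambda>x. D x / x) \<longlongrightarrow> \<sigma> * c0 * J0 / J0) (at_right 0)"
      by (rule Lim_transform_eventually) (use ev in \<open>eventually_elim, use Jpos in force\<close>)
    then have "((\<lambda>x. D x / x) \<longlongrightarrow> \<sigma> * c0) (at_right 0)" using False by simp
    then have "0 \<le> \<sigma> * c0" by (rule tendsto_lowerbound[OF _ Dx]) simp
    then have pos: "0 < \<sigma> * c0" using c(2) sg by (auto simp: less_le)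
    have "((\<lambda>x. c x - D x * V x / J x) \<longlongrightarrow> c0 - 0 * V0 / J0) (at_right 0)"
      by (intro tendsto_intros c D V0 J0 False)
    then show ?thesis using pos by auto
  next
    case True
    then have V0nz: "V0 \<noteq> 0" using nz by simp
    have Jx: "((\<lambda>x. J x / x) \<longlongrightarrow> \<sigma> * V0) (at_right 0)"
    proof (rule lhopital_right_0[where f'="\<lambda>x. \<sigma> * V x" and g'="\<lambda>_. 1"])
      show "(J \<longlongrightarrow> 0) (at_right 0)" using J0 True by simp
      show "\<forall>\<^sub>F x in at_right 0. (J has_real_derivative \<sigma> * V x) (at x)"
        using ev by eventually_elim (rule dJ)
      show "((\<lambda>x. \<sigma> * V x / 1) \<longlongrightarrow> \<sigma> * V0) (at_right 0)"
        using V0 by (auto intro!: tendsto_intros)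
    qed (use ev id0 in \<open>auto elim!: eventually_mono\<close>)
    \<comment> \<open>The derivative \<open>\<sigma> * c * J\<close> of \<open>D * J\<close> is
      itself of first order here. The factor \<open>2\<close> from differentiating
      \<open>x\<^sup>2\<close> is the origin of \<open>c0 / 2\<close>.\<close>
    have DJx: "((\<lambda>x. (D x * J x) / x\<^sup>2) \<longlongrightarrow> \<sigma> * c0 * (\<sigma> * V0) / 2) (at_right 0)"
    proof (rule lhopital_right_0[OF DJ0 _ _ _ evd, where g'="\<lambda>x. 2 * x"])
      show "((\<lambda>x::real. x\<^sup>2) \<longlongrightarrow> 0) (at_right 0)" using tendsto_power[OF id0, of 2] by simp
      show "\<forall>\<^sub>F x in at_right 0. ((\<lambda>x::real. x\<^sup>2) has_real_derivative 2 * x) (at x)"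
        by (rule always_eventually) (auto intro!: derivative_eq_intros)
      have "((\<lambda>x. \<sigma> * c x * (J x / x) / 2) \<longlongrightarrow> \<sigma> * c0 * (\<sigma> * V0) / 2) (at_right 0)"
        by (intro tendsto_intros c Jx) auto
      then show "((\<lambda>x. \<sigma> * c x * J x / (2 * x)) \<longlongrightarrow> \<sigma> * c0 * (\<sigma> * V0) / 2) (at_right 0)"
        by (simp add: mult.commute)
    qed (use ev in \<open>auto elim!: eventually_mono\<close>)
    have sV: "\<sigma> * V0 \<noteq> 0" using V0nz sg by auto
    have "((\<lambda>x. (D x * J x) / x\<^sup>2 / (J x / x)) \<longlongrightarrow> \<sigma> * c0 * (\<sigma> * V0) / 2 / (\<sigma> * V0)) (at_right 0)"
      by (rule tendsto_divide[OF DJx Jx sV])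
    then have "((\<lambda>x. D x / x) \<longlongrightarrow> \<sigma> * c0 * (\<sigma> * V0) / 2 / (\<sigma> * V0)) (at_right 0)"
      by (rule Lim_transform_eventually)
         (use ev in \<open>eventually_elim, use Jpos in \<open>force simp: power2_eq_square\<close>\<close>)
    then have Dl: "((\<lambda>x. D x / x) \<longlongrightarrow> \<sigma> * c0 / 2) (at_right 0)" using V0nz sg by auto
    then have "0 \<le> \<sigma> * c0 / 2" by (rule tendsto_lowerbound[OF _ Dx]) simp
    then have pos: "0 < \<sigma> * c0" using c(2) sg by (auto simp: less_le)
    \<comment> \<open>Both \<open>D\<close> and \<open>J\<close> tend to \<open>0\<close>, so both
      are divided by \<open>x\<close> before the limit of \<open>D * V / J\<close> is taken.\<close>
    have "((\<lambda>x. c x - (D x / x) * V x / (J x / x)) \<longlongrightarrow> c0 - (\<sigma> * c0 / 2) * V0 / (\<sigma> * V0)) (at_right 0)"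
      by (intro tendsto_intros c Dl V0 Jx sV)
    then have "((\<lambda>x. c x - D x * V x / J x) \<longlongrightarrow> c0 - (\<sigma> * c0 / 2) * V0 / (\<sigma> * V0)) (at_right 0)"
      by (rule Lim_transform_eventually) (use ev in \<open>eventually_elim, force\<close>)
    moreover have "c0 - (\<sigma> * c0 / 2) * V0 / (\<sigma> * V0) = c0 / 2"
      using V0nz sg by (auto simp: field_simps)
    ultimately have "((\<lambda>x. c x - D x * V x / J x) \<longlongrightarrow> c0 / 2) (at_right 0)" by (simp only:)
    then show ?thesis using pos by blast
  qed
  then show "\<sigma> * c0 > 0"
    "((\<lambda>x. c x - D x * V x / J x) \<longlongrightarrow> c0 / 2) (at_right 0) \<or>
     ((\<lambda>x. c x - D x * V x / J x) \<longlongrightarrow> c0) (at_right 0)" by auto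
qed

section \<open>Fluxes through graphs\<close>

abbreviation sq :: "real \<Rightarrow> (real \<times> real) set" where
  "sq r \<equiv> {-r..r} \<times> {-r..r}"

abbreviation swp :: "(real \<times> real \<Rightarrow> real) \<Rightarrow> real \<times> real \<Rightarrow> real" where
  "swp f \<equiv> (\<lambda>p. f (snd p, fst p))"

text \<open>\<open>\<partial>a/\<partial>x + \<partial>b/\<partial>y = k\<close>, integrated over all subrectangles, for fields that are merely continuous.\<close>

definition flux_id :: "real \<Rightarrow> (real \<times> real \<Rightarrow> real) \<Rightarrow> (real \<times> real \<Rightarrow> real) \<Rightarrow> (real \<times> real \<Rightarrow> real) \<Rightarrow> bool" where
  "flux_id r a b k \<longleftrightarrow> (\<forall>x1 x2 y1 y2. x1 \<in> {-r..r} \<and> x2 \<in> {-r..r} \<and> x1 \<le> x2 \<and> y1 \<in> {-r..r} \<and> y2 \<in> {-r..r} \<and> y1 \<le> y2 \<longrightarrow>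
     integral {y1..y2} (\<lambda>y. a (x2, y) - a (x1, y)) + integral {x1..x2} (\<lambda>x. b (x, y2) - b (x, y1))
     = integral {x1..x2} (\<lambda>x. integral {y1..y2} (\<lambda>y. k (x, y))))"

lemma continuous_on_swp:
  assumes "continuous_on (sq r) f" shows "continuous_on (sq r) (swp f)"
  by (rule continuous_on_pairI[OF assms]) (auto intro!: continuous_intros)

lemma continuous_on_slice:
  fixes f :: "real \<times> real \<Rightarrow> real"
  assumes "continuous_on (sq r) f" "x \<in> {-r..r}"
  shows "continuous_on {-r..r} (\<lambda>y. f (x, y))" "continuous_on {-r..r} (\<lambda>y. f (y, x))"
  by (rule continuous_on_pairI[OF assms(1)]; use assms in \<open>auto intro!: continuous_intros\<close>)+

lemma continuous_on_slice_seg: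
  fixes f :: "real \<times> real \<Rightarrow> real"
  assumes "continuous_on (sq r) f" "x \<in> {-r..r}" "u \<in> {-r..r}" "v \<in> {-r..r}"
  shows "continuous_on (closed_segment u v) (\<lambda>y. f (x, y))" "continuous_on (closed_segment u v) (\<lambda>y. f (y, x))"
  using continuous_on_slice[OF assms(1,2)] closed_segment_subset_Icc[OF assms(3,4)]
  by (auto elim: continuous_on_subset)

lemma integral_slice_swap:
  fixes k :: "real \<times> real \<Rightarrow> real"
  assumes "continuous_on (sq r) k" "{x1..x2} \<subseteq> {-r..r}" "{y1..y2} \<subseteq> {-r..r}"
  shows "integral {x1..x2} (\<lambda>x. integral {y1..y2} (\<lambda>y. k (x, y)))
    = integral {y1..y2} (\<lambda>y. integral {x1..x2} (\<lambda>x. k (x, y)))"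
proof -
  have "continuous_on (cbox (x1, y1) (x2, y2)) (\<lambda>(x, y). k (x, y))"
    using assms by (auto simp: cbox_Pair_eq intro!: continuous_on_subset[OF assms(1)])
  from integral_swap_continuous[OF this] show ?thesis by simp
qed

text \<open>Reflection in the diagonal exchanges the components and keeps the divergence. It lets
  the results on graphs over the first axis serve for graphs over the second.\<close>

lemma flux_id_swap:
  assumes fl: "flux_id r a b k" and k: "continuous_on (sq r) k"
  shows "flux_id r (swp b) (swp a) (swp k)"
  unfolding flux_id_def
proof (intro allI impI)
  fix x1 x2 y1 y2 :: real
  assume h: "x1 \<in> {-r..r} \<and> x2 \<in> {-r..r} \<and> x1 \<le> x2 \<and> y1 \<in> {-r..r} \<and> y2 \<in> {-r..r} \<and> y1 \<le> y2"
  have "integral {y1..y2} (\<lambda>x. integral {x1..x2} (\<lambda>y. k (x, y)))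
      = integral {x1..x2} (\<lambda>y. integral {y1..y2} (\<lambda>x. k (x, y)))"
    by (rule integral_slice_swap[OF k]) (use h in auto)
  moreover have "integral {x1..x2} (\<lambda>y. a (y2, y) - a (y1, y)) + integral {y1..y2} (\<lambda>x. b (x, x2) - b (x, x1))
     = integral {y1..y2} (\<lambda>x. integral {x1..x2} (\<lambda>y. k (x, y)))"
    using fl h unfolding flux_id_def by blast
  ultimately show "integral {y1..y2} (\<lambda>y. swp b (x2, y) - swp b (x1, y)) + integral {x1..x2} (\<lambda>x. swp a (x, y2) - swp a (x, y1))
     = integral {x1..x2} (\<lambda>x. integral {y1..y2} (\<lambda>y. swp k (x, y)))"
    by simp
qed

lemma bounded_on_sq:
  fixes f :: "real \<times> real \<Rightarrow> real"
  assumes "continuous_on (sq r) f"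
  obtains C where "C > 0" "\<And>x y. x \<in> {-r..r} \<Longrightarrow> y \<in> {-r..r} \<Longrightarrow> \<bar>f (x, y)\<bar> \<le> C"
proof -
  have "compact (f ` sq r)"
    by (rule compact_continuous_image[OF assms]) (auto intro!: compact_Times)
  then obtain C where "C > 0" "\<forall>z\<in>f ` sq r. norm z \<le> C"
    using bounded_pos compact_imp_bounded by metis
  then show ?thesis using that[of C] by auto
qed

lemma uniform_on_sq:
  fixes f :: "real \<times> real \<Rightarrow> real"
  assumes "continuous_on (sq r) f" "e > 0"
  obtains d where "d > 0"
    "\<And>x y x' y'. x \<in> {-r..r} \<Longrightarrow> y \<in> {-r..r} \<Longrightarrow> x' \<in> {-r..r} \<Longrightarrow> y' \<in> {-r..r} \<Longrightarrow>
      \<bar>x - x'\<bar> < d \<Longrightarrow> \<bar>y - y'\<bar> < d \<Longrightarrow> \<bar>f (x, y) - f (x', y')\<bar> < e"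
proof -
  have "uniformly_continuous_on (sq r) f"
    by (rule compact_uniformly_continuous[OF assms(1)]) (auto intro!: compact_Times)
  then obtain d where d: "d > 0" "\<And>p q. p \<in> sq r \<Longrightarrow> q \<in> sq r \<Longrightarrow> dist q p < d \<Longrightarrow> dist (f q) (f p) < e"
    using assms(2) unfolding uniformly_continuous_on_def by metis
  show ?thesis
  proof (rule that[of "d/2"])
    fix x y x' y' :: real
    assume h: "x \<in> {-r..r}" "y \<in> {-r..r}" "x' \<in> {-r..r}" "y' \<in> {-r..r}" "\<bar>x - x'\<bar> < d/2" "\<bar>y - y'\<bar> < d/2"
    have "dist (x, y) (x', y') \<le> \<bar>x - x'\<bar> + \<bar>y - y'\<bar>"
      unfolding dist_Pair_Pair dist_real_def by (rule order_trans[OF sqrt_sum_squares_le_sum_abs]) simp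
    then show "\<bar>f (x, y) - f (x', y')\<bar> < e"
      using d(2)[of "(x', y')" "(x, y)"] h by (auto simp: dist_real_def)
  qed (use d in auto)
qed

section \<open>Differentiation of fluxes between moving graphs\<close>

text \<open>At \<open>t = x\<close> the interval shrinks to a point, so the change of the integrand
  with \<open>t\<close> contributes nothing to first order and no derivative of \<open>a\<close> is
  needed. The integral is a mean value \<open>\<phi> t\<close> of \<open>a\<close> times
  \<open>g t - g x\<close>.\<close>

lemma SI_moving_deriv:
  fixes a :: "real \<times> real \<Rightarrow> real"
  assumes a: "continuous_on (sq r) a" and I: "I \<subseteq> {-r..r}" and x: "x \<in> I"
    and g: "(g has_real_derivative d) (at x within I)" and gr: "\<And>t. t \<in> I \<Longrightarrow> g t \<in> {-r..r}"
  shows "((\<lambda>t. SI (\<lambda>y. a (t, y)) (g x) (g t)) has_real_derivative a (x, g x) * d) (at x within I)"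
proof -
  \<comment> \<open>The value for \<open>g t = g x\<close> is the limit of the mean values; it
    matters because \<open>g\<close> may return to \<open>g x\<close> arbitrarily close to
    \<open>x\<close>.\<close>
  define \<phi> where "\<phi> t = (if g t = g x then a (x, g x) else SI (\<lambda>y. a (t, y)) (g x) (g t) / (g t - g x))" for t
  have eq: "SI (\<lambda>y. a (t, y)) (g x) (g t) = \<phi> t * (g t - g x)" for t
    by (auto simp: \<phi>_def)
  have gc: "(g \<longlongrightarrow> g x) (at x within I)"
    using DERIV_continuous[OF g] by (simp add: continuous_within)
  have "(\<phi> \<longlongrightarrow> a (x, g x)) (at x within I)"
  proof (rule tendstoI)
    fix e :: real assume e: "0 < e"
    then have e2: "0 < e / 2" by simp
    obtain \<delta> where \<delta>: "\<delta> > 0"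
      "\<And>x y x' y'. x \<in> {-r..r} \<Longrightarrow> y \<in> {-r..r} \<Longrightarrow> x' \<in> {-r..r} \<Longrightarrow> y' \<in> {-r..r} \<Longrightarrow>
      \<bar>x - x'\<bar> < \<delta> \<Longrightarrow> \<bar>y - y'\<bar> < \<delta> \<Longrightarrow> \<bar>a (x, y) - a (x', y')\<bar> < e / 2"
      using uniform_on_sq[OF a e2] by metis
    have ev1: "\<forall>\<^sub>F t in at x within I. \<bar>g t - g x\<bar> < \<delta>"
      using tendstoD[OF gc \<delta>(1)] by (simp add: dist_real_def)
    have ev2: "\<forall>\<^sub>F t in at x within I. t \<in> I \<and> \<bar>t - x\<bar> < \<delta>"
      using \<delta>(1) by (auto simp: eventually_at dist_real_def)
    show "\<forall>\<^sub>F t in at x within I. dist (\<phi> t) (a (x, g x)) < e"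
      using ev1 ev2
    proof eventually_elim
      case (elim t)
      have sr: "t \<in> {-r..r}" "x \<in> {-r..r}" "g t \<in> {-r..r}" "g x \<in> {-r..r}" using elim x I gr by auto
      have "\<bar>SI (\<lambda>y. a (t, y)) (g x) (g t) - a (x, g x) * (g t - g x)\<bar> \<le> e / 2 * \<bar>g t - g x\<bar>"
      proof (rule SI_approx)
        show "continuous_on (closed_segment (g x) (g t)) (\<lambda>y. a (t, y))"
          by (rule continuous_on_slice_seg[OF a]) (use sr in auto)
        fix y assume y: "y \<in> closed_segment (g x) (g t)"
        then have "y \<in> {-r..r}" using closed_segment_subset_Icc[OF sr(4,3)] by blast
        moreover have "\<bar>y - g x\<bar> \<le> \<bar>g t - g x\<bar>"
          using y by (auto simp: closed_segment_eq_real_ivl split: if_splits)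
        ultimately show "\<bar>a (t, y) - a (x, g x)\<bar> \<le> e / 2"
          using \<delta>(2)[of t y x "g x"] sr elim by auto
      qed
      then have "\<bar>(\<phi> t - a (x, g x)) * (g t - g x)\<bar> \<le> e / 2 * \<bar>g t - g x\<bar>"
        by (simp add: eq left_diff_distrib)
      then have "g t = g x \<or> \<bar>\<phi> t - a (x, g x)\<bar> \<le> e / 2"
        unfolding abs_mult by (metis abs_eq_0_iff eq_iff_diff_eq_0 mult_le_cancel_right_pos zero_less_abs_iff)
      then show ?case using e by (auto simp: dist_real_def \<phi>_def)
    qed
  qed
  then have "((\<lambda>t. \<phi> t * ((g t - g x) / (t - x))) \<longlongrightarrow> a (x, g x) * d) (at x within I)"
    using g unfolding has_field_derivative_iff by (rule tendsto_mult)
  then show ?thesis unfolding has_field_derivative_iff by (simp add: eq)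
qed

lemma SI_param_continuous_fixed:
  fixes k :: "real \<times> real \<Rightarrow> real"
  assumes k: "continuous_on (sq r) k" and "u \<in> {-r..r}" "v \<in> {-r..r}"
  shows "continuous_on {-r..r} (\<lambda>t. SI (\<lambda>y. k (t, y)) u v)"
proof -
  have *: "continuous_on {-r..r} (\<lambda>t. integral (cbox x y) (\<lambda>z. k (t, z)))" if "{x..y} \<subseteq> {-r..r}" for x y
    by (rule integral_continuous_on_param) (use that in \<open>auto intro!: continuous_on_subset[OF k]\<close>)
  show ?thesis
    using *[of u v] *[of v u] assms by (cases "u \<le> v") (auto simp: SI_def intro!: continuous_intros)
qed

lemma SI_decomp:
  fixes k :: "real \<times> real \<Rightarrow> real"
  assumes "continuous_on (sq r) k" "t \<in> {-r..r}" "u \<in> {-r..r}" "v \<in> {-r..r}" "u' \<in> {-r..r}" "v' \<in> {-r..r}"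
  shows "SI (\<lambda>y. k (t, y)) u' v' = SI (\<lambda>y. k (t, y)) u v + SI (\<lambda>y. k (t, y)) v v' - SI (\<lambda>y. k (t, y)) u u'"
  using SI_eq_diff[OF continuous_on_slice(1)[OF assms(1,2)]] assms by simp

lemma SI_param_continuous:
  fixes k :: "real \<times> real \<Rightarrow> real"
  assumes k: "continuous_on (sq r) k" and I: "I \<subseteq> {-r..r}"
    and g: "continuous_on I g0" "continuous_on I g1"
    and gr: "\<And>t. t \<in> I \<Longrightarrow> g0 t \<in> {-r..r}" "\<And>t. t \<in> I \<Longrightarrow> g1 t \<in> {-r..r}"
  shows "continuous_on I (\<lambda>t. SI (\<lambda>y. k (t, y)) (g0 t) (g1 t))"
  unfolding continuous_on_def
proof
  fix x assume x: "x \<in> I"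
  obtain C where C: "C > 0" "\<And>x y. x \<in> {-r..r} \<Longrightarrow> y \<in> {-r..r} \<Longrightarrow> \<bar>k (x, y)\<bar> \<le> C"
    using bounded_on_sq[OF k] by metis
  have ev: "eventually (\<lambda>t. t \<in> I) (at x within I)"
    by (auto simp: eventually_at intro!: exI[of _ 1])
  have small: "((\<lambda>t. SI (\<lambda>y. k (t, y)) (g x) (g t)) \<longlongrightarrow> 0) (at x within I)"
    if "continuous_on I g" "\<And>t. t \<in> I \<Longrightarrow> g t \<in> {-r..r}" for g
  proof (rule Lim_null_comparison)
    show "\<forall>\<^sub>F t in at x within I. norm (SI (\<lambda>y. k (t, y)) (g x) (g t)) \<le> C * \<bar>g t - g x\<bar>"
      using ev
    proof eventually_elim
      case (elim t)
      have sr: "t \<in> {-r..r}" "g t \<in> {-r..r}" "g x \<in> {-r..r}" using elim x I that by auto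
      have "\<bar>SI (\<lambda>y. k (t, y)) (g x) (g t)\<bar> \<le> C * \<bar>g t - g x\<bar>"
      proof (rule SI_abs_le)
        show "continuous_on (closed_segment (g x) (g t)) (\<lambda>y. k (t, y))"
          by (rule continuous_on_slice_seg[OF k]) (use sr in auto)
        show "\<bar>k (t, y)\<bar> \<le> C" if "y \<in> closed_segment (g x) (g t)" for y
          using that closed_segment_subset_Icc[OF sr(3,2)] C(2) sr by blast
      qed
      then show ?case by simp
    qed
    have "(g \<longlongrightarrow> g x) (at x within I)" using that(1) x by (simp add: continuous_on_def)
    then have "((\<lambda>t. C * \<bar>g t - g x\<bar>) \<longlongrightarrow> C * \<bar>g x - g x\<bar>) (at x within I)"
      by (intro tendsto_intros)
    then show "((\<lambda>t. C * \<bar>g t - g x\<bar>) \<longlongrightarrow> 0) (at x within I)" by simp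
  qed
  have "continuous_on I (\<lambda>t. SI (\<lambda>y. k (t, y)) (g0 x) (g1 x))"
    by (rule continuous_on_subset[OF SI_param_continuous_fixed[OF k] I]) (use gr x in auto)
  then have "((\<lambda>t. SI (\<lambda>y. k (t, y)) (g0 x) (g1 x)) \<longlongrightarrow> SI (\<lambda>y. k (x, y)) (g0 x) (g1 x)) (at x within I)"
    using x by (simp add: continuous_on_def)
  from tendsto_diff[OF tendsto_add[OF this small[OF g(2) gr(2)]] small[OF g(1) gr(1)]]
  have "((\<lambda>t. SI (\<lambda>y. k (t, y)) (g0 x) (g1 x) + SI (\<lambda>y. k (t, y)) (g1 x) (g1 t) - SI (\<lambda>y. k (t, y)) (g0 x) (g0 t))
      \<longlongrightarrow> SI (\<lambda>y. k (x, y)) (g0 x) (g1 x)) (at x within I)" by simp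
  then show "((\<lambda>t. SI (\<lambda>y. k (t, y)) (g0 t) (g1 t)) \<longlongrightarrow> SI (\<lambda>y. k (x, y)) (g0 x) (g1 x)) (at x within I)"
  proof (rule Lim_transform_eventually)
    show "\<forall>\<^sub>F t in at x within I. SI (\<lambda>y. k (t, y)) (g0 x) (g1 x) + SI (\<lambda>y. k (t, y)) (g1 x) (g1 t) - SI (\<lambda>y. k (t, y)) (g0 x) (g0 t) = SI (\<lambda>y. k (t, y)) (g0 t) (g1 t)"
      using ev
    proof eventually_elim
      case (elim t)
      have "SI (\<lambda>y. k (t, y)) (g0 t) (g1 t) = SI (\<lambda>y. k (t, y)) (g0 x) (g1 x) + SI (\<lambda>y. k (t, y)) (g1 x) (g1 t) - SI (\<lambda>y. k (t, y)) (g0 x) (g0 t)"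
        by (rule SI_decomp[OF k]) (use elim x I gr in auto)
      then show ?case by simp
    qed
  qed
qed

text \<open>The balance over \<open>{-r..t} \<times> {u..v}\<close> shows the flux through the
  vertical segment at \<open>t\<close> to be an indefinite integral of a continuous function. This
  turns the integrated divergence identity into a pointwise derivative without differentiating
  \<open>a\<close> or \<open>b\<close>.\<close>

lemma flux_deriv_fixed:
  assumes fl: "flux_id r a b k" and c: "continuous_on (sq r) a" "continuous_on (sq r) b" "continuous_on (sq r) k"
    and uv: "u \<in> {-r..r}" "v \<in> {-r..r}" and x: "x \<in> {-r..r}"
  shows "((\<lambda>t. SI (\<lambda>y. a (t, y)) u v) has_real_derivative
      SI (\<lambda>y. k (x, y)) u v - (b (x, v) - b (x, u))) (at x within {-r..r})"
proof -
  have r: "-r \<in> {-r..r}" using x by auto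
  have main: "((\<lambda>t. SI (\<lambda>y. a (t, y)) u v) has_real_derivative
      SI (\<lambda>y. k (x, y)) u v - (b (x, v) - b (x, u))) (at x within {-r..r})"
    if uv: "u \<in> {-r..r}" "v \<in> {-r..r}" "u \<le> v" for u v
  proof -
    define f where "f t = SI (\<lambda>y. k (t, y)) u v - (b (t, v) - b (t, u))" for t
    have cf: "continuous_on {-r..r} f"
      unfolding f_def by (intro continuous_intros SI_param_continuous_fixed continuous_on_slice c uv)
    have eq: "SI (\<lambda>y. a (t, y)) u v = SI (\<lambda>y. a (-r, y)) u v + integral {-r..t} f" if t: "t \<in> {-r..r}" for t
    proof -
      have i: "(\<lambda>y. a (z, y)) integrable_on {u..v}" if "z \<in> {-r..r}" for z
        using continuous_on_slice(1)[OF c(1) that] uv by (auto intro!: integrable_continuous_real elim: continuous_on_subset)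
      have i2: "(\<lambda>x. b (x, z)) integrable_on {-r..t}" if "z \<in> {-r..r}" for z
        using continuous_on_slice(2)[OF c(2) that] t by (auto intro!: integrable_continuous_real elim: continuous_on_subset)
      have i3: "(\<lambda>x. integral {u..v} (\<lambda>y. k (x, y))) integrable_on {-r..t}"
        using SI_param_continuous_fixed[OF c(3) uv(1,2)] t uv
        by (auto intro!: integrable_continuous_real simp: SI_def elim: continuous_on_subset)
      have "integral {u..v} (\<lambda>y. a (t, y) - a (-r, y)) + integral {-r..t} (\<lambda>x. b (x, v) - b (x, u))
         = integral {-r..t} (\<lambda>x. integral {u..v} (\<lambda>y. k (x, y)))"
        using fl uv t r unfolding flux_id_def by auto
      moreover have "integral {u..v} (\<lambda>y. a (t, y) - a (-r, y)) = SI (\<lambda>y. a (t, y)) u v - SI (\<lambda>y. a (-r, y)) u v"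
        using integral_diff[OF i[OF t] i[OF r]] uv by (simp add: SI_def)
      moreover have "integral {-r..t} f = integral {-r..t} (\<lambda>x. integral {u..v} (\<lambda>y. k (x, y))) - integral {-r..t} (\<lambda>x. b (x, v) - b (x, u))"
        unfolding f_def using integral_diff[OF i3 integrable_diff[OF i2[OF uv(2)] i2[OF uv(1)]]] uv by (simp add: SI_def)
      ultimately show ?thesis by simp
    qed
    have "((\<lambda>t. SI (\<lambda>y. a (-r, y)) u v + integral {-r..t} f) has_real_derivative 0 + f x) (at x within {-r..r})"
      by (intro DERIV_add DERIV_const integral_has_real_derivative cf x)
    then have "((\<lambda>t. SI (\<lambda>y. a (-r, y)) u v + integral {-r..t} f) has_real_derivative f x) (at x within {-r..r})"
      by simp
    then have "((\<lambda>t. SI (\<lambda>y. a (t, y)) u v) has_real_derivative f x) (at x within {-r..r})"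
      by (rule has_field_derivative_transform_within[where d=1]) (use x in \<open>simp_all add: eq[symmetric]\<close>)
    then show ?thesis by (simp add: f_def)
  qed
  show ?thesis
  proof (cases "u \<le> v")
    case True then show ?thesis using main uv by blast
  next
    case False
    then have "((\<lambda>t. - SI (\<lambda>y. a (t, y)) v u) has_real_derivative
      - (SI (\<lambda>y. k (x, y)) v u - (b (x, u) - b (x, v)))) (at x within {-r..r})"
      by (intro DERIV_minus main uv) simp
    then show ?thesis
      by (simp add: SI_swap[of _ v u] algebra_simps)
  qed
qed

text \<open>The segment is split into the one with both ends frozen at \<open>x\<close> and two end
  pieces that shrink to points. The brackets \<open>a * d - b\<close> come from the two graphs; they
  vanish for graphs that are integral curves of \<open>(a, b)\<close>.\<close>

lemma flux_deriv:
  assumes fl: "flux_id r a b k" and c: "continuous_on (sq r) a" "continuous_on (sq r) b" "continuous_on (sq r) k"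
    and I: "I \<subseteq> {-r..r}" and x: "x \<in> I"
    and g: "(g0 has_real_derivative d0) (at x within I)" "(g1 has_real_derivative d1) (at x within I)"
    and gr: "\<And>t. t \<in> I \<Longrightarrow> g0 t \<in> {-r..r}" "\<And>t. t \<in> I \<Longrightarrow> g1 t \<in> {-r..r}"
  shows "((\<lambda>t. SI (\<lambda>y. a (t, y)) (g0 t) (g1 t)) has_real_derivative
     (a (x, g1 x) * d1 - b (x, g1 x)) - (a (x, g0 x) * d0 - b (x, g0 x)) + SI (\<lambda>y. k (x, y)) (g0 x) (g1 x)) (at x within I)"
proof -
  have "((\<lambda>t. SI (\<lambda>y. a (t, y)) (g0 x) (g1 x)) has_real_derivative
      SI (\<lambda>y. k (x, y)) (g0 x) (g1 x) - (b (x, g1 x) - b (x, g0 x))) (at x within I)"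
    by (rule DERIV_subset[OF flux_deriv_fixed[OF fl c] I]) (use gr x I in auto)
  from DERIV_diff[OF DERIV_add[OF this SI_moving_deriv[OF c(1) I x g(2) gr(2)]] SI_moving_deriv[OF c(1) I x g(1) gr(1)]]
  have "((\<lambda>t. SI (\<lambda>y. a (t, y)) (g0 x) (g1 x) + SI (\<lambda>y. a (t, y)) (g1 x) (g1 t) - SI (\<lambda>y. a (t, y)) (g0 x) (g0 t))
    has_real_derivative SI (\<lambda>y. k (x, y)) (g0 x) (g1 x) - (b (x, g1 x) - b (x, g0 x)) + a (x, g1 x) * d1 - a (x, g0 x) * d0) (at x within I)"
    .
  then have "((\<lambda>t. SI (\<lambda>y. a (t, y)) (g0 t) (g1 t)) has_real_derivative
     SI (\<lambda>y. k (x, y)) (g0 x) (g1 x) - (b (x, g1 x) - b (x, g0 x)) + a (x, g1 x) * d1 - a (x, g0 x) * d0) (at x within I)"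
  proof (rule has_field_derivative_transform_within[where d=1])
    fix t assume "t \<in> I" "dist t x < 1"
    then show "SI (\<lambda>y. a (t, y)) (g0 x) (g1 x) + SI (\<lambda>y. a (t, y)) (g1 x) (g1 t) - SI (\<lambda>y. a (t, y)) (g0 x) (g0 t) = SI (\<lambda>y. a (t, y)) (g0 t) (g1 t)"
      using SI_decomp[OF c(1), of t "g0 x" "g1 x" "g0 t" "g1 t"] x I gr by auto
  qed (use x in auto)
  then show ?thesis by (simp add: algebra_simps)
qed

text \<open>The limit is taken in the fundamental theorem of calculus, where bounded pointwise
  convergence of the derivatives is enough; continuity of \<open>G\<close> then gives back a
  derivative at every point.\<close>

lemma deriv_limit_dominated:
  fixes f f' :: "nat \<Rightarrow> real \<Rightarrow> real"
  assumes der: "\<And>n x. x \<in> {a..b} \<Longrightarrow> (f n has_real_derivative f' n x) (at x within {a..b})"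
    and bd: "\<And>n x. x \<in> {a..b} \<Longrightarrow> \<bar>f' n x\<bar> \<le> C"
    and lf: "\<And>x. x \<in> {a..b} \<Longrightarrow> (\<lambda>n. f n x) \<longlonglongrightarrow> F x"
    and lf': "\<And>x. x \<in> {a..b} \<Longrightarrow> (\<lambda>n. f' n x) \<longlonglongrightarrow> G x"
    and cG: "continuous_on {a..b} G" and x: "x \<in> {a..b}"
  shows "(F has_real_derivative G x) (at x within {a..b})"
proof -
  have eq: "F a + integral {a..u} G = F u" if u: "u \<in> {a..b}" for u
  proof -
    have ftc: "(f' n has_integral (f n u - f n a)) {a..u}" for n
    proof (rule fundamental_theorem_of_calculus)
      fix z assume z: "z \<in> {a..u}"
      then have "(f n has_real_derivative f' n z) (at z within {a..u})"
        by (intro DERIV_subset[OF der]) (use u in auto)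
      then show "(f n has_vector_derivative f' n z) (at z within {a..u})"
        by (simp add: has_real_derivative_iff_has_vector_derivative)
    qed (use u in auto)
    have "(\<lambda>n. integral {a..u} (f' n)) \<longlonglongrightarrow> integral {a..u} G"
    proof (rule dominated_convergence(2)[where h="\<lambda>_. C"])
      show "f' n integrable_on {a..u}" for n using ftc[of n] by blast
    qed (use bd lf' u in auto)
    then have "(\<lambda>n. f n u - f n a) \<longlonglongrightarrow> integral {a..u} G"
      using integral_unique[OF ftc] by simp
    moreover have "(\<lambda>n. f n u - f n a) \<longlonglongrightarrow> F u - F a"
      by (intro tendsto_intros lf) (use u in auto)
    ultimately have "integral {a..u} G = F u - F a" by (rule LIMSEQ_unique)
    then show ?thesis by simp
  qed
  have "((\<lambda>u. F a + integral {a..u} G) has_real_derivative 0 + G x) (at x within {a..b})"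
    by (intro DERIV_add DERIV_const integral_has_real_derivative cG x)
  then have "((\<lambda>u. F a + integral {a..u} G) has_real_derivative G x) (at x within {a..b})"
    by simp
  then show ?thesis
    by (rule has_field_derivative_transform_within[where d=1]) (use x eq in auto)
qed

text \<open>The width weighted by \<open>w\<close> is comparable with the plain width, and its
  derivative is at most a multiple of itself. Gronwall then bounds the width at one place by the
  width at any other, with the same \<open>C\<close> for all pairs of curves; if it is zero
  somewhere, it is zero everywhere.\<close>

lemma SI_spread:
  fixes w k :: "real \<times> real \<Rightarrow> real"
  assumes cw: "continuous_on (sq r) w" and ck: "continuous_on (sq r) k"
    and \<kappa>: "\<kappa> > 0" "\<And>p. p \<in> sq r \<Longrightarrow> \<kappa> \<le> w p" and r: "r > 0"
  obtains C where "C > 0"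
    "\<And>s g0 g1 y y'. s \<le> r \<Longrightarrow> (\<And>t. t \<in> {-s..s} \<Longrightarrow> g0 t \<in> {-r..r} \<and> g1 t \<in> {-r..r} \<and>
      ((\<lambda>t. SI (\<lambda>x. w (t, x)) (g0 t) (g1 t)) has_real_derivative SI (\<lambda>x. k (t, x)) (g0 t) (g1 t)) (at t within {-s..s})) \<Longrightarrow>
      y \<in> {-s..s} \<Longrightarrow> y' \<in> {-s..s} \<Longrightarrow> \<bar>g1 y - g0 y\<bar> \<le> C * \<bar>g1 y' - g0 y'\<bar>"
proof -
  obtain c where c: "c > 0" "\<And>x y. x \<in> {-r..r} \<Longrightarrow> y \<in> {-r..r} \<Longrightarrow> \<bar>k (x, y)\<bar> \<le> c"
    using bounded_on_sq[OF ck] by metis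
  obtain W where W: "W > 0" "\<And>x y. x \<in> {-r..r} \<Longrightarrow> y \<in> {-r..r} \<Longrightarrow> \<bar>w (x, y)\<bar> \<le> W"
    using bounded_on_sq[OF cw] by metis
  define C where "C = W / \<kappa> * exp (c / \<kappa> * (2 * r))"
  have main: "\<bar>g1 y - g0 y\<bar> \<le> C * \<bar>g1 y' - g0 y'\<bar>"
    if s: "s \<le> r" and g: "\<And>t. t \<in> {-s..s} \<Longrightarrow> g0 t \<in> {-r..r} \<and> g1 t \<in> {-r..r} \<and>
      ((\<lambda>t. SI (\<lambda>x. w (t, x)) (g0 t) (g1 t)) has_real_derivative SI (\<lambda>x. k (t, x)) (g0 t) (g1 t)) (at t within {-s..s})"
      and y: "y \<in> {-s..s}" "y' \<in> {-s..s}" for s g0 g1 y y'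
  proof -
    define M where "M t = SI (\<lambda>x. w (t, x)) (g0 t) (g1 t)" for t
    have sub: "closed_segment (g0 z) (g1 z) \<subseteq> {-r..r}" "z \<in> {-r..r}" "g0 z \<in> {-r..r}" "g1 z \<in> {-r..r}" if "z \<in> {-s..s}" for z
      using closed_segment_subset_Icc g[OF that] that s by auto
    have lower: "\<kappa> * \<bar>g1 z - g0 z\<bar> \<le> \<bar>M z\<bar>" if z: "z \<in> {-s..s}" for z
      unfolding M_def by (rule SI_lower[OF continuous_on_slice_seg(1)[OF cw]]) (use sub[OF z] \<kappa> in auto)
    have upper: "\<bar>M z\<bar> \<le> W * \<bar>g1 z - g0 z\<bar>" if z: "z \<in> {-s..s}" for z
      unfolding M_def by (rule SI_abs_le[OF continuous_on_slice_seg(1)[OF cw]]) (use sub[OF z] W in auto)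
    have "\<bar>M y\<bar> \<le> \<bar>M y'\<bar> * exp (c / \<kappa> * \<bar>y - y'\<bar>)"
    proof (rule gronwall_abs[where f'="\<lambda>t. SI (\<lambda>x. k (t, x)) (g0 t) (g1 t)"])
      fix z assume z: "z \<in> {-s..s}"
      show "(M has_real_derivative SI (\<lambda>x. k (z, x)) (g0 z) (g1 z)) (at z within {-s..s})"
        unfolding M_def[abs_def] using g[OF z] by blast
      have "\<bar>SI (\<lambda>x. k (z, x)) (g0 z) (g1 z)\<bar> \<le> c * \<bar>g1 z - g0 z\<bar>"
        by (rule SI_abs_le[OF continuous_on_slice_seg(1)[OF ck]]) (use sub[OF z] c in auto)
      also have "\<dots> \<le> c * (\<bar>M z\<bar> / \<kappa>)"
        using lower[OF z] c(1) \<kappa>(1) by (intro mult_left_mono) (auto simp: field_simps)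
      finally show "\<bar>SI (\<lambda>x. k (z, x)) (g0 z) (g1 z)\<bar> \<le> c / \<kappa> * \<bar>M z\<bar>" by simp
    qed (use y in auto)
    also have "\<dots> \<le> \<bar>M y'\<bar> * exp (c / \<kappa> * (2 * r))"
      using y s c(1) \<kappa>(1) by (intro mult_left_mono) (auto intro!: mult_left_mono divide_right_mono)
    also have "\<dots> \<le> W * \<bar>g1 y' - g0 y'\<bar> * exp (c / \<kappa> * (2 * r))"
      using upper[OF y(2)] by (intro mult_right_mono) auto
    finally have "\<kappa> * \<bar>g1 y - g0 y\<bar> \<le> W * \<bar>g1 y' - g0 y'\<bar> * exp (c / \<kappa> * (2 * r))"
      using lower[OF y(1)] by linarith
    then show ?thesis using \<kappa>(1) by (simp add: C_def field_simps)
  qed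
  show ?thesis by (rule that[OF _ main]) (use W \<kappa> in \<open>auto simp: C_def\<close>)
qed

section \<open>Integral curves of the normal field\<close>

text \<open>\<open>(A, B)\<close> stands for the unit normal \<open>N\<close> in coordinates centred
  at a nonsingular point, with second axis along \<open>N\<close> at that point. There
  \<open>B = 1\<close>, so \<open>1 / 2 \<le> B\<close> is a matter of taking the square small; it
  bounds all slopes by \<open>2\<close>.\<close>

locale flux_frame =
  fixes r :: real and A B H :: "real \<times> real \<Rightarrow> real"
  assumes r_pos: "r > 0"
    and cA: "continuous_on (sq r) A" and cB: "continuous_on (sq r) B" and cH: "continuous_on (sq r) H"
    and unit: "\<And>p. p \<in> sq r \<Longrightarrow> (A p)\<^sup>2 + (B p)\<^sup>2 = 1"
    and B_half: "\<And>p. p \<in> sq r \<Longrightarrow> 1 / 2 \<le> B p"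
    and flux: "flux_id r A B H"
begin

lemma B_le_1: "p \<in> sq r \<Longrightarrow> B p \<le> 1"
  using unit[of p] by (metis abs_le_square_iff abs_le_D1 abs_one le_add_same_cancel2 one_power2 zero_le_power2)

lemma A_le_1: "p \<in> sq r \<Longrightarrow> \<bar>A p\<bar> \<le> 1"
  using unit[of p] by (metis abs_le_square_iff abs_one le_add_same_cancel1 one_power2 zero_le_power2)

lemma A_div_B_le: "p \<in> sq r \<Longrightarrow> \<bar>A p / B p\<bar> \<le> 2"
  using A_le_1[of p] B_half[of p] by (auto simp: abs_divide field_simps)

lemma B_nz: "p \<in> sq r \<Longrightarrow> B p \<noteq> 0"
  using B_half[of p] by auto

text \<open>An \<open>ncurve\<close> is an unparametrised integral curve of \<open>(A, B)\<close>, written as a graph over the second axis.\<close>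

definition ncurve :: "real \<Rightarrow> (real \<Rightarrow> real) \<Rightarrow> bool" where
  "ncurve s X \<longleftrightarrow> (\<forall>y\<in>{-s..s}. X y \<in> {-r..r} \<and>
     (X has_real_derivative A (X y, y) / B (X y, y)) (at y within {-s..s}))"

text \<open>Slopes are at most \<open>2\<close> and the window has length \<open>2 * s\<close>, so
  the curve moves by at most \<open>4 * s \<le> r / 2\<close> from \<open>x0\<close> and stays in
  the square.\<close>

lemma ncurve_exists:
  assumes "0 \<le> s" "8 * s \<le> r" "y0 \<in> {-s..s}" "\<bar>x0\<bar> \<le> r / 2"
  obtains X where "ncurve s X" "X y0 = x0"
proof -
  have c: "continuous_on (sq r) (\<lambda>p. A (snd p, fst p) / B (snd p, fst p))"
    by (intro continuous_intros continuous_on_swp cA cB) (use B_nz in auto)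
  have "\<exists>g. g y0 = x0 \<and> (\<forall>t\<in>{-s..s}. g t \<in> {-r..r} \<and> (g has_real_derivative A (snd (t, g t), fst (t, g t)) / B (snd (t, g t), fst (t, g t))) (at t within {-s..s}))"
    by (rule peano_box[OF c, of 2]) (use A_div_B_le assms in auto)
  then show ?thesis using that unfolding ncurve_def by auto
qed

lemma ncurve_continuous: "ncurve s X \<Longrightarrow> continuous_on {-s..s} X"
  unfolding ncurve_def by (rule DERIV_continuous_on) blast

lemma ncurve_in: "ncurve s X \<Longrightarrow> y \<in> {-s..s} \<Longrightarrow> X y \<in> {-r..r}"
  unfolding ncurve_def by blast

lemma ncurve_deriv:
  "ncurve s X \<Longrightarrow> y \<in> {-s..s} \<Longrightarrow> (X has_real_derivative A (X y, y) / B (X y, y)) (at y within {-s..s})"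
  unfolding ncurve_def by blast

text \<open>The curves are tangent to \<open>(A, B)\<close> and carry no flux themselves. So the
  flux through the level between them changes by the divergence \<open>H\<close> only.\<close>

lemma ncurve_flux:
  assumes s: "s \<le> r" and X: "ncurve s X0" "ncurve s X1" and y: "y \<in> {-s..s}"
  shows "((\<lambda>y. SI (\<lambda>x. B (x, y)) (X0 y) (X1 y)) has_real_derivative SI (\<lambda>x. H (x, y)) (X0 y) (X1 y))
    (at y within {-s..s})"
proof -
  have I: "{-s..s} \<subseteq> {-r..r}" using s by auto
  have "((\<lambda>t. SI (\<lambda>x. swp B (t, x)) (X0 t) (X1 t)) has_real_derivative
     (swp B (y, X1 y) * (A (X1 y, y) / B (X1 y, y)) - swp A (y, X1 y))
     - (swp B (y, X0 y) * (A (X0 y, y) / B (X0 y, y)) - swp A (y, X0 y)) + SI (\<lambda>x. swp H (y, x)) (X0 y) (X1 y))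
     (at y within {-s..s})"
    by (rule flux_deriv[OF flux_id_swap[OF flux cH] _ _ _ I y])
       (use X y in \<open>auto intro!: continuous_on_swp cA cB cH ncurve_deriv dest: ncurve_in\<close>)
  then show ?thesis
    using ncurve_in[OF X(1) y] ncurve_in[OF X(2) y] y s B_nz by (simp add: I[THEN subsetD])
qed

text \<open>The weight is \<open>B\<close>, bounded below by \<open>1 / 2\<close>. In particular the
  integral curves of the merely continuous field \<open>(A, B)\<close> are unique and depend on
  their starting point in a Lipschitz way.\<close>

lemma ncurve_spread:
  obtains C where "C > 0" "\<And>s X0 X1 y y'. s \<le> r \<Longrightarrow> ncurve s X0 \<Longrightarrow> ncurve s X1 \<Longrightarrow> y \<in> {-s..s} \<Longrightarrow> y' \<in> {-s..s} \<Longrightarrow>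
    \<bar>X1 y - X0 y\<bar> \<le> C * \<bar>X1 y' - X0 y'\<bar>"
proof -
  have half: "1 / 2 \<le> swp B p" if "p \<in> sq r" for p using B_half[of "(snd p, fst p)"] that by auto
  have pos: "0 < (1 / 2 :: real)" by simp
  show thesis
  proof (rule SI_spread[OF continuous_on_swp[OF cB] continuous_on_swp[OF cH] pos half r_pos])
    fix C :: real
    assume C0: "C > 0" and C: "\<And>s g0 g1 y y'. s \<le> r \<Longrightarrow> (\<And>t. t \<in> {-s..s} \<Longrightarrow> g0 t \<in> {-r..r} \<and> g1 t \<in> {-r..r} \<and>
      ((\<lambda>t. SI (\<lambda>x. swp B (t, x)) (g0 t) (g1 t)) has_real_derivative SI (\<lambda>x. swp H (t, x)) (g0 t) (g1 t)) (at t within {-s..s})) \<Longrightarrow>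
      y \<in> {-s..s} \<Longrightarrow> y' \<in> {-s..s} \<Longrightarrow> \<bar>g1 y - g0 y\<bar> \<le> C * \<bar>g1 y' - g0 y'\<bar>"
    show thesis
    proof (rule that[OF C0])
      fix s X0 X1 y y'
      assume s: "s \<le> r" and X: "ncurve s X0" "ncurve s X1" and y: "y \<in> {-s..s}" "y' \<in> {-s..s}"
      show "\<bar>X1 y - X0 y\<bar> \<le> C * \<bar>X1 y' - X0 y'\<bar>"
        by (rule C[OF s _ y]) (use ncurve_flux[OF s X] ncurve_in[OF X(1)] ncurve_in[OF X(2)] in simp)
    qed
  qed
qed

end

section \<open>Product rule for the divergence\<close>

text \<open>\<open>f\<close> has the derivative \<open>h\<close> along integral curves of
  \<open>(A, B)\<close> but is only continuous across them, so \<open>div (f N) = h + f H\<close>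
  cannot be expanded pointwise. It is used with \<open>f = H\<close> and \<open>h = N(H)\<close>,
  which gives the potential of the Jacobi equation.\<close>

locale flux_product = flux_frame +
  fixes s :: real and f h :: "real \<times> real \<Rightarrow> real"
  assumes s: "s > 0" "8 * s \<le> r"
    and cf: "continuous_on (sq r) f" and ch: "continuous_on (sq r) h"
    and f_deriv: "\<And>X y. ncurve s X \<Longrightarrow> y \<in> {-s<..<s} \<Longrightarrow>
      ((\<lambda>y. f (X y, y)) has_real_derivative h (X y, y) / B (X y, y)) (at y)"
begin

lemma s_le_r: "s \<le> r" using s by simp

definition K :: "real \<times> real \<Rightarrow> real" where "K p = h p + f p * H p"

definition fB :: "real \<times> real \<Rightarrow> real" where "fB p = f p * B p"

lemma cK: "continuous_on (sq r) K"
  unfolding K_def[abs_def] by (intro continuous_intros cf ch cH)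

lemma cfB: "continuous_on (sq r) fB"
  unfolding fB_def[abs_def] by (intro continuous_intros cf cB)

text \<open>The defect of the balance for \<open>(f A, f B)\<close> on the strip between two
  integral curves and two levels. The curved sides carry no flux and do not appear.\<close>

definition flux_gap :: "real \<Rightarrow> real \<Rightarrow> (real \<Rightarrow> real) \<Rightarrow> (real \<Rightarrow> real) \<Rightarrow> real" where
  "flux_gap y1 y2 X0 X1 = SI (\<lambda>x. fB (x, y2)) (X0 y2) (X1 y2) - SI (\<lambda>x. fB (x, y1)) (X0 y1) (X1 y1)
    - integral {y1..y2} (\<lambda>y. SI (\<lambda>x. K (x, y)) (X0 y) (X1 y))"

lemma ncurve_sub:
  assumes "ncurve s X0" "ncurve s X1" "z \<in> {-s..s}"
  shows "closed_segment (X0 z) (X1 z) \<subseteq> {-r..r}" "z \<in> {-r..r}" "X0 z \<in> {-r..r}" "X1 z \<in> {-r..r}"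
  using closed_segment_subset_Icc ncurve_in[OF assms(1,3)] ncurve_in[OF assms(2,3)] assms(3) s_le_r by auto

lemma ncurve_SI_continuous:
  assumes X: "ncurve s X0" "ncurve s X1" and k: "continuous_on (sq r) k"
  shows "continuous_on {-s..s} (\<lambda>y. SI (\<lambda>x. k (x, y)) (X0 y) (X1 y))"
proof -
  have "continuous_on {-s..s} (\<lambda>y. SI (\<lambda>x. swp k (y, x)) (X0 y) (X1 y))"
    by (rule SI_param_continuous[OF continuous_on_swp[OF k]])
       (use X s_le_r ncurve_in ncurve_continuous in auto)
  then show ?thesis by simp
qed

lemma flux_gap_add:
  assumes X: "ncurve s X0" "ncurve s X1" "ncurve s X2" and y: "y1 \<in> {-s..s}" "y2 \<in> {-s..s}"
  shows "flux_gap y1 y2 X0 X1 + flux_gap y1 y2 X1 X2 = flux_gap y1 y2 X0 X2"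
proof -
  have e: "SI (\<lambda>x. k (x, y)) (X0 y) (X1 y) + SI (\<lambda>x. k (x, y)) (X1 y) (X2 y) = SI (\<lambda>x. k (x, y)) (X0 y) (X2 y)"
    if "y \<in> {-s..s}" "continuous_on (sq r) k" for y k
    by (rule SI_combine[OF continuous_on_slice(2)[OF that(2)]])
       (use that ncurve_sub[OF X(1,2) that(1)] ncurve_sub[OF X(1,3) that(1)] in auto)
  have sub: "{y1..y2} \<subseteq> {-s..s}" using y by auto
  have i: "(\<lambda>y. SI (\<lambda>x. K (x, y)) (X y) (X' y)) integrable_on {y1..y2}" if "ncurve s X" "ncurve s X'" for X X'
    by (intro integrable_continuous_real continuous_on_subset[OF ncurve_SI_continuous[OF that cK] sub])
  have "integral {y1..y2} (\<lambda>y. SI (\<lambda>x. K (x, y)) (X0 y) (X1 y)) + integral {y1..y2} (\<lambda>y. SI (\<lambda>x. K (x, y)) (X1 y) (X2 y))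
    = integral {y1..y2} (\<lambda>y. SI (\<lambda>x. K (x, y)) (X0 y) (X1 y) + SI (\<lambda>x. K (x, y)) (X1 y) (X2 y))"
    by (rule integral_add[symmetric]) (intro i X)+
  also have "\<dots> = integral {y1..y2} (\<lambda>y. SI (\<lambda>x. K (x, y)) (X0 y) (X2 y))"
    by (rule integral_cong) (use e[OF _ cK] sub in auto)
  finally show ?thesis
    using e[OF y(1) cfB] e[OF y(2) cfB] by (simp add: flux_gap_def)
qed

text \<open>On a thin strip \<open>f\<close> is replaced by its values on the curve
  \<open>X0\<close>. There the product rule holds exactly, since \<open>f\<close> is differentiable
  along the curve and the flux of \<open>(A, B)\<close> is differentiable by
  \<open>ncurve_flux\<close>. The replacement costs the oscillation \<open>\<omega>\<close> across
  the strip times the width \<open>Z\<close>, so the gap is of smaller order than the width.\<close>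

lemma flux_gap_bound:
  assumes X: "ncurve s X0" "ncurve s X1" and y: "y1 \<in> {-s..s}" "y2 \<in> {-s..s}" "y1 \<le> y2"
    and \<omega>: "\<And>x y. y \<in> {-s..s} \<Longrightarrow> x \<in> closed_segment (X0 y) (X1 y) \<Longrightarrow> \<bar>f (x, y) - f (X0 y, y)\<bar> \<le> \<omega>"
      "\<And>x y. y \<in> {-s..s} \<Longrightarrow> x \<in> closed_segment (X0 y) (X1 y) \<Longrightarrow>
         \<bar>h (x, y) / B (x, y) - h (X0 y, y) / B (X0 y, y)\<bar> \<le> \<omega>"
    and Z: "\<And>y. y \<in> {-s..s} \<Longrightarrow> \<bar>X1 y - X0 y\<bar> \<le> Z"
    and c: "\<And>x y. x \<in> {-r..r} \<Longrightarrow> y \<in> {-r..r} \<Longrightarrow> \<bar>H (x, y)\<bar> \<le> c"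
  shows "\<bar>flux_gap y1 y2 X0 X1\<bar> \<le> \<omega> * Z * (2 + 2 * s * (1 + c))"
proof -
  have \<omega>0: "0 \<le> \<omega>" using \<omega>(1)[OF y(1) ends_in_segment(1)] by simp
  have c0: "0 \<le> c" using c[of 0 0] r_pos by simp
  note sub = ncurve_sub[OF X]
  define M where "M y = SI (\<lambda>x. B (x, y)) (X0 y) (X1 y)" for y
  define G where "G y = f (X0 y, y) * M y" for y
  define G' where "G' y = h (X0 y, y) / B (X0 y, y) * M y + f (X0 y, y) * SI (\<lambda>x. H (x, y)) (X0 y) (X1 y)" for y
  have sub12: "{y1..y2} \<subseteq> {-s..s}" using y by auto
  have cX0: "continuous_on {-s..s} X0" by (rule ncurve_continuous[OF X(1)])
  have cpair: "continuous_on {-s..s} (\<lambda>y. k (X0 y, y))" if "continuous_on (sq r) k" for k :: "real \<times> real \<Rightarrow> real"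
    by (rule continuous_on_pairI[OF that cX0]) (use sub in auto)
  have cM: "continuous_on {-s..s} M"
    unfolding M_def[abs_def] by (rule ncurve_SI_continuous[OF X cB])
  have cG: "continuous_on {-s..s} G"
    unfolding G_def by (intro continuous_intros cM cpair cf)
  have B0: "B (X0 y, y) \<noteq> 0" if "y \<in> {-s..s}" for y using sub[OF that] B_nz by auto
  have cG': "continuous_on {-s..s} G'"
    unfolding G'_def by (intro continuous_intros cM cpair ch cB cf ncurve_SI_continuous[OF X cH]) (use B0 in auto)
  have dG: "(G has_real_derivative G' y) (at y)" if "y \<in> {-s<..<s}" for y
  proof -
    have y': "y \<in> {-s..s}" using that by auto
    have "(M has_real_derivative SI (\<lambda>x. H (x, y)) (X0 y) (X1 y)) (at y)"
      using ncurve_flux[OF s_le_r X y'] that at_within_Icc_at[of "-s" y s] by (simp add: M_def[abs_def])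
    from DERIV_mult[OF f_deriv[OF X(1) that] this]
    show ?thesis by (simp add: G_def[abs_def] G'_def algebra_simps)
  qed
  have "(G' has_integral (G y2 - G y1)) {y1..y2}"
  proof (rule fundamental_theorem_of_calculus_interior[OF y(3)])
    show "continuous_on {y1..y2} G" by (rule continuous_on_subset[OF cG sub12])
    show "(G has_vector_derivative G' x) (at x)" if "x \<in> {y1<..<y2}" for x
      using dG[of x] that y by (auto simp: has_real_derivative_iff_has_vector_derivative)
  qed
  then have intG: "integral {y1..y2} G' = G y2 - G y1" by (rule integral_unique)
  have SIc: "\<bar>SI (\<lambda>x. k (x, y)) (X0 y) (X1 y)\<bar> \<le> \<omega>' * Z"
    if "y \<in> {-s..s}" "continuous_on (closed_segment (X0 y) (X1 y)) (\<lambda>x. k (x, y))" "0 \<le> \<omega>'"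
      "\<And>x. x \<in> closed_segment (X0 y) (X1 y) \<Longrightarrow> \<bar>k (x, y)\<bar> \<le> \<omega>'" for y \<omega>' and k :: "real \<times> real \<Rightarrow> real"
    by (rule order_trans[OF SI_abs_le[OF that(2,4)]]) (use Z[OF that(1)] that(3) in \<open>auto intro: mult_left_mono\<close>)
  have seg: "continuous_on (closed_segment (X0 y) (X1 y)) (\<lambda>x. k (x, y))"
    if "y \<in> {-s..s}" "continuous_on (sq r) k" for y and k :: "real \<times> real \<Rightarrow> real"
    by (rule continuous_on_slice_seg(2)[OF that(2)]) (use sub[OF that(1)] in auto)
  have e1: "\<bar>SI (\<lambda>x. fB (x, y)) (X0 y) (X1 y) - G y\<bar> \<le> \<omega> * Z" if y: "y \<in> {-s..s}" for y
  proof -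
    have "SI (\<lambda>x. fB (x, y)) (X0 y) (X1 y) - G y = SI (\<lambda>x. fB (x, y) - f (X0 y, y) * B (x, y)) (X0 y) (X1 y)"
      unfolding G_def M_def SI_cmult[symmetric]
      by (rule SI_diff[symmetric]) (intro continuous_intros seg y cfB cB)+
    also have "\<bar>\<dots>\<bar> \<le> \<omega> * Z"
    proof (rule SIc[OF y _ \<omega>0, where k="\<lambda>p. fB p - f (X0 y, y) * B p"])
      show "continuous_on (closed_segment (X0 y) (X1 y)) (\<lambda>x. fB (x, y) - f (X0 y, y) * B (x, y))"
        by (intro continuous_intros seg y cfB cB)
      fix x assume x: "x \<in> closed_segment (X0 y) (X1 y)"
      then have xy: "(x, y) \<in> sq r" using sub[OF y] by auto
      have "\<bar>fB (x, y) - f (X0 y, y) * B (x, y)\<bar> = \<bar>f (x, y) - f (X0 y, y)\<bar> * \<bar>B (x, y)\<bar>"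
        by (simp add: fB_def left_diff_distrib flip: abs_mult)
      also have "\<dots> \<le> \<omega> * 1"
        by (rule mult_mono) (use \<omega>(1)[OF y x] B_le_1[OF xy] B_half[OF xy] \<omega>0 in auto)
      finally show "\<bar>fB (x, y) - f (X0 y, y) * B (x, y)\<bar> \<le> \<omega>" by simp
    qed
    finally show ?thesis .
  qed
  have e2: "\<bar>SI (\<lambda>x. K (x, y)) (X0 y) (X1 y) - G' y\<bar> \<le> (\<omega> * (1 + c)) * Z" if y: "y \<in> {-s..s}" for y
  proof -
    let ?k = "\<lambda>x. K (x, y) - (h (X0 y, y) / B (X0 y, y) * B (x, y) + f (X0 y, y) * H (x, y))"
    have "G' y = SI (\<lambda>x. h (X0 y, y) / B (X0 y, y) * B (x, y) + f (X0 y, y) * H (x, y)) (X0 y) (X1 y)"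
      unfolding G'_def M_def SI_cmult[symmetric]
      by (rule SI_add[symmetric]) (intro continuous_intros seg y cB cH)+
    then have "SI (\<lambda>x. K (x, y)) (X0 y) (X1 y) - G' y = SI ?k (X0 y) (X1 y)"
      using B0[OF y] by (subst SI_diff) (auto intro!: continuous_intros seg y cB cH cK)
    also have "\<bar>\<dots>\<bar> \<le> (\<omega> * (1 + c)) * Z"
    proof (rule SIc[OF y, where k="\<lambda>p. K p - (h (X0 y, y) / B (X0 y, y) * B p + f (X0 y, y) * H p)"])
      show "continuous_on (closed_segment (X0 y) (X1 y)) ?k"
        by (intro continuous_intros seg y cB cH cK)
      show "0 \<le> \<omega> * (1 + c)" using \<omega>0 c0 by simp
      fix x assume x: "x \<in> closed_segment (X0 y) (X1 y)"
      then have xy: "(x, y) \<in> sq r" "x \<in> {-r..r}" "y \<in> {-r..r}" using sub[OF y] by auto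
      have "?k x = (h (x, y) / B (x, y) - h (X0 y, y) / B (X0 y, y)) * B (x, y) + (f (x, y) - f (X0 y, y)) * H (x, y)"
        using B_nz[OF xy(1)] by (simp add: K_def left_diff_distrib)
      also have "\<bar>\<dots>\<bar> \<le> \<omega> * 1 + \<omega> * c"
      proof (intro order_trans[OF abs_triangle_ineq] add_mono)
        show "\<bar>(h (x, y) / B (x, y) - h (X0 y, y) / B (X0 y, y)) * B (x, y)\<bar> \<le> \<omega> * 1"
          unfolding abs_mult by (rule mult_mono) (use \<omega>(2)[OF y x] B_le_1[OF xy(1)] B_half[OF xy(1)] \<omega>0 in auto)
        show "\<bar>(f (x, y) - f (X0 y, y)) * H (x, y)\<bar> \<le> \<omega> * c"
          unfolding abs_mult by (rule mult_mono) (use \<omega>(1)[OF y x] c[OF xy(2,3)] \<omega>0 in auto)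
      qed
      finally show "\<bar>?k x\<bar> \<le> \<omega> * (1 + c)" by (simp add: algebra_simps)
    qed
    finally show ?thesis .
  qed
  have iK: "(\<lambda>y. SI (\<lambda>x. K (x, y)) (X0 y) (X1 y)) integrable_on {y1..y2}"
    by (intro integrable_continuous_real continuous_on_subset[OF ncurve_SI_continuous[OF X cK] sub12])
  have iG: "G' integrable_on {y1..y2}"
    by (intro integrable_continuous_real continuous_on_subset[OF cG' sub12])
  have "\<bar>integral {y1..y2} (\<lambda>y. SI (\<lambda>x. K (x, y)) (X0 y) (X1 y) - G' y)\<bar> \<le> (\<omega> * (1 + c)) * Z * (y2 - y1)"
  proof -
    have "continuous_on {y1..y2} (\<lambda>y. SI (\<lambda>x. K (x, y)) (X0 y) (X1 y) - G' y)"
      by (rule continuous_on_diff[OF continuous_on_subset[OF ncurve_SI_continuous[OF X cK] sub12] continuous_on_subset[OF cG' sub12]])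
    from integral_bound[OF y(3) this, of "(\<omega> * (1 + c)) * Z"] show ?thesis
      using e2 sub12 by auto
  qed
  also have "\<dots> \<le> (\<omega> * (1 + c)) * Z * (2 * s)"
    using y \<omega>0 c0 Z[OF y(1)] abs_ge_zero[of "X1 y1 - X0 y1"] by (intro mult_left_mono mult_nonneg_nonneg) (auto intro: order_trans)
  finally have "\<bar>integral {y1..y2} (\<lambda>y. SI (\<lambda>x. K (x, y)) (X0 y) (X1 y)) - (G y2 - G y1)\<bar> \<le> (\<omega> * (1 + c)) * Z * (2 * s)"
    by (simp add: integral_diff[OF iK iG] intG)
  then have "\<bar>flux_gap y1 y2 X0 X1\<bar> \<le> \<omega> * Z + \<omega> * Z + (\<omega> * (1 + c)) * Z * (2 * s)"
    using e1[OF y(1)] e1[OF y(2)] unfolding flux_gap_def by linarith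
  also have "\<dots> = \<omega> * Z * (2 + 2 * s * (1 + c))" by (simp add: algebra_simps)
  finally show ?thesis .
qed

text \<open>The gap is additive for adjacent strips and of smaller order than their width, so as a
  function of the label \<open>v\<close> it has derivative zero; for \<open>v = u\<close> it
  vanishes. Curves are labelled by their abscissa at height \<open>y0\<close>, and
  \<open>ncurve_spread\<close> makes strips between nearby labels uniformly thin.\<close>

lemma flux_gap_zero:
  assumes X: "\<And>u. \<bar>u\<bar> \<le> r / 2 \<Longrightarrow> ncurve s (X u) \<and> X u y0 = u" and y0: "y0 \<in> {-s..s}"
    and u: "\<bar>u\<bar> \<le> r / 2" "\<bar>v\<bar> \<le> r / 2" and y: "y1 \<in> {-s..s}" "y2 \<in> {-s..s}" "y1 \<le> y2"
  shows "flux_gap y1 y2 (X u) (X v) = 0"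
proof -
  obtain c where c: "c > 0" "\<And>x y. x \<in> {-r..r} \<Longrightarrow> y \<in> {-r..r} \<Longrightarrow> \<bar>H (x, y)\<bar> \<le> c"
    using bounded_on_sq[OF cH] by metis
  obtain C where C: "C > 0" "\<And>s X0 X1 y y'. s \<le> r \<Longrightarrow> ncurve s X0 \<Longrightarrow> ncurve s X1 \<Longrightarrow> y \<in> {-s..s} \<Longrightarrow> y' \<in> {-s..s} \<Longrightarrow>
    \<bar>X1 y - X0 y\<bar> \<le> C * \<bar>X1 y' - X0 y'\<bar>"
    using ncurve_spread by metis
  have spread: "\<bar>X b y - X a y\<bar> \<le> C * \<bar>b - a\<bar>" if "\<bar>a\<bar> \<le> r / 2" "\<bar>b\<bar> \<le> r / 2" "y \<in> {-s..s}" for a b y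
    using C(2)[OF s_le_r, of "X a" "X b" y y0] X[OF that(1)] X[OF that(2)] that y0 by simp
  have chB: "continuous_on (sq r) (\<lambda>p. h p / B p)"
    by (intro continuous_intros ch cB) (use B_nz in auto)
  define S where "S = 2 + 2 * s * (1 + c)"
  have S: "S > 0" using s c by (simp add: S_def add_pos_pos)
  let ?q = "\<lambda>v. flux_gap y1 y2 (X u) (X v)"
  have d0: "(?q has_real_derivative 0) (at a within {-(r/2)..r/2})" if a: "a \<in> {-(r/2)..r/2}" for a
    unfolding has_field_derivative_iff
  proof (rule tendstoI)
    fix e :: real assume e: "0 < e"
    \<comment> \<open>\<open>C * S\<close> is the factor in the bound of the gap; the extra
      \<open>2\<close> turns the weak inequality into the strict one needed for the limit.\<close>
    define \<omega> where "\<omega> = e / (2 * C * S)"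
    have \<omega>: "\<omega> > 0" using e C S by (simp add: \<omega>_def)
    obtain d1 where d1: "d1 > 0" "\<And>x y x' y'. x \<in> {-r..r} \<Longrightarrow> y \<in> {-r..r} \<Longrightarrow> x' \<in> {-r..r} \<Longrightarrow> y' \<in> {-r..r} \<Longrightarrow>
      \<bar>x - x'\<bar> < d1 \<Longrightarrow> \<bar>y - y'\<bar> < d1 \<Longrightarrow> \<bar>f (x, y) - f (x', y')\<bar> < \<omega>"
      using uniform_on_sq[OF cf \<omega>] by metis
    obtain d2 where d2: "d2 > 0" "\<And>x y x' y'. x \<in> {-r..r} \<Longrightarrow> y \<in> {-r..r} \<Longrightarrow> x' \<in> {-r..r} \<Longrightarrow> y' \<in> {-r..r} \<Longrightarrow>
      \<bar>x - x'\<bar> < d2 \<Longrightarrow> \<bar>y - y'\<bar> < d2 \<Longrightarrow> \<bar>h (x, y) / B (x, y) - h (x', y') / B (x', y')\<bar> < \<omega>"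
      using uniform_on_sq[OF chB \<omega>] by metis
    have bound: "\<bar>?q b - ?q a\<bar> \<le> e / 2 * \<bar>b - a\<bar>" if b: "b \<in> {-(r/2)..r/2}" "\<bar>b - a\<bar> < min d1 d2 / C" for b
    proof -
      have ab: "\<bar>a\<bar> \<le> r / 2" "\<bar>b\<bar> \<le> r / 2" using a b by auto
      have nc: "ncurve s (X a)" "ncurve s (X b)" using X ab by auto
      have Cd: "C * \<bar>b - a\<bar> < min d1 d2" using b(2) C(1) by (simp add: field_simps)
      have close: "\<bar>x - X a y\<bar> < min d1 d2 \<and> x \<in> {-r..r} \<and> y \<in> {-r..r} \<and> X a y \<in> {-r..r}"
        if "y \<in> {-s..s}" "x \<in> closed_segment (X a y) (X b y)" for x y
      proof -
        have "\<bar>x - X a y\<bar> \<le> \<bar>X b y - X a y\<bar>"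
          using that(2) by (auto simp: closed_segment_eq_real_ivl split: if_splits)
        then show ?thesis using spread[OF ab that(1)] Cd ncurve_sub[OF nc that(1)] that(2) by auto
      qed
      have "\<bar>flux_gap y1 y2 (X a) (X b)\<bar> \<le> \<omega> * (C * \<bar>b - a\<bar>) * (2 + 2 * s * (1 + c))"
      proof (rule flux_gap_bound[OF nc y _ _ _ c(2)])
        fix y x assume yx: "y \<in> {-s..s}" "x \<in> closed_segment (X a y) (X b y)"
        show "\<bar>f (x, y) - f (X a y, y)\<bar> \<le> \<omega>"
          using d1(2)[of x y "X a y" y] close[OF yx] d1(1) by force
        show "\<bar>h (x, y) / B (x, y) - h (X a y, y) / B (X a y, y)\<bar> \<le> \<omega>"
          using d2(2)[of x y "X a y" y] close[OF yx] d2(1) by force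
      qed (use spread[OF ab] in auto)
      also have "\<dots> = e / 2 * \<bar>b - a\<bar>"
        unfolding S_def[symmetric] \<omega>_def using C(1) S by (simp add: field_simps)
      finally have "\<bar>flux_gap y1 y2 (X a) (X b)\<bar> \<le> e / 2 * \<bar>b - a\<bar>" .
      moreover have "?q a + flux_gap y1 y2 (X a) (X b) = ?q b"
        by (rule flux_gap_add) (use nc X u y in auto)
      ultimately show ?thesis by linarith
    qed
    have "\<forall>\<^sub>F b in at a within {-(r/2)..r/2}. b \<in> {-(r/2)..r/2} \<and> b \<noteq> a \<and> \<bar>b - a\<bar> < min d1 d2 / C"
      using d1(1) d2(1) C(1) by (auto simp: eventually_at dist_real_def intro!: exI[of _ "min d1 d2 / C"])
    then show "\<forall>\<^sub>F b in at a within {-(r/2)..r/2}. dist ((?q b - ?q a) / (b - a)) 0 < e"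
    proof eventually_elim
      case (elim b)
      then have "\<bar>?q b - ?q a\<bar> / \<bar>b - a\<bar> \<le> e / 2"
        using bound[of b] by (simp add: field_simps)
      moreover have "e / 2 < e" using e by simp
      ultimately have "\<bar>?q b - ?q a\<bar> / \<bar>b - a\<bar> < e" by (rule le_less_trans)
      then show ?case by (simp add: dist_real_def)
    qed
  qed
  have "convex {-(r/2)..r/2}" by simp
  from has_field_derivative_zero_constant[OF this d0]
  obtain q0 where q0: "\<And>a. a \<in> {-(r/2)..r/2} \<Longrightarrow> ?q a = q0" by metis
  have "u \<in> {-(r/2)..r/2}" "v \<in> {-(r/2)..r/2}" using u unfolding atLeastAtMost_iff by linarith+
  then have "?q v = ?q u" using q0[of u] q0[of v] by (simp only:)
  also have "\<dots> = 0" by (simp add: flux_gap_def)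
  finally show ?thesis .
qed

text \<open>Strips are traded for rectangles one level at a time. The curves through
  \<open>(x1, y0)\<close> and \<open>(x2, y0)\<close> bound a strip with exact balance; its
  difference from the rectangle consists of two end pieces that shrink to points at
  \<open>y0\<close>, each contributing a term \<open>f * A\<close>.\<close>

lemma flux_level_deriv:
  assumes x: "x1 \<in> {-s..s}" "x2 \<in> {-s..s}" and y0: "y0 \<in> {-s..s}"
  shows "((\<lambda>y. SI (\<lambda>x. fB (x, y)) x1 x2) has_real_derivative
    SI (\<lambda>x. K (x, y0)) x1 x2 - (f (x2, y0) * A (x2, y0) - f (x1, y0) * A (x1, y0))) (at y0 within {-s..s})"
proof -
  have "\<exists>X. ncurve s X \<and> X y0 = u" if "\<bar>u\<bar> \<le> r / 2" for u
    using ncurve_exists[of s y0 u] s y0 that by (metis less_imp_le)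
  then obtain X where X: "\<And>u. \<bar>u\<bar> \<le> r / 2 \<Longrightarrow> ncurve s (X u) \<and> X u y0 = u" by metis
  have xr: "\<bar>x1\<bar> \<le> r / 2" "\<bar>x2\<bar> \<le> r / 2" "x1 \<in> {-r..r}" "x2 \<in> {-r..r}" using x s by auto
  note X1 = X[OF xr(1), THEN conjunct1] and X2 = X[OF xr(2), THEN conjunct1]
  have e1: "X x1 y0 = x1" "X x2 y0 = x2" using X xr by auto
  let ?Kf = "\<lambda>y. SI (\<lambda>x. K (x, y)) (X x1 y) (X x2 y)"
  have M: "SI (\<lambda>x. fB (x, y)) (X x1 y) (X x2 y) = SI (\<lambda>x. fB (x, -s)) (X x1 (-s)) (X x2 (-s)) + integral {-s..y} ?Kf"
    if "y \<in> {-s..s}" for y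
    using flux_gap_zero[OF X y0 xr(1,2), of "-s" y] that by (simp add: flux_gap_def)
  have "((\<lambda>y. SI (\<lambda>x. fB (x, -s)) (X x1 (-s)) (X x2 (-s)) + integral {-s..y} ?Kf) has_real_derivative 0 + ?Kf y0) (at y0 within {-s..s})"
    by (intro DERIV_add DERIV_const integral_has_real_derivative ncurve_SI_continuous X1 X2 cK y0)
  then have dM: "((\<lambda>y. SI (\<lambda>x. fB (x, y)) (X x1 y) (X x2 y)) has_real_derivative SI (\<lambda>x. K (x, y0)) x1 x2) (at y0 within {-s..s})"
    unfolding e1 add_0
    by (rule has_field_derivative_transform_within[where d=1]) (use y0 in \<open>simp_all add: M[symmetric]\<close>)
  have mv: "((\<lambda>y. SI (\<lambda>x. fB (x, y)) u (X u y)) has_real_derivative f (u, y0) * A (u, y0)) (at y0 within {-s..s})"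
    if "\<bar>u\<bar> \<le> r / 2" for u
  proof -
    have Xu: "ncurve s (X u)" "X u y0 = u" using X that by auto
    have "((\<lambda>t. SI (\<lambda>y. swp fB (t, y)) (X u y0) (X u t)) has_real_derivative swp fB (y0, X u y0) * (A (X u y0, y0) / B (X u y0, y0))) (at y0 within {-s..s})"
      by (rule SI_moving_deriv[OF continuous_on_swp[OF cfB]])
         (use ncurve_deriv[OF Xu(1)] ncurve_in[OF Xu(1)] y0 s_le_r in auto)
    moreover have "B (u, y0) \<noteq> 0" by (rule B_nz) (use that y0 s_le_r r_pos in auto)
    ultimately show ?thesis by (simp add: Xu fB_def)
  qed
  from DERIV_add[OF DERIV_diff[OF dM mv[OF xr(2)]] mv[OF xr(1)]]
  have "((\<lambda>y. SI (\<lambda>x. fB (x, y)) (X x1 y) (X x2 y) - SI (\<lambda>x. fB (x, y)) x2 (X x2 y) + SI (\<lambda>x. fB (x, y)) x1 (X x1 y))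
     has_real_derivative SI (\<lambda>x. K (x, y0)) x1 x2 - f (x2, y0) * A (x2, y0) + f (x1, y0) * A (x1, y0)) (at y0 within {-s..s})" .
  then have "((\<lambda>y. SI (\<lambda>x. fB (x, y)) x1 x2)
     has_real_derivative SI (\<lambda>x. K (x, y0)) x1 x2 - f (x2, y0) * A (x2, y0) + f (x1, y0) * A (x1, y0)) (at y0 within {-s..s})"
  proof (rule has_field_derivative_transform_within[where d=1])
    fix y assume y: "y \<in> {-s..s}"
    have "SI (\<lambda>x. fB (x, y)) (X x1 y) (X x2 y) = SI (\<lambda>x. fB (x, y)) x1 x2 + SI (\<lambda>x. fB (x, y)) x2 (X x2 y) - SI (\<lambda>x. fB (x, y)) x1 (X x1 y)"
      using SI_decomp[OF continuous_on_swp[OF cfB], of y x1 x2 "X x1 y" "X x2 y"] xr ncurve_sub[OF X1 X2 y] by simp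
    then show "SI (\<lambda>x. fB (x, y)) (X x1 y) (X x2 y) - SI (\<lambda>x. fB (x, y)) x2 (X x2 y) + SI (\<lambda>x. fB (x, y)) x1 (X x1 y) = SI (\<lambda>x. fB (x, y)) x1 x2"
      by simp
  qed (use y0 in auto)
  then show ?thesis by (simp add: algebra_simps)
qed

lemma flux_product: "flux_id s (\<lambda>p. f p * A p) (\<lambda>p. f p * B p) (\<lambda>p. h p + f p * H p)"
  unfolding flux_id_def
proof (intro allI impI)
  fix x1 x2 y1 y2 :: real
  assume hyp: "x1 \<in> {-s..s} \<and> x2 \<in> {-s..s} \<and> x1 \<le> x2 \<and> y1 \<in> {-s..s} \<and> y2 \<in> {-s..s} \<and> y1 \<le> y2"
  have sub: "{y1..y2} \<subseteq> {-r..r}" "{x1..x2} \<subseteq> {-r..r}" "{y1..y2} \<subseteq> {-s..s}" using hyp s_le_r by auto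
  have xr: "x1 \<in> {-r..r}" "x2 \<in> {-r..r}" "y1 \<in> {-r..r}" "y2 \<in> {-r..r}" using hyp s_le_r by auto
  let ?fA = "\<lambda>p. f p * A p"
  have cfA: "continuous_on (sq r) ?fA" by (intro continuous_intros cf cA)
  have cKi: "continuous_on {-r..r} (\<lambda>y. SI (\<lambda>x. K (x, y)) x1 x2)"
    using SI_param_continuous_fixed[OF continuous_on_swp[OF cK] xr(1,2)] by simp
  have "((\<lambda>y. SI (\<lambda>x. K (x, y)) x1 x2 - (?fA (x2, y) - ?fA (x1, y))) has_integral
     SI (\<lambda>x. fB (x, y2)) x1 x2 - SI (\<lambda>x. fB (x, y1)) x1 x2) {y1..y2}"
  proof (rule fundamental_theorem_of_calculus)
    fix y assume "y \<in> {y1..y2}"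
    then show "((\<lambda>y. SI (\<lambda>x. fB (x, y)) x1 x2) has_vector_derivative SI (\<lambda>x. K (x, y)) x1 x2 - (?fA (x2, y) - ?fA (x1, y))) (at y within {y1..y2})"
      using flux_level_deriv[of x1 x2 y] hyp sub(3)
      by (auto simp: has_real_derivative_iff_has_vector_derivative[symmetric] intro: DERIV_subset)
  qed (use hyp in auto)
  then have 1: "integral {y1..y2} (\<lambda>y. SI (\<lambda>x. K (x, y)) x1 x2 - (?fA (x2, y) - ?fA (x1, y)))
    = SI (\<lambda>x. fB (x, y2)) x1 x2 - SI (\<lambda>x. fB (x, y1)) x1 x2"
    by (rule integral_unique)
  have 2: "integral {y1..y2} (\<lambda>y. SI (\<lambda>x. K (x, y)) x1 x2 - (?fA (x2, y) - ?fA (x1, y)))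
    = integral {y1..y2} (\<lambda>y. SI (\<lambda>x. K (x, y)) x1 x2) - integral {y1..y2} (\<lambda>y. ?fA (x2, y) - ?fA (x1, y))"
    by (intro integral_diff integrable_continuous_real continuous_on_diff
        continuous_on_subset[OF cKi sub(1)] continuous_on_subset[OF continuous_on_slice(1)[OF cfA] sub(1)] xr)
  have 3: "integral {x1..x2} (\<lambda>x. fB (x, y2) - fB (x, y1)) = SI (\<lambda>x. fB (x, y2)) x1 x2 - SI (\<lambda>x. fB (x, y1)) x1 x2"
    using SI_diff[OF continuous_on_slice_seg(2)[OF cfB xr(4) xr(1,2)] continuous_on_slice_seg(2)[OF cfB xr(3) xr(1,2)]] hyp
    by (simp add: SI_def)
  have 4: "integral {y1..y2} (\<lambda>y. SI (\<lambda>x. K (x, y)) x1 x2) = integral {x1..x2} (\<lambda>x. integral {y1..y2} (\<lambda>y. K (x, y)))"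
    using integral_slice_swap[OF cK sub(2,1)] hyp by (simp add: SI_def)
  show "integral {y1..y2} (\<lambda>y. ?fA (x2, y) - ?fA (x1, y)) + integral {x1..x2} (\<lambda>x. f (x, y2) * B (x, y2) - f (x, y1) * B (x, y1))
     = integral {x1..x2} (\<lambda>x. integral {y1..y2} (\<lambda>y. h (x, y) + f (x, y) * H (x, y)))"
    using 1 2 3 4 by (simp add: fB_def K_def)
qed

end

section \<open>Characteristic curves as graphs\<close>

context flux_frame begin

text \<open>The hypothesis differentiates in the unit-speed parameter, as
  \<open>has_deriv_along\<close> does, the conclusion in the height. The two differ by
  \<open>dy = B dt\<close>, hence the division by \<open>B\<close>.\<close>

lemma ncurve_field_derivative:
  assumes f: "\<And>x y e. e > 0 \<Longrightarrow> (\<And>t. \<bar>t\<bar> < e \<Longrightarrow> (x t, y t) \<in> sq r \<and>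
      (x has_real_derivative A (x t, y t)) (at t) \<and> (y has_real_derivative B (x t, y t)) (at t)) \<Longrightarrow>
      ((\<lambda>t. f (x t, y t)) has_real_derivative h (x 0, y 0)) (at 0)"
    and X: "ncurve s X" and s: "s \<le> r" and y: "y \<in> {-s<..<s}"
  shows "((\<lambda>y. f (X y, y)) has_real_derivative h (X y, y) / B (X y, y)) (at y)"
proof -
  define e where "e = min (y + s) (s - y)"
  have e: "e > 0" using y by (auto simp: e_def)
  have in_s: "y + z \<in> {-s<..<s}" if "z \<in> {-e<..<e}" for z
    using that unfolding e_def greaterThanLessThan_iff by linarith
  have Xsq: "(X z, z) \<in> sq r" if "z \<in> {-s..s}" for z using ncurve_in[OF X that] that s by auto
  have cinv: "continuous_on {-s..s} (\<lambda>t. 1 / B (X t, t))"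
    by (intro continuous_intros continuous_on_pairI[OF cB ncurve_continuous[OF X]]) (use Xsq B_nz in auto)
  \<comment> \<open>\<open>T\<close> is the time needed from height \<open>y\<close>, and its
    inverse \<open>S\<close> below gives the height gained after a given time; followed at height
    \<open>y + S t\<close>, the graph becomes the unit-speed curve.\<close>
  define T where "T z = SI (\<lambda>t. 1 / B (X t, t)) y z" for z
  have dT: "(T has_real_derivative 1 / B (X z, z)) (at z)" if "z \<in> {-s<..<s}" for z
    using SI_has_real_derivative[OF cinv, of y z] that y at_within_Icc_at[of "-s" z s] by (simp add: T_def[abs_def])
  have dTy: "((\<lambda>z. T (y + z)) has_real_derivative 1 / B (X (y + z), y + z)) (at z)" if "z \<in> {-e<..<e}" for z
  proof -
    have "((\<lambda>z. y + z) has_real_derivative 1) (at z)" by (auto intro!: derivative_eq_intros)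
    from DERIV_chain2[where f=T and g="\<lambda>z. y + z", OF dT[OF in_s[OF that]] this] show ?thesis by simp
  qed
  have posB: "1 / B (X (y + z), y + z) > 0" if "z \<in> {-e<..<e}" for z
    using B_half[OF Xsq[of "y + z"]] in_s[OF that] by auto
  obtain d S where d: "d > 0" and S0: "S (T (y + 0)) = 0"
    and S: "\<And>t. \<bar>t - T (y + 0)\<bar> < d \<Longrightarrow> S t \<in> {-e<..<e} \<and> T (y + S t) = t \<and> (S has_real_derivative 1 / (1 / B (X (y + S t), y + S t))) (at t)"
    and ST: "\<And>z. z \<in> {-e/2..e/2} \<Longrightarrow> S (T (y + z)) = z"
    using reparam[where x="\<lambda>z. T (y + z)", OF e dTy posB] by blast
  have T0: "T y = 0" by (simp add: T_def)
  have S0': "S 0 = 0" using S0 T0 by simp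
  have S': "S t \<in> {-e<..<e}" "(S has_real_derivative B (X (y + S t), y + S t)) (at t)" if "\<bar>t\<bar> < d" for t
    using S[of t] that T0 by auto
  have "((\<lambda>t. f (X (y + S t), y + S t)) has_real_derivative h (X (y + S 0), y + S 0)) (at 0)"
  proof (rule f[OF d])
    fix t assume t: "\<bar>t\<bar> < d"
    have i: "y + S t \<in> {-s<..<s}" by (rule in_s[OF S'(1)[OF t]])
    then have i': "y + S t \<in> {-s..s}" by auto
    have dy: "((\<lambda>t. y + S t) has_real_derivative B (X (y + S t), y + S t)) (at t)"
      using S'(2)[OF t] by (auto intro!: derivative_eq_intros)
    have "(X has_real_derivative A (X (y + S t), y + S t) / B (X (y + S t), y + S t)) (at (y + S t))"
      using ncurve_deriv[OF X i'] i at_within_Icc_at[of "-s" "y + S t" s] by simp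
    from DERIV_chain2[where f=X and g="\<lambda>t. y + S t", OF this dy]
    have dx: "((\<lambda>t. X (y + S t)) has_real_derivative A (X (y + S t), y + S t)) (at t)"
      using B_nz[OF Xsq[OF i']] by simp
    show "(X (y + S t), y + S t) \<in> sq r \<and>
      ((\<lambda>t. X (y + S t)) has_real_derivative A (X (y + S t), y + S t)) (at t) \<and>
      ((\<lambda>t. y + S t) has_real_derivative B (X (y + S t), y + S t)) (at t)"
      using Xsq[OF i'] dx dy by blast
  qed
  then have dF: "((\<lambda>t. f (X (y + S t), y + S t)) has_real_derivative h (X y, y)) (at (T y))"
    by (simp add: T0 S0')
  have "((\<lambda>z. f (X (y + S (T z)), y + S (T z))) has_real_derivative h (X y, y) * (1 / B (X y, y))) (at y)"
    by (rule DERIV_chain2[OF dF dT[OF y]])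
  then have "((\<lambda>z. f (X (y + S (T z)), y + S (T z))) has_real_derivative h (X y, y) / B (X y, y)) (at y)"
    by simp
  then show ?thesis
  proof (rule has_field_derivative_transform_within[where d="e/2"])
    fix z assume "dist z y < e / 2"
    then have "z - y \<in> {-e/2..e/2}" unfolding dist_real_def atLeastAtMost_iff by linarith
    then have "S (T z) = z - y" using ST[of "z - y"] by simp
    then show "f (X (y + S (T z)), y + S (T z)) = f (X z, z)" by simp
  qed (use e in auto)
qed

text \<open>A \<open>ccurve\<close> is an unparametrised characteristic curve, written as a graph over the first axis.\<close>

definition ccurve :: "real \<Rightarrow> (real \<Rightarrow> real) \<Rightarrow> bool" where
  "ccurve s g \<longleftrightarrow> (\<forall>x\<in>{-s..s}. g x \<in> {-r/2..r/2} \<and>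
     (g has_real_derivative - A (x, g x) / B (x, g x)) (at x within {-s..s}))"

text \<open>The argument is that of \<open>ncurve_exists\<close> with a box of half the size: the
  graph keeps to heights at most \<open>r / 2\<close>, so that vertical translates by up to
  \<open>r / 2\<close> remain in the square.\<close>

lemma ccurve_exists:
  assumes "0 \<le> s" "16 * s \<le> r" "x0 \<in> {-s..s}" "\<bar>y0\<bar> \<le> r / 4"
  obtains g where "ccurve s g" "g x0 = y0"
proof -
  have sub: "{-r/2..r/2} \<times> {-r/2..r/2} \<subseteq> sq r" using r_pos by auto
  have c: "continuous_on ({-(r/2)..r/2} \<times> {-(r/2)..r/2}) (\<lambda>p. - A p / B p)"
    by (intro continuous_intros continuous_on_subset[OF cA] continuous_on_subset[OF cB]) (use B_nz sub in auto)
  have "\<exists>g. g x0 = y0 \<and> (\<forall>t\<in>{-s..s}. g t \<in> {-(r/2)..r/2} \<and> (g has_real_derivative - A (t, g t) / B (t, g t)) (at t within {-s..s}))"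
  proof (rule peano_box[OF c, of 2])
    fix p assume "p \<in> {-(r/2)..r/2} \<times> {-(r/2)..r/2}"
    then have "p \<in> sq r" using sub by auto
    then show "\<bar>- A p / B p\<bar> \<le> 2" using A_div_B_le[of p] by simp
  qed (use assms in auto)
  then show ?thesis using that unfolding ccurve_def by auto
qed

lemma ccurve_in: "ccurve s g \<Longrightarrow> x \<in> {-s..s} \<Longrightarrow> \<bar>g x\<bar> \<le> r / 2"
proof -
  assume "ccurve s g" "x \<in> {-s..s}"
  then have "g x \<in> {-r/2..r/2}" unfolding ccurve_def by blast
  then show ?thesis unfolding atLeastAtMost_iff by linarith
qed

lemma ccurve_deriv:
  "ccurve s g \<Longrightarrow> x \<in> {-s..s} \<Longrightarrow> (g has_real_derivative - A (x, g x) / B (x, g x)) (at x within {-s..s})"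
  unfolding ccurve_def by blast

lemma ccurve_continuous: "ccurve s g \<Longrightarrow> continuous_on {-s..s} g"
  unfolding ccurve_def by (rule DERIV_continuous_on) blast

lemma ccurve_sq: "ccurve s g \<Longrightarrow> x \<in> {-s..s} \<Longrightarrow> s \<le> r \<Longrightarrow> (x, g x) \<in> sq r \<and> g x \<in> {-r..r} \<and> x \<in> {-r..r}"
  using ccurve_in[of s g x] r_pos by (auto simp: abs_le_iff)

lemma ccurve_pair_continuous:
  fixes k :: "real \<times> real \<Rightarrow> real"
  assumes "ccurve s g" "s \<le> r" "continuous_on (sq r) k"
  shows "continuous_on {-s..s} (\<lambda>x. k (x, g x))"
  by (rule continuous_on_pairI[OF assms(3) _ ccurve_continuous[OF assms(1)]])
     (use ccurve_sq[OF assms(1) _ assms(2)] in auto)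

text \<open>Among all graphs, the flux of \<open>(A, B)\<close> through the translates of a characteristic graph is
  extremal at the graph itself, so the first variation of the flux in the translation parameter vanishes.\<close>

lemma ccurve_A_deriv:
  assumes g: "ccurve s g" and s: "s \<le> r" and x: "x \<in> {-s..s}"
  shows "((\<lambda>x. A (x, g x)) has_real_derivative H (x, g x)) (at x within {-s..s})"
proof -
  have I: "{-s..s} \<subseteq> {-r..r}" using s by auto
  have cHg: "continuous_on {-s..s} (\<lambda>x. H (x, g x))" by (rule ccurve_pair_continuous[OF g s cH])
  \<comment> \<open>The claim is that \<open>\<phi>\<close> is constant; then \<open>A\<close> along
    the graph is a primitive of \<open>H\<close>.\<close>
  define \<phi> where "\<phi> x = A (x, g x) - integral {-s..x} (\<lambda>x. H (x, g x))" for x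
  \<comment> \<open>Below, \<open>m x\<close> is the flux through the vertical segment of signed
    length \<open>\<epsilon>\<close> on the graph, so that \<open>m x / \<epsilon>\<close> is close
    to \<open>A (x, g x)\<close>. Extremality bounds the derivative of \<open>m\<close> from below
    only; dividing by \<open>\<epsilon>\<close> makes this a lower or an upper bound according to
    the sign, which \<open>sgn \<epsilon>\<close> records.\<close>
  have key: "sgn \<epsilon> * \<phi> u \<le> sgn \<epsilon> * \<phi> v + e * (2 + v - u)"
    if e: "e > 0" and uv: "u \<in> {-s..s}" "v \<in> {-s..s}" "u \<le> v" and \<epsilon>: "\<epsilon> \<noteq> 0" "\<bar>\<epsilon>\<bar> \<le> r / 2"
      and cl: "\<And>x y y'. x \<in> {-r..r} \<Longrightarrow> y \<in> {-r..r} \<Longrightarrow> y' \<in> {-r..r} \<Longrightarrow> \<bar>y - y'\<bar> \<le> \<bar>\<epsilon>\<bar> \<Longrightarrow>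
        \<bar>A (x, y) - A (x, y')\<bar> \<le> e \<and> \<bar>H (x, y) - H (x, y')\<bar> \<le> e" for e u v \<epsilon>
  proof -
    have inr: "g x \<in> {-r..r}" "g x + \<epsilon> \<in> {-r..r}" "x \<in> {-r..r}" if "x \<in> {-s..s}" for x
      using ccurve_in[OF g that] \<epsilon>(2) that s r_pos by (auto simp: abs_le_iff)
    have ap: "\<bar>SI (\<lambda>y. k (x, y)) (g x) (g x + \<epsilon>) - k (x, g x) * \<epsilon>\<bar> \<le> e * \<bar>\<epsilon>\<bar>"
      if x: "x \<in> {-s..s}" and k: "continuous_on (sq r) k"
        "\<And>y. y \<in> {-r..r} \<Longrightarrow> \<bar>y - g x\<bar> \<le> \<bar>\<epsilon>\<bar> \<Longrightarrow> \<bar>k (x, y) - k (x, g x)\<bar> \<le> e"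
      for x and k :: "real \<times> real \<Rightarrow> real"
    proof -
      have "\<bar>SI (\<lambda>y. k (x, y)) (g x) (g x + \<epsilon>) - k (x, g x) * (g x + \<epsilon> - g x)\<bar> \<le> e * \<bar>g x + \<epsilon> - g x\<bar>"
      proof (rule SI_approx[OF continuous_on_slice_seg(1)[OF k(1)]])
        fix t assume t: "t \<in> closed_segment (g x) (g x + \<epsilon>)"
        then have "t \<in> {-r..r}" using closed_segment_subset_Icc[OF inr(1,2)[OF x]] by blast
        moreover have "\<bar>t - g x\<bar> \<le> \<bar>\<epsilon>\<bar>"
          using t by (auto simp: closed_segment_eq_real_ivl split: if_splits)
        ultimately show "\<bar>k (x, t) - k (x, g x)\<bar> \<le> e" by (rule k(2))
      qed (use inr[OF x] in auto)
      then show ?thesis by simp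
    qed
    define m where "m x = SI (\<lambda>y. A (x, y)) (g x) (g x + \<epsilon>)" for x
    define m' where "m' x = (A (x, g x + \<epsilon>) * (- A (x, g x) / B (x, g x)) - B (x, g x + \<epsilon>))
      - (A (x, g x) * (- A (x, g x) / B (x, g x)) - B (x, g x)) + SI (\<lambda>y. H (x, y)) (g x) (g x + \<epsilon>)" for x
    have dm: "(m has_real_derivative m' x) (at x within {-s..s})" if x: "x \<in> {-s..s}" for x
      unfolding m_def m'_def
      by (rule flux_deriv[OF flux cA cB cH I x])
         (use ccurve_deriv[OF g x] inr in \<open>auto intro!: derivative_eq_intros\<close>)
    have m'_ge: "SI (\<lambda>y. H (x, y)) (g x) (g x + \<epsilon>) \<le> m' x" if x: "x \<in> {-s..s}" for x
    proof -
      let ?A0 = "A (x, g x)" let ?B0 = "B (x, g x)" let ?A1 = "A (x, g x + \<epsilon>)" let ?B1 = "B (x, g x + \<epsilon>)"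
      have sq0: "(x, g x) \<in> sq r" and sq1: "(x, g x + \<epsilon>) \<in> sq r" using inr[OF x] by auto
      have u0: "?A0\<^sup>2 + ?B0\<^sup>2 = 1" and u1: "?A1\<^sup>2 + ?B1\<^sup>2 = 1" using unit[OF sq0] unit[OF sq1] by auto
      have B0: "?B0 > 0" using B_half[OF sq0] by simp
      \<comment> \<open>The inner product of the unit vectors on the graph and on its translate is
        at most \<open>1\<close>, its value when both are taken on the graph. This is the
        extremality, and it stands in for a derivative of the field in the vertical
        direction.\<close>
      have "0 \<le> (?A1 - ?A0)\<^sup>2 + (?B1 - ?B0)\<^sup>2" by simp
      then have "?A1 * ?A0 + ?B1 * ?B0 \<le> 1" using u0 u1 by (simp add: power2_diff)
      then have "?A1 * ?A0 + ?B1 * ?B0 \<le> ?A0 * ?A0 + ?B0 * ?B0" using u0 by (simp add: power2_eq_square)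
      then have "(?A1 * ?A0 + ?B1 * ?B0) / ?B0 \<le> (?A0 * ?A0 + ?B0 * ?B0) / ?B0"
        using B0 by (intro divide_right_mono) auto
      then have "?A1 * ?A0 / ?B0 + ?B1 \<le> ?A0 * ?A0 / ?B0 + ?B0"
        using B0 by (simp add: add_divide_distrib)
      then show ?thesis by (simp add: m'_def)
    qed
    have "sgn \<epsilon> * (m u / \<epsilon> - integral {-s..u} (\<lambda>x. H (x, g x))) + e * u
       \<le> sgn \<epsilon> * (m v / \<epsilon> - integral {-s..v} (\<lambda>x. H (x, g x))) + e * v"
    proof (rule nondecreasing_within[where f="\<lambda>u. sgn \<epsilon> * (m u / \<epsilon> - integral {-s..u} (\<lambda>x. H (x, g x))) + e * u"
          and f'="\<lambda>x. sgn \<epsilon> * (m' x / \<epsilon> - H (x, g x)) + e", OF _ _ uv])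
      fix x assume x: "x \<in> {-s..s}"
      have "((\<lambda>u. sgn \<epsilon> * (m u / \<epsilon> - integral {-s..u} (\<lambda>x. H (x, g x))) + e * u) has_real_derivative
          sgn \<epsilon> * (m' x / \<epsilon> - H (x, g x)) + e * 1) (at x within {-s..s})"
        by (intro DERIV_add DERIV_cmult DERIV_diff DERIV_cdivide dm[OF x] integral_has_real_derivative[OF cHg x] DERIV_ident)
      then show "((\<lambda>u. sgn \<epsilon> * (m u / \<epsilon> - integral {-s..u} (\<lambda>x. H (x, g x))) + e * u) has_real_derivative
          sgn \<epsilon> * (m' x / \<epsilon> - H (x, g x)) + e) (at x within {-s..s})" by simp
      have "\<bar>SI (\<lambda>y. H (x, y)) (g x) (g x + \<epsilon>) - H (x, g x) * \<epsilon>\<bar> \<le> e * \<bar>\<epsilon>\<bar>"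
        by (rule ap[OF x cH]) (use cl inr[OF x] in auto)
      then have "- (e * \<bar>\<epsilon>\<bar>) \<le> m' x - H (x, g x) * \<epsilon>" using m'_ge[OF x] by linarith
      then have "0 \<le> (m' x - H (x, g x) * \<epsilon> + e * \<bar>\<epsilon>\<bar>) / \<bar>\<epsilon>\<bar>" using \<epsilon> by simp
      also have "\<dots> = sgn \<epsilon> * (m' x / \<epsilon> - H (x, g x)) + e"
        using \<epsilon> by (cases "\<epsilon> > 0") (auto simp: field_simps sgn_if)
      finally show "0 \<le> sgn \<epsilon> * (m' x / \<epsilon> - H (x, g x)) + e" .
    qed
    moreover have "\<bar>sgn \<epsilon> * (m x / \<epsilon>) - sgn \<epsilon> * A (x, g x)\<bar> \<le> e" if x: "x \<in> {-s..s}" for x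
    proof -
      have "\<bar>m x - A (x, g x) * \<epsilon>\<bar> \<le> e * \<bar>\<epsilon>\<bar>"
        unfolding m_def by (rule ap[OF x cA]) (use cl inr[OF x] in auto)
      then have "\<bar>m x - A (x, g x) * \<epsilon>\<bar> / \<bar>\<epsilon>\<bar> \<le> e" using \<epsilon> by (simp add: field_simps)
      also have "\<bar>m x - A (x, g x) * \<epsilon>\<bar> / \<bar>\<epsilon>\<bar> = \<bar>m x / \<epsilon> - A (x, g x)\<bar>"
        using \<epsilon> by (simp add: abs_divide[symmetric] diff_divide_distrib)
      finally have "\<bar>sgn \<epsilon>\<bar> * \<bar>m x / \<epsilon> - A (x, g x)\<bar> \<le> e" using \<epsilon> by (simp add: abs_sgn_eq)
      then show ?thesis by (simp only: abs_mult[symmetric] right_diff_distrib)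
    qed
    note this[OF uv(1)] this[OF uv(2)]
    ultimately show ?thesis unfolding \<phi>_def right_diff_distrib distrib_left by linarith
  qed
  \<comment> \<open>Letting \<open>\<epsilon>\<close> tend to \<open>0\<close> through positive and
    through negative values shows that \<open>\<phi>\<close> is nondecreasing and
    nonincreasing.\<close>
  have le: "\<sigma> * \<phi> u \<le> \<sigma> * \<phi> v" if \<sigma>: "\<bar>\<sigma>\<bar> = 1" and uv: "u \<in> {-s..s}" "v \<in> {-s..s}" "u \<le> v" for \<sigma> u v
  proof (rule field_le_epsilon)
    fix e' :: real assume e': "e' > 0"
    define e where "e = e' / (2 + v - u)"
    have e: "e > 0" "e * (2 + v - u) = e'" using e' uv by (auto simp: e_def)
    obtain d1 where d1: "d1 > 0" "\<And>x y x' y'. x \<in> {-r..r} \<Longrightarrow> y \<in> {-r..r} \<Longrightarrow> x' \<in> {-r..r} \<Longrightarrow> y' \<in> {-r..r} \<Longrightarrow>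
      \<bar>x - x'\<bar> < d1 \<Longrightarrow> \<bar>y - y'\<bar> < d1 \<Longrightarrow> \<bar>A (x, y) - A (x', y')\<bar> < e"
      using uniform_on_sq[OF cA e(1)] by metis
    obtain d2 where d2: "d2 > 0" "\<And>x y x' y'. x \<in> {-r..r} \<Longrightarrow> y \<in> {-r..r} \<Longrightarrow> x' \<in> {-r..r} \<Longrightarrow> y' \<in> {-r..r} \<Longrightarrow>
      \<bar>x - x'\<bar> < d2 \<Longrightarrow> \<bar>y - y'\<bar> < d2 \<Longrightarrow> \<bar>H (x, y) - H (x', y')\<bar> < e"
      using uniform_on_sq[OF cH e(1)] by metis
    define \<epsilon> where "\<epsilon> = \<sigma> * min (r / 2) (min d1 d2 / 2)"
    define \<mu> where "\<mu> = min (r / 2) (min d1 d2 / 2)"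
    have \<mu>: "\<mu> > 0" "\<mu> \<le> r / 2" "\<mu> < d1" "\<mu> < d2" using r_pos d1(1) d2(1) by (auto simp: \<mu>_def)
    have \<epsilon>: "\<epsilon> = \<sigma> * \<mu>" by (simp add: \<epsilon>_def \<mu>_def)
    have ab: "\<bar>\<epsilon>\<bar> = \<mu>" using \<sigma> \<mu> by (simp add: \<epsilon> abs_mult)
    have sg: "sgn \<epsilon> = \<sigma>" using \<sigma> \<mu> by (auto simp: \<epsilon> sgn_mult sgn_if abs_if split: if_splits)
    have "sgn \<epsilon> * \<phi> u \<le> sgn \<epsilon> * \<phi> v + e * (2 + v - u)"
    proof (rule key[OF e(1) uv])
      fix x y y' assume "x \<in> {-r..r}" "y \<in> {-r..r}" "y' \<in> {-r..r}" "\<bar>y - y'\<bar> \<le> \<bar>\<epsilon>\<bar>"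
      then show "\<bar>A (x, y) - A (x, y')\<bar> \<le> e \<and> \<bar>H (x, y) - H (x, y')\<bar> \<le> e"
        using d1(2)[of x y x y'] d2(2)[of x y x y'] ab \<mu> d1(1) d2(1) by auto
    qed (use ab \<mu> in auto)
    then show "\<sigma> * \<phi> u \<le> \<sigma> * \<phi> v + e'" by (simp add: sg e(2))
  qed
  have const: "\<phi> u = \<phi> (-s)" if u: "u \<in> {-s..s}" for u
    using le[of 1 "-s" u] le[of "-1" "-s" u] u by auto
  have "((\<lambda>u. \<phi> (-s) + integral {-s..u} (\<lambda>x. H (x, g x))) has_real_derivative 0 + H (x, g x)) (at x within {-s..s})"
    by (intro DERIV_add DERIV_const integral_has_real_derivative[OF cHg x])
  then have "((\<lambda>u. \<phi> (-s) + integral {-s..u} (\<lambda>x. H (x, g x))) has_real_derivative H (x, g x)) (at x within {-s..s})"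
    by simp
  then show ?thesis
  proof (rule has_field_derivative_transform_within[where d=1])
    fix u assume "u \<in> {-s..s}"
    from const[OF this] show "\<phi> (-s) + integral {-s..u} (\<lambda>x. H (x, g x)) = A (u, g u)" by (simp add: \<phi>_def)
  qed (use x in auto)
qed

lemma B_eq_sqrt: "p \<in> sq r \<Longrightarrow> sqrt (1 - (A p)\<^sup>2) = B p"
  using unit[of p] B_half[of p] by (intro real_sqrt_unique) auto

lemma A_lt_1: "p \<in> sq r \<Longrightarrow> -1 < A p \<and> A p < 1"
proof -
  assume p: "p \<in> sq r"
  have "(1/2)\<^sup>2 \<le> (B p)\<^sup>2" using B_half[OF p] by (intro power_mono) auto
  then have "(A p)\<^sup>2 < 1" using unit[OF p] by (simp add: power2_eq_square)
  then show ?thesis using abs_square_less_1[of "A p"] by auto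
qed

text \<open>The angle of \<open>(A, B)\<close> measured from the second axis: \<open>A\<close> is
  its sine and \<open>B > 0\<close> its cosine. Along a characteristic graph its derivative will be
  \<open>H / B\<close>, that is \<open>H\<close> in arc length, so \<open>H\<close> prescribes the
  curvature of characteristic curves.\<close>

definition slope_angle :: "real \<times> real \<Rightarrow> real" where "slope_angle p = arctan (A p / B p)"

lemma ccurve_angle_deriv:
  assumes g: "ccurve s g" and s: "s \<le> r" and x: "x \<in> {-s..s}"
  shows "((\<lambda>x. slope_angle (x, g x)) has_real_derivative H (x, g x) / B (x, g x)) (at x within {-s..s})"
proof -
  have eq: "slope_angle p = arcsin (A p)" if "p \<in> sq r" for p
    using arcsin_arctan[of "A p"] A_lt_1[OF that] B_eq_sqrt[OF that] by (simp add: slope_angle_def)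
  have p: "(x, g x) \<in> sq r" using ccurve_sq[OF g x s] by simp
  have "((\<lambda>x. arcsin (A (x, g x))) has_real_derivative inverse (sqrt (1 - (A (x, g x))\<^sup>2)) * H (x, g x)) (at x within {-s..s})"
    using A_lt_1[OF p] by (intro DERIV_chain2[OF DERIV_arcsin ccurve_A_deriv[OF g s x]]) auto
  then have "((\<lambda>x. arcsin (A (x, g x))) has_real_derivative H (x, g x) / B (x, g x)) (at x within {-s..s})"
    by (simp add: B_eq_sqrt[OF p] field_simps)
  then show ?thesis
    by (rule has_field_derivative_transform_within[where d=1]) (use x eq ccurve_sq[OF g _ s] in auto)
qed

lemma ccurve_B_deriv:
  assumes g: "ccurve s g" and s: "s \<le> r" and x: "x \<in> {-s..s}"
  shows "((\<lambda>x. B (x, g x)) has_real_derivative - A (x, g x) * H (x, g x) / B (x, g x)) (at x within {-s..s})"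
proof -
  have p: "(x, g x) \<in> sq r" using ccurve_sq[OF g x s] by simp
  have pos: "0 < 1 - (A (x, g x))\<^sup>2" using A_lt_1[OF p] abs_square_less_1[of "A (x, g x)"] by auto
  have "((\<lambda>x. sqrt (1 - (A (x, g x))\<^sup>2)) has_real_derivative - A (x, g x) * H (x, g x) / sqrt (1 - (A (x, g x))\<^sup>2)) (at x within {-s..s})"
    using pos by (auto intro!: derivative_eq_intros ccurve_A_deriv[OF g s x] simp: field_simps)
  then have "((\<lambda>x. sqrt (1 - (A (x, g x))\<^sup>2)) has_real_derivative - A (x, g x) * H (x, g x) / B (x, g x)) (at x within {-s..s})"
    by (simp add: B_eq_sqrt[OF p])
  then show ?thesis
    by (rule has_field_derivative_transform_within[where d=1]) (use x B_eq_sqrt ccurve_sq[OF g _ s] in auto)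
qed

end

section \<open>Distances of neighbouring characteristic curves\<close>

text \<open>The square now carries three balances: \<open>div N = H\<close>,
  \<open>div (H N) = K\<close> and \<open>curl (D N) = c\<close>, the last one written as the
  divergence of the rotated field \<open>(D B, - D A)\<close>, which is tangent to characteristic
  curves.\<close>

locale char_frame = flux_frame +
  fixes D c K :: "real \<times> real \<Rightarrow> real"
  assumes cD: "continuous_on (sq r) D" and cc: "continuous_on (sq r) c" and cK: "continuous_on (sq r) K"
    and D_pos: "\<And>p. p \<in> sq r \<Longrightarrow> D p > 0"
    and flux_D: "flux_id r (\<lambda>p. D p * B p) (\<lambda>p. - (D p * A p)) c"
    and flux_H: "flux_id r (\<lambda>p. H p * A p) (\<lambda>p. H p * B p) K"
begin

lemma D_lower:
  obtains \<kappa> where "\<kappa> > 0" "\<And>p. p \<in> sq r \<Longrightarrow> \<kappa> \<le> D p * B p"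
proof -
  have ne: "sq r \<noteq> {}" using r_pos by auto
  have cp: "compact (sq r)" by (auto intro!: compact_Times)
  have "continuous_on (sq r) (\<lambda>p. D p * B p)" by (intro continuous_intros cD cB)
  from continuous_attains_inf[OF cp ne this]
  obtain p0 where p0: "p0 \<in> sq r" "\<And>p. p \<in> sq r \<Longrightarrow> D p0 * B p0 \<le> D p * B p"
    by blast
  have "0 < D p0 * B p0" using D_pos[OF p0(1)] B_half[OF p0(1)] by (intro mult_pos_pos) auto
  then show ?thesis using that p0(2) by blast
qed

text \<open>Both graphs are tangent to the rotated field \<open>(D B, - D A)\<close>, so they carry
  no flux and only the source \<open>c\<close> between them remains.\<close>

lemma ccurve_flux_D:
  assumes g: "ccurve s g0" "ccurve s g1" and s: "s \<le> r" and x: "x \<in> {-s..s}"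
  shows "((\<lambda>x. SI (\<lambda>y. D (x, y) * B (x, y)) (g0 x) (g1 x)) has_real_derivative SI (\<lambda>y. c (x, y)) (g0 x) (g1 x)) (at x within {-s..s})"
proof -
  have I: "{-s..s} \<subseteq> {-r..r}" using s by auto
  have sq: "(x, g0 x) \<in> sq r" "(x, g1 x) \<in> sq r" using ccurve_sq[OF g(1) x s] ccurve_sq[OF g(2) x s] by auto
  have "((\<lambda>x. SI (\<lambda>y. D (x, y) * B (x, y)) (g0 x) (g1 x)) has_real_derivative
    (D (x, g1 x) * B (x, g1 x) * (- A (x, g1 x) / B (x, g1 x)) - - (D (x, g1 x) * A (x, g1 x)))
    - (D (x, g0 x) * B (x, g0 x) * (- A (x, g0 x) / B (x, g0 x)) - - (D (x, g0 x) * A (x, g0 x)))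
    + SI (\<lambda>y. c (x, y)) (g0 x) (g1 x)) (at x within {-s..s})"
    by (rule flux_deriv[OF flux_D _ _ cc I x ccurve_deriv[OF g(1) x] ccurve_deriv[OF g(2) x]])
       (use ccurve_sq[OF g(1) _ s] ccurve_sq[OF g(2) _ s] in \<open>auto intro!: continuous_intros cD cB cA\<close>)
  then show ?thesis using B_nz[OF sq(1)] B_nz[OF sq(2)] by simp
qed

text \<open>\<open>H N\<close> is normal to the graphs, and each of them contributes
  \<open>H / B\<close> up to sign. This is exactly the derivative of the angle along the graph, so
  adding the difference of the angles removes both side terms and leaves only \<open>K\<close>
  between the curves.\<close>

lemma ccurve_flux_H:
  assumes g: "ccurve s g0" "ccurve s g1" and s: "s \<le> r" and x: "x \<in> {-s..s}"
  shows "((\<lambda>x. slope_angle (x, g1 x) - slope_angle (x, g0 x) + SI (\<lambda>y. H (x, y) * A (x, y)) (g0 x) (g1 x))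
    has_real_derivative SI (\<lambda>y. K (x, y)) (g0 x) (g1 x)) (at x within {-s..s})"
proof -
  have I: "{-s..s} \<subseteq> {-r..r}" using s by auto
  have sq: "(x, g0 x) \<in> sq r" "(x, g1 x) \<in> sq r" using ccurve_sq[OF g(1) x s] ccurve_sq[OF g(2) x s] by auto
  have e: "H p * A p * (- A p / B p) - H p * B p = - (H p / B p)" if "p \<in> sq r" for p
  proof -
    have "H p * A p * (- A p / B p) - H p * B p = - (H p * ((A p)\<^sup>2 + (B p)\<^sup>2) / B p)"
      using B_nz[OF that] by (simp add: field_simps power2_eq_square)
    then show ?thesis using unit[OF that] by simp
  qed
  have "((\<lambda>x. SI (\<lambda>y. H (x, y) * A (x, y)) (g0 x) (g1 x)) has_real_derivative
    (H (x, g1 x) * A (x, g1 x) * (- A (x, g1 x) / B (x, g1 x)) - H (x, g1 x) * B (x, g1 x))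
    - (H (x, g0 x) * A (x, g0 x) * (- A (x, g0 x) / B (x, g0 x)) - H (x, g0 x) * B (x, g0 x))
    + SI (\<lambda>y. K (x, y)) (g0 x) (g1 x)) (at x within {-s..s})"
    by (rule flux_deriv[OF flux_H _ _ cK I x ccurve_deriv[OF g(1) x] ccurve_deriv[OF g(2) x]])
       (use ccurve_sq[OF g(1) _ s] ccurve_sq[OF g(2) _ s] in \<open>auto intro!: continuous_intros cH cB cA\<close>)
  from DERIV_add[OF DERIV_diff[OF ccurve_angle_deriv[OF g(2) s x] ccurve_angle_deriv[OF g(1) s x]] this]
  show ?thesis unfolding e[OF sq(1)] e[OF sq(2)] by simp
qed

text \<open>The weight is \<open>D * B\<close>, which has a positive minimum on the compact square.
  Within the square, characteristic curves therefore neither branch nor merge.\<close>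

lemma ccurve_spread:
  obtains C where "C > 0" "\<And>s g0 g1 x x'. s \<le> r \<Longrightarrow> ccurve s g0 \<Longrightarrow> ccurve s g1 \<Longrightarrow> x \<in> {-s..s} \<Longrightarrow> x' \<in> {-s..s} \<Longrightarrow>
    \<bar>g1 x - g0 x\<bar> \<le> C * \<bar>g1 x' - g0 x'\<bar>"
proof -
  obtain \<kappa> where \<kappa>: "\<kappa> > 0" "\<And>p. p \<in> sq r \<Longrightarrow> \<kappa> \<le> D p * B p" using D_lower by blast
  have cDB: "continuous_on (sq r) (\<lambda>p. D p * B p)" by (intro continuous_intros cD cB)
  show ?thesis
  proof (rule SI_spread[OF cDB cc \<kappa> r_pos])
    fix C :: real
    assume C0: "C > 0" and C: "\<And>s g0 g1 y y'. s \<le> r \<Longrightarrow> (\<And>t. t \<in> {-s..s} \<Longrightarrow> g0 t \<in> {-r..r} \<and> g1 t \<in> {-r..r} \<and>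
      ((\<lambda>t. SI (\<lambda>x. D (t, x) * B (t, x)) (g0 t) (g1 t)) has_real_derivative SI (\<lambda>x. c (t, x)) (g0 t) (g1 t)) (at t within {-s..s})) \<Longrightarrow>
      y \<in> {-s..s} \<Longrightarrow> y' \<in> {-s..s} \<Longrightarrow> \<bar>g1 y - g0 y\<bar> \<le> C * \<bar>g1 y' - g0 y'\<bar>"
    show thesis
    proof (rule that[OF C0])
      fix s g0 g1 x x'
      assume s: "s \<le> r" and g: "ccurve s g0" "ccurve s g1" and x: "x \<in> {-s..s}" "x' \<in> {-s..s}"
      show "\<bar>g1 x - g0 x\<bar> \<le> C * \<bar>g1 x' - g0 x'\<bar>"
        by (rule C[OF s _ x]) (use ccurve_flux_D[OF g s] ccurve_sq[OF g(1) _ s] ccurve_sq[OF g(2) _ s] in blast)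
    qed
  qed
qed

lemma ccurve_unique:
  assumes "s \<le> r" "ccurve s g0" "ccurve s g1" "x0 \<in> {-s..s}" "g0 x0 = g1 x0" "x \<in> {-s..s}"
  shows "g0 x = g1 x"
proof -
  obtain C where "\<bar>g1 x - g0 x\<bar> \<le> C * \<bar>g1 x0 - g0 x0\<bar>" using ccurve_spread assms by metis
  then show ?thesis using assms by simp
qed

text \<open>The infinitesimal distance \<open>\<zeta>\<close> to the neighbouring characteristic graphs and the first variation
  \<open>e\<close> of their angles exist as subsequential limits of difference quotients and solve a linear system.\<close>

lemma ccurve_variation:
  assumes g0: "ccurve s g0" and g00: "\<bar>g0 0\<bar> \<le> r / 8" and s: "0 < s" "16 * s \<le> r"
  obtains \<zeta> e where "\<And>x. x \<in> {-s..s} \<Longrightarrow> \<zeta> x > 0 \<and>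
    (\<zeta> has_real_derivative - (e x - H (x, g0 x) * A (x, g0 x) * \<zeta> x) / (B (x, g0 x))\<^sup>2) (at x within {-s..s}) \<and>
    (e has_real_derivative K (x, g0 x) * \<zeta> x) (at x within {-s..s}) \<and>
    ((\<lambda>x. D (x, g0 x) * B (x, g0 x) * \<zeta> x) has_real_derivative c (x, g0 x) * \<zeta> x) (at x within {-s..s})"
proof -
  have sr: "s \<le> r" using s by simp
  \<comment> \<open>Together with \<open>\<bar>g0 0\<bar> \<le> r / 8\<close> this keeps the
    starting heights within the bound \<open>r / 4\<close> that \<open>ccurve_exists\<close>
    requires.\<close>
  define \<epsilon> where "\<epsilon> n = r / 8 / real (Suc n)" for n
  have \<epsilon>: "\<epsilon> n > 0" "\<epsilon> n \<le> r / 8" for n using r_pos by (auto simp: \<epsilon>_def field_simps)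
  have \<epsilon>0: "\<epsilon> \<longlonglongrightarrow> 0" unfolding \<epsilon>_def by real_asymp
  have "\<exists>g. ccurve s g \<and> g 0 = g0 0 + \<epsilon> n" for n
  proof -
    have "\<bar>g0 0 + \<epsilon> n\<bar> \<le> r / 4" using g00 \<epsilon>[of n] by linarith
    then show ?thesis using ccurve_exists[of s 0 "g0 0 + \<epsilon> n"] s by (metis atLeastAtMost_iff less_imp_le neg_le_0_iff_le)
  qed
  then obtain G where G: "\<And>n. ccurve s (G n)" "\<And>n. G n 0 = g0 0 + \<epsilon> n" by metis
  have x0: "0 \<in> {-s..s}" using s by auto
  obtain C where C: "C > 0" "\<And>s g0 g1 x x'. s \<le> r \<Longrightarrow> ccurve s g0 \<Longrightarrow> ccurve s g1 \<Longrightarrow> x \<in> {-s..s} \<Longrightarrow> x' \<in> {-s..s} \<Longrightarrow>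
    \<bar>g1 x - g0 x\<bar> \<le> C * \<bar>g1 x' - g0 x'\<bar>" by (rule ccurve_spread) blast
  define z where "z n x = (G n x - g0 x) / \<epsilon> n" for n x
  have Gz: "G n x - g0 x = \<epsilon> n * z n x" for n x using \<epsilon>(1)[of n] by (simp add: z_def)
  \<comment> \<open>These are the spread estimates from \<open>0\<close> to \<open>x\<close> and
    from \<open>x\<close> to \<open>0\<close>; the lower bound keeps the limit positive.\<close>
  have zC: "\<bar>z n x\<bar> \<le> C" "1 / C \<le> \<bar>z n x\<bar>" if "x \<in> {-s..s}" for n x
    using C(2)[OF sr g0 G(1)[of n] that x0] C(2)[OF sr g0 G(1)[of n] x0 that] \<epsilon>(1)[of n] C(1) G(2)[of n]
    by (auto simp: z_def abs_divide field_simps)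
  have z0: "z n 0 = 1" for n using \<epsilon>(1)[of n] G(2)[of n] by (simp add: z_def)
  define \<tau> where "\<tau> n x = slope_angle (x, G n x)" for n x
  define \<tau>0 where "\<tau>0 x = slope_angle (x, g0 x)" for x
  define S where "S k n x = SI (\<lambda>y. k (x, y)) (g0 x) (G n x) / \<epsilon> n" for k n x
  \<comment> \<open>The quotient of the angles alone has as derivative a difference quotient of
    \<open>H / B\<close>, which need not be bounded. With the flux of \<open>H N\<close> added the
    derivative is \<open>S K n\<close>, a mean of \<open>K\<close> times \<open>z n\<close>, hence
    bounded.\<close>
  define e where "e n x = (\<tau> n x - \<tau>0 x) / \<epsilon> n + S (\<lambda>p. H p * A p) n x" for n x
  have sq0: "(x, g0 x) \<in> sq r" "g0 x \<in> {-r..r}" "x \<in> {-r..r}" if "x \<in> {-s..s}" for x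
    using ccurve_sq[OF g0 that sr] by auto
  have sqG: "(x, G n x) \<in> sq r" "G n x \<in> {-r..r}" if "x \<in> {-s..s}" for x n
    using ccurve_sq[OF G(1) that sr] by auto
  have tanG: "tan (\<tau> n x) = A (x, G n x) / B (x, G n x)" "tan (\<tau>0 x) = A (x, g0 x) / B (x, g0 x)" for n x
    by (simp_all add: \<tau>_def \<tau>0_def slope_angle_def tan_arctan)
  define z' where "z' n x = - (tan (\<tau> n x) - tan (\<tau>0 x)) / \<epsilon> n" for n x
  have dz: "(z n has_real_derivative z' n x) (at x within {-s..s})" if x: "x \<in> {-s..s}" for n x
  proof -
    have "((\<lambda>x. (G n x - g0 x) / \<epsilon> n) has_real_derivative
       (- A (x, G n x) / B (x, G n x) - - A (x, g0 x) / B (x, g0 x)) / \<epsilon> n) (at x within {-s..s})"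
      by (intro DERIV_cdivide DERIV_diff ccurve_deriv G g0 x)
    then show ?thesis by (simp add: z_def[abs_def] z'_def tanG)
  qed
  have de: "(e n has_real_derivative S K n x) (at x within {-s..s})" if x: "x \<in> {-s..s}" for n x
  proof -
    have "((\<lambda>x. (slope_angle (x, G n x) - slope_angle (x, g0 x) + SI (\<lambda>y. H (x, y) * A (x, y)) (g0 x) (G n x)) / \<epsilon> n)
       has_real_derivative SI (\<lambda>y. K (x, y)) (g0 x) (G n x) / \<epsilon> n) (at x within {-s..s})"
      by (intro DERIV_cdivide ccurve_flux_H[OF g0 G(1) sr x])
    then show ?thesis by (simp add: e_def[abs_def] S_def[abs_def] \<tau>_def \<tau>0_def add_divide_distrib)
  qed
  have dm: "(S (\<lambda>p. D p * B p) n has_real_derivative S c n x) (at x within {-s..s})" if x: "x \<in> {-s..s}" for n x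
    unfolding S_def[abs_def] by (intro DERIV_cdivide ccurve_flux_D[OF g0 G(1) sr x])
  have Sb: "\<exists>M>0. \<forall>n. \<forall>x\<in>{-s..s}. \<bar>S k n x\<bar> \<le> M" if k: "continuous_on (sq r) k" for k
  proof -
    obtain M where M: "M > 0" "\<And>x y. x \<in> {-r..r} \<Longrightarrow> y \<in> {-r..r} \<Longrightarrow> \<bar>k (x, y)\<bar> \<le> M"
      using bounded_on_sq[OF k] by metis
    have "\<bar>S k n x\<bar> \<le> M * C" if x: "x \<in> {-s..s}" for n x
    proof -
      have "\<bar>SI (\<lambda>y. k (x, y)) (g0 x) (G n x)\<bar> \<le> M * \<bar>G n x - g0 x\<bar>"
        by (rule SI_abs_le[OF continuous_on_slice_seg(1)[OF k]])
           (use sq0[OF x] sqG[OF x] M closed_segment_subset_Icc in blast)+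
      also have "\<dots> = M * \<bar>z n x\<bar> * \<epsilon> n" using \<epsilon>(1)[of n] by (simp add: Gz abs_mult)
      also have "\<dots> \<le> M * C * \<epsilon> n"
        using zC(1)[OF x, of n] M(1) \<epsilon>(1)[of n] by (intro mult_right_mono mult_left_mono) auto
      finally show ?thesis using \<epsilon>(1)[of n] by (simp add: S_def abs_divide field_simps)
    qed
    then show ?thesis using M(1) C(1) by (intro exI[of _ "M * C"]) auto
  qed
  have cHA: "continuous_on (sq r) (\<lambda>p. H p * A p)" and cDB: "continuous_on (sq r) (\<lambda>p. D p * B p)"
    by (intro continuous_intros cH cA cD cB)+
  obtain MK where MK: "MK > 0" "\<And>n x. x \<in> {-s..s} \<Longrightarrow> \<bar>S K n x\<bar> \<le> MK" using Sb[OF cK] by metis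
  obtain Mc where Mc: "Mc > 0" "\<And>n x. x \<in> {-s..s} \<Longrightarrow> \<bar>S c n x\<bar> \<le> Mc" using Sb[OF cc] by metis
  obtain MA where MA: "MA > 0" "\<And>n x. x \<in> {-s..s} \<Longrightarrow> \<bar>S (\<lambda>p. H p * A p) n x\<bar> \<le> MA" using Sb[OF cHA] by metis
  have arctan_le: "\<bar>a - b\<bar> \<le> \<bar>tan a - tan b\<bar>" if "a = arctan a'" "b = arctan b'" for a b a' b' :: real
  proof -
    have "norm (arctan a' - arctan b') \<le> 1 * norm (a' - b')"
      by (rule field_differentiable_bound[of UNIV arctan "\<lambda>x. inverse (1 + x\<^sup>2)"])
         (auto intro!: DERIV_arctan simp: norm_inverse inverse_le_1_iff)
    then show ?thesis using that by (simp add: tan_arctan)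
  qed
  \<comment> \<open>\<open>5 = 1 + 2\<^sup>2\<close> bounds the derivative
    \<open>1 + (tan x)\<^sup>2\<close> where the slope is at most \<open>2\<close>.\<close>
  have tan_le: "\<bar>tan (arctan a') - tan (arctan b')\<bar> \<le> 5 * \<bar>arctan a' - arctan b'\<bar>"
    if ab: "\<bar>a'\<bar> \<le> 2" "\<bar>b'\<bar> \<le> 2" for a' b' :: real
  proof -
    have "norm (tan (arctan a') - tan (arctan b')) \<le> 5 * norm (arctan a' - arctan b')"
    proof (rule field_differentiable_bound[of "{arctan (-2)..arctan 2}" tan "\<lambda>x. inverse ((cos x)\<^sup>2)"])
      fix x assume "x \<in> {arctan (-2)..arctan 2}"
      then have x: "arctan (-2) \<le> x" "x \<le> arctan 2" by auto
      have "- (pi/2) < x" "x < pi/2" using x arctan_lbound[of "-2"] arctan_ubound[of 2] by linarith+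
      then have xa: "arctan (tan x) = x" by (rule arctan_tan)
      have "arctan (-2) \<le> arctan (tan x)" "arctan (tan x) \<le> arctan 2" unfolding xa by (rule x)+
      then have tx: "\<bar>tan x\<bar> \<le> 2" unfolding arctan_le_iff by linarith
      have cx: "cos x \<noteq> 0" using cos_arctan_not_zero[of "tan x"] xa by simp
      show "(tan has_real_derivative inverse ((cos x)\<^sup>2)) (at x within {arctan (-2)..arctan 2})"
        by (rule has_field_derivative_at_within[OF DERIV_tan[OF cx]])
      have "inverse ((cos x)\<^sup>2) = 1 + (tan x)\<^sup>2"
        using tan_sec[OF cx] by (simp add: power_inverse)
      moreover have "(tan x)\<^sup>2 \<le> 2\<^sup>2" using tx by (intro abs_le_square_iff[THEN iffD1]) auto
      ultimately show "norm (inverse ((cos x)\<^sup>2)) \<le> 5" by simp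
    qed (use ab in \<open>auto simp: arctan_le_iff abs_le_iff simp del: arctan_minus\<close>)
    then show ?thesis by simp
  qed
  have slope2: "\<bar>A (x, G n x) / B (x, G n x)\<bar> \<le> 2" "\<bar>A (x, g0 x) / B (x, g0 x)\<bar> \<le> 2" if "x \<in> {-s..s}" for n x
    using A_div_B_le sq0[OF that] sqG[OF that] by blast+
  define E where "E = 2 * C / s + MA + MK * (2 * s)"
  have eb: "\<bar>e n x\<bar> \<le> E" if x: "x \<in> {-s..s}" for n x
  proof -
    \<comment> \<open>No bound for the angles at \<open>0\<close> is available. But
      \<open>z n\<close> is bounded, so somewhere its derivative is at most
      \<open>2 * C / s\<close>; at that \<open>\<xi>\<close> the angles are controlled by the
      slopes, and from there \<open>e n\<close> varies by at most
      \<open>MK * (2 * s)\<close>.\<close>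
    have "\<exists>\<xi>\<in>{0<..<s}. z n s - z n 0 = z' n \<xi> * (s - 0)"
    proof (rule mvt_simple[OF s(1)])
      fix \<xi> assume "0 \<le> \<xi>" "\<xi> \<le> s"
      then have "(z n has_real_derivative z' n \<xi>) (at \<xi> within {0..s})"
        by (intro DERIV_subset[OF dz]) auto
      then show "(z n has_derivative (*) (z' n \<xi>)) (at \<xi> within {0..s})" by (simp add: has_field_derivative_def)
    qed
    then obtain \<xi> where \<xi>: "\<xi> \<in> {0<..<s}" "z n s - z n 0 = z' n \<xi> * (s - 0)" by blast
    have \<xi>': "\<xi> \<in> {-s..s}" "s \<in> {-s..s}" using \<xi>(1) by auto
    have "\<bar>z' n \<xi>\<bar> * s = \<bar>z n s - z n 0\<bar>" using \<xi>(2) s(1) by (simp add: abs_mult)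
    also have "\<dots> \<le> 2 * C" using zC(1)[OF \<xi>'(2), of n] zC(1)[OF x0, of n] by linarith
    finally have zz: "\<bar>z' n \<xi>\<bar> \<le> 2 * C / s" using s(1) by (simp add: field_simps)
    have "\<bar>\<tau> n \<xi> - \<tau>0 \<xi>\<bar> \<le> \<bar>tan (\<tau> n \<xi>) - tan (\<tau>0 \<xi>)\<bar>"
      by (rule arctan_le) (simp_all add: \<tau>_def \<tau>0_def slope_angle_def)
    then have "\<bar>(\<tau> n \<xi> - \<tau>0 \<xi>) / \<epsilon> n\<bar> \<le> \<bar>z' n \<xi>\<bar>"
      unfolding z'_def abs_divide abs_minus_cancel by (rule divide_right_mono) simp
    then have "\<bar>e n \<xi>\<bar> \<le> 2 * C / s + MA"
      using zz MA(2)[OF \<xi>'(1), of n] unfolding e_def by linarith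
    moreover have "\<bar>e n x - e n \<xi>\<bar> \<le> MK * (2 * s)"
    proof -
      have "norm (e n x - e n \<xi>) \<le> MK * norm (x - \<xi>)"
        by (rule field_differentiable_bound[OF _ de]) (use MK x \<xi>' in auto)
      also have "\<dots> \<le> MK * (2 * s)" using x \<xi>' MK(1) by (intro mult_left_mono) auto
      finally show ?thesis by simp
    qed
    ultimately show ?thesis unfolding E_def by linarith
  qed
  have \<tau>b: "\<bar>(\<tau> n x - \<tau>0 x) / \<epsilon> n\<bar> \<le> E + MA" if "x \<in> {-s..s}" for n x
    using eb[OF that, of n] MA(2)[OF that, of n] unfolding e_def by linarith
  define Z where "Z = 5 * (E + MA)"
  have z'b: "\<bar>z' n x\<bar> \<le> Z" if x: "x \<in> {-s..s}" for n x
  proof -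
    have "\<bar>tan (\<tau> n x) - tan (\<tau>0 x)\<bar> \<le> 5 * \<bar>\<tau> n x - \<tau>0 x\<bar>"
      unfolding \<tau>_def \<tau>0_def slope_angle_def by (rule tan_le[OF slope2[OF x]])
    then have "\<bar>z' n x\<bar> \<le> 5 * \<bar>\<tau> n x - \<tau>0 x\<bar> / \<bar>\<epsilon> n\<bar>"
      unfolding z'_def abs_divide abs_minus_cancel by (rule divide_right_mono) simp
    also have "\<dots> = 5 * \<bar>(\<tau> n x - \<tau>0 x) / \<epsilon> n\<bar>" by (simp add: abs_divide)
    also have "\<dots> \<le> Z" using \<tau>b[OF x, of n] by (simp add: Z_def)
    finally show ?thesis .
  qed
  have lipz: "\<bar>z n x - z n y\<bar> \<le> Z * \<bar>x - y\<bar>" if "x \<in> {-s..s}" "y \<in> {-s..s}" for n x y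
    using field_differentiable_bound[of "{-s..s}" "z n" "z' n" Z x y] dz z'b that by auto
  have lipe: "\<bar>e n x - e n y\<bar> \<le> MK * \<bar>x - y\<bar>" if "x \<in> {-s..s}" "y \<in> {-s..s}" for n x y
    using field_differentiable_bound[of "{-s..s}" "e n" "S K n" MK x y] de MK that by auto
  have E0: "E \<ge> 0" using eb[OF x0] abs_ge_zero order_trans by blast
  have Z0: "Z \<ge> 0" using z'b[OF x0] abs_ge_zero order_trans by blast
  obtain g k where g: "continuous_on {-s..s} g" "strict_mono (k :: nat \<Rightarrow> nat)"
    and conv: "\<And>e'. 0 < e' \<Longrightarrow> \<exists>N. \<forall>n x. n \<ge> N \<and> x \<in> {-s..s} \<longrightarrow> norm ((z (k n) x, e (k n) x) - g x) < e'"
  proof (rule Arzela_Ascoli[of "{-s..s}" "\<lambda>n x. (z n x, e n x)" "C + E"])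
    fix n x assume x: "x \<in> {-s..s}"
    have "norm (z n x, e n x) \<le> norm (z n x) + norm (e n x)" by (rule norm_Pair_le)
    then show "norm (z n x, e n x) \<le> C + E" using zC(1)[OF x, of n] eb[OF x, of n] by simp
  next
    fix x e' :: real assume x: "x \<in> {-s..s}" and e': "0 < e'"
    have "norm ((z n x, e n x) - (z n y, e n y)) < e'" if y: "y \<in> {-s..s}" "norm (x - y) < e' / (Z + MK)" for n y
    proof -
      have "norm ((z n x, e n x) - (z n y, e n y)) \<le> norm (z n x - z n y) + norm (e n x - e n y)"
        unfolding diff_Pair by (rule norm_Pair_le)
      also have "\<dots> \<le> Z * \<bar>x - y\<bar> + MK * \<bar>x - y\<bar>" using lipz[OF x y(1), of n] lipe[OF x y(1), of n] by simp
      also have "\<dots> < e'" using y(2) Z0 MK(1) by (simp add: field_simps)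
      finally show ?thesis .
    qed
    then show "\<exists>d>0. \<forall>n y. y \<in> {-s..s} \<and> norm (x - y) < d \<longrightarrow> norm ((z n x, e n x) - (z n y, e n y)) < e'"
      using e' Z0 MK(1) by (intro exI[of _ "e' / (Z + MK)"]) auto
  qed auto
  define \<zeta> where "\<zeta> x = fst (g x)" for x
  define el where "el x = snd (g x)" for x
  have c\<zeta>: "continuous_on {-s..s} \<zeta>" and cel: "continuous_on {-s..s} el"
    unfolding \<zeta>_def[abs_def] el_def[abs_def] by (intro continuous_intros g(1))+
  have lg: "(\<lambda>n. (z (k n) x, e (k n) x)) \<longlonglongrightarrow> g x" if "x \<in> {-s..s}" for x
    unfolding lim_sequentially dist_norm using conv that by meson
  have lz: "(\<lambda>n. z (k n) x) \<longlonglongrightarrow> \<zeta> x" and le: "(\<lambda>n. e (k n) x) \<longlonglongrightarrow> el x" if "x \<in> {-s..s}" for x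
    using tendsto_fst[OF lg[OF that]] tendsto_snd[OF lg[OF that]] by (simp_all add: \<zeta>_def el_def)
  have l\<epsilon>: "(\<lambda>n. \<epsilon> (k n)) \<longlonglongrightarrow> 0" using LIMSEQ_subseq_LIMSEQ[OF \<epsilon>0 g(2)] by (simp add: o_def)
  \<comment> \<open>\<open>S q n x\<close> is a mean of \<open>q\<close> over the segment between
    the two graphs, times \<open>z n x\<close>, and the segment shrinks to the point on
    \<open>g0\<close>.\<close>
  have lS: "(\<lambda>n. S q (k n) x) \<longlonglongrightarrow> q (x, g0 x) * \<zeta> x" if x: "x \<in> {-s..s}" and q: "continuous_on (sq r) q" for q x
  proof -
    have lG: "(\<lambda>n. \<epsilon> (k n) * C) \<longlonglongrightarrow> 0" using tendsto_mult_left_zero[OF l\<epsilon>] .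
    have "(\<lambda>n. S q (k n) x - q (x, g0 x) * z (k n) x) \<longlonglongrightarrow> 0"
    proof (rule tendstoI)
      fix e' :: real assume e': "0 < e'"
      then have e2: "e' / (2 * C) > 0" using C(1) by simp
      obtain d where d: "d > 0" "\<And>x y x' y'. x \<in> {-r..r} \<Longrightarrow> y \<in> {-r..r} \<Longrightarrow> x' \<in> {-r..r} \<Longrightarrow> y' \<in> {-r..r} \<Longrightarrow>
        \<bar>x - x'\<bar> < d \<Longrightarrow> \<bar>y - y'\<bar> < d \<Longrightarrow> \<bar>q (x, y) - q (x', y')\<bar> < e' / (2 * C)"
        using uniform_on_sq[OF q e2] by metis
      have "\<forall>\<^sub>F n in sequentially. \<epsilon> (k n) * C < d"
        using order_tendstoD(2)[OF lG d(1)] .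
      then show "\<forall>\<^sub>F n in sequentially. dist (S q (k n) x - q (x, g0 x) * z (k n) x) 0 < e'"
      proof eventually_elim
        case (elim n)
        let ?n = "k n"
        have small: "\<bar>G ?n x - g0 x\<bar> < d"
          unfolding Gz using zC(1)[OF x, of ?n] \<epsilon>(1)[of ?n] elim
          by (simp add: abs_mult) (meson le_less_trans mult_left_mono less_imp_le)
        have "\<bar>SI (\<lambda>y. q (x, y)) (g0 x) (G ?n x) - q (x, g0 x) * (G ?n x - g0 x)\<bar> \<le> e' / (2 * C) * \<bar>G ?n x - g0 x\<bar>"
        proof (rule SI_approx[OF continuous_on_slice_seg(1)[OF q]])
          fix t assume t: "t \<in> closed_segment (g0 x) (G ?n x)"
          then have tr: "t \<in> {-r..r}" using closed_segment_subset_Icc[OF sq0(2)[OF x] sqG(2)[OF x]] by blast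
          have "\<bar>t - g0 x\<bar> \<le> \<bar>G ?n x - g0 x\<bar>"
            using t by (auto simp: closed_segment_eq_real_ivl split: if_splits)
          then show "\<bar>q (x, t) - q (x, g0 x)\<bar> \<le> e' / (2 * C)"
            using d(2)[of x t x "g0 x"] tr sq0[OF x] small d(1) by auto
        qed (use sq0[OF x] sqG[OF x] in auto)
        also have "\<dots> \<le> e' / (2 * C) * (\<epsilon> ?n * C)"
          unfolding Gz using zC(1)[OF x, of ?n] \<epsilon>(1)[of ?n] e2
          by (intro mult_left_mono) (auto simp: abs_mult)
        also have "\<dots> = e' / 2 * \<epsilon> ?n" using C(1) by simp
        finally have "\<bar>SI (\<lambda>y. q (x, y)) (g0 x) (G ?n x) - q (x, g0 x) * (\<epsilon> ?n * z ?n x)\<bar> / \<epsilon> ?n \<le> e' / 2"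
          using \<epsilon>(1)[of ?n] by (simp add: Gz field_simps)
        also have "\<bar>SI (\<lambda>y. q (x, y)) (g0 x) (G ?n x) - q (x, g0 x) * (\<epsilon> ?n * z ?n x)\<bar> / \<epsilon> ?n
          = \<bar>(SI (\<lambda>y. q (x, y)) (g0 x) (G ?n x) - q (x, g0 x) * (\<epsilon> ?n * z ?n x)) / \<epsilon> ?n\<bar>"
          using \<epsilon>(1)[of ?n] by (simp add: abs_divide)
        also have "(SI (\<lambda>y. q (x, y)) (g0 x) (G ?n x) - q (x, g0 x) * (\<epsilon> ?n * z ?n x)) / \<epsilon> ?n
          = S q ?n x - q (x, g0 x) * z ?n x"
          using \<epsilon>(1)[of ?n] by (simp add: S_def diff_divide_distrib)
        finally have "\<bar>S q ?n x - q (x, g0 x) * z ?n x\<bar> \<le> e' / 2" .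
        moreover have "e' / 2 < e'" using e' by simp
        ultimately have "\<bar>S q ?n x - q (x, g0 x) * z ?n x\<bar> < e'" by (rule le_less_trans)
        then show ?case by (simp add: dist_real_def)
      qed
    qed
    from tendsto_add[OF this tendsto_mult_left[OF lz[OF x], of "q (x, g0 x)"]]
    show ?thesis by simp
  qed
  have lz': "(\<lambda>n. z' (k n) x) \<longlonglongrightarrow> - (el x - H (x, g0 x) * A (x, g0 x) * \<zeta> x) / (B (x, g0 x))\<^sup>2" if x: "x \<in> {-s..s}" for x
  proof -
    have l\<omega>: "(\<lambda>n. (\<tau> (k n) x - \<tau>0 x) / \<epsilon> (k n)) \<longlonglongrightarrow> el x - H (x, g0 x) * A (x, g0 x) * \<zeta> x"
      using tendsto_diff[OF le[OF x] lS[OF x cHA]] by (simp add: e_def)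
    have "(\<lambda>n. \<epsilon> (k n) * ((\<tau> (k n) x - \<tau>0 x) / \<epsilon> (k n)) + \<tau>0 x) \<longlonglongrightarrow> 0 * (el x - H (x, g0 x) * A (x, g0 x) * \<zeta> x) + \<tau>0 x"
      by (intro tendsto_intros l\<omega> l\<epsilon>)
    moreover have "\<epsilon> n * ((\<tau> n x - \<tau>0 x) / \<epsilon> n) + \<tau>0 x = \<tau> n x" for n
      using \<epsilon>(1)[of n] by simp
    ultimately have l\<tau>: "(\<lambda>n. \<tau> (k n) x) \<longlonglongrightarrow> \<tau>0 x" by simp
    have cs: "cos (\<tau>0 x) \<noteq> 0" unfolding \<tau>0_def slope_angle_def by (rule cos_arctan_not_zero)
    \<comment> \<open>\<open>\<phi>\<close> is the difference quotient of \<open>tan\<close> at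
      \<open>\<tau>0 x\<close>, completed by the derivative, which is \<open>1 / B\<^sup>2\<close>
      there. It converts quotients of angles into quotients of slopes.\<close>
    obtain \<phi> where \<phi>: "\<And>t. tan t - tan (\<tau>0 x) = \<phi> t * (t - \<tau>0 x)" "isCont \<phi> (\<tau>0 x)" "\<phi> (\<tau>0 x) = inverse ((cos (\<tau>0 x))\<^sup>2)"
      using CARAT_DERIV[THEN iffD1, OF DERIV_tan[OF cs]] by metis
    have "inverse ((cos (\<tau>0 x))\<^sup>2) = 1 + (tan (\<tau>0 x))\<^sup>2"
      using tan_sec[OF cs] by (simp add: power_inverse)
    also have "\<dots> = ((A (x, g0 x))\<^sup>2 + (B (x, g0 x))\<^sup>2) / (B (x, g0 x))\<^sup>2"
      unfolding tanG(2) using B_nz[OF sq0(1)[OF x]] by (simp add: power_divide add_divide_distrib)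
    finally have sec: "inverse ((cos (\<tau>0 x))\<^sup>2) = 1 / (B (x, g0 x))\<^sup>2"
      using unit[OF sq0(1)[OF x]] by simp
    have "(\<lambda>n. - (\<phi> (\<tau> (k n) x) * ((\<tau> (k n) x - \<tau>0 x) / \<epsilon> (k n)))) \<longlonglongrightarrow>
       - (\<phi> (\<tau>0 x) * (el x - H (x, g0 x) * A (x, g0 x) * \<zeta> x))"
      by (intro tendsto_intros l\<omega> isCont_tendsto_compose[OF \<phi>(2) l\<tau>])
    moreover have "- (\<phi> (\<tau>0 x) * w) = - w / (B (x, g0 x))\<^sup>2" for w by (simp add: \<phi>(3) sec)
    moreover have "- (\<phi> (\<tau> n x) * ((\<tau> n x - \<tau>0 x) / \<epsilon> n)) = z' n x" for n by (simp add: z'_def \<phi>(1))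
    ultimately show ?thesis by (simp only:)
  qed
  have cp: "continuous_on {-s..s} (\<lambda>x. q (x, g0 x))" if "continuous_on (sq r) q" for q :: "real \<times> real \<Rightarrow> real"
    by (rule ccurve_pair_continuous[OF g0 sr that])
  show ?thesis
  proof (rule that)
    fix x assume x: "x \<in> {-s..s}"
    have pos: "\<zeta> x > 0"
    proof -
      \<comment> \<open>\<open>z n\<close> is continuous, nowhere zero and equal to \<open>1\<close>
        at \<open>0\<close>, so the bound on its modulus is a bound on \<open>z n\<close>
        itself.\<close>
      have zpos: "z n x \<ge> 1 / C" for n
      proof (rule ccontr)
        assume neg: "\<not> 1 / C \<le> z n x"
        then have neg: "z n x \<le> 0" using zC(2)[OF x, of n] C(1) by (auto simp: abs_if split: if_splits)
        have cz: "continuous_on {-s..s} (z n)" by (rule DERIV_continuous_on[OF dz])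
        have "connected (z n ` {-s..s})" by (rule connected_continuous_image[OF cz]) simp
        moreover have "z n x \<in> z n ` {-s..s}" "z n 0 \<in> z n ` {-s..s}" using x x0 by blast+
        moreover have "z n x \<le> 0" "0 \<le> z n 0" using neg z0[of n] by auto
        ultimately have "0 \<in> z n ` {-s..s}" by (rule connectedD_interval)
        then obtain y where "y \<in> {-s..s}" "z n y = 0" by auto
        then show False using zC(2)[of y n] C(1) by simp
      qed
      have "1 / C \<le> \<zeta> x"
        by (rule tendsto_lowerbound[OF lz[OF x]]) (use zpos in auto)
      moreover have "0 < 1 / C" using C(1) by simp
      ultimately show ?thesis by linarith
    qed
    have d1: "(\<zeta> has_real_derivative - (el x - H (x, g0 x) * A (x, g0 x) * \<zeta> x) / (B (x, g0 x))\<^sup>2) (at x within {-s..s})"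
      by (rule deriv_limit_dominated[where f="\<lambda>n. z (k n)" and f'="\<lambda>n. z' (k n)" and C=Z])
         (use dz z'b lz lz' x B_nz sq0(1) in \<open>auto intro!: continuous_intros cel c\<zeta> cp cH cA cB\<close>)
    have d2: "(el has_real_derivative K (x, g0 x) * \<zeta> x) (at x within {-s..s})"
      by (rule deriv_limit_dominated[where f="\<lambda>n. e (k n)" and f'="\<lambda>n. S K (k n)" and C=MK])
         (use de MK(2) le lS[OF _ cK] x in \<open>auto intro!: continuous_intros c\<zeta> cp cK\<close>)
    have d3: "((\<lambda>x. D (x, g0 x) * B (x, g0 x) * \<zeta> x) has_real_derivative c (x, g0 x) * \<zeta> x) (at x within {-s..s})"
      by (rule deriv_limit_dominated[where f="\<lambda>n. S (\<lambda>p. D p * B p) (k n)" and f'="\<lambda>n. S c (k n)" and C=Mc])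
         (use dm Mc(2) lS[OF _ cDB] lS[OF _ cc] x in \<open>auto intro!: continuous_intros c\<zeta> cp cc\<close>)
    show "\<zeta> x > 0 \<and>
      (\<zeta> has_real_derivative - (el x - H (x, g0 x) * A (x, g0 x) * \<zeta> x) / (B (x, g0 x))\<^sup>2) (at x within {-s..s}) \<and>
      (el has_real_derivative K (x, g0 x) * \<zeta> x) (at x within {-s..s}) \<and>
      ((\<lambda>x. D (x, g0 x) * B (x, g0 x) * \<zeta> x) has_real_derivative c (x, g0 x) * \<zeta> x) (at x within {-s..s})"
      using pos d1 d2 d3 by blast
  qed
qed

text \<open>Passing from the vertical distance \<open>\<zeta>\<close> to the normal distance \<open>B * \<zeta>\<close> turns the linear system
  into the Jacobi equation \<open>j'' = - K j\<close> in the arc length parameter.\<close>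

lemma ccurve_jacobi:
  assumes g0: "ccurve s g0" and g00: "\<bar>g0 0\<bar> \<le> r / 8" and s: "0 < s" "16 * s \<le> r"
  obtains j e where "\<And>x. x \<in> {-s..s} \<Longrightarrow> j x > 0 \<and>
    (j has_real_derivative - e x / B (x, g0 x)) (at x within {-s..s}) \<and>
    (e has_real_derivative K (x, g0 x) * j x / B (x, g0 x)) (at x within {-s..s}) \<and>
    ((\<lambda>x. D (x, g0 x) * j x) has_real_derivative c (x, g0 x) * j x / B (x, g0 x)) (at x within {-s..s})"
proof (rule ccurve_variation[OF assms])
  fix \<zeta> e
  assume *: "\<And>x. x \<in> {-s..s} \<Longrightarrow> \<zeta> x > 0 \<and>
    (\<zeta> has_real_derivative - (e x - H (x, g0 x) * A (x, g0 x) * \<zeta> x) / (B (x, g0 x))\<^sup>2) (at x within {-s..s}) \<and>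
    (e has_real_derivative K (x, g0 x) * \<zeta> x) (at x within {-s..s}) \<and>
    ((\<lambda>x. D (x, g0 x) * B (x, g0 x) * \<zeta> x) has_real_derivative c (x, g0 x) * \<zeta> x) (at x within {-s..s})"
  have sr: "s \<le> r" using s by simp
  show thesis
  proof (rule that[of "\<lambda>x. B (x, g0 x) * \<zeta> x" e])
    fix x assume x: "x \<in> {-s..s}"
    have p: "(x, g0 x) \<in> sq r" using ccurve_sq[OF g0 x sr] by simp
    have B: "B (x, g0 x) > 0" using B_half[OF p] by simp
    have "((\<lambda>x. B (x, g0 x) * \<zeta> x) has_real_derivative
      - A (x, g0 x) * H (x, g0 x) / B (x, g0 x) * \<zeta> x + - (e x - H (x, g0 x) * A (x, g0 x) * \<zeta> x) / (B (x, g0 x))\<^sup>2 * B (x, g0 x)) (at x within {-s..s})"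
      using *[OF x] by (intro DERIV_mult ccurve_B_deriv[OF g0 sr x]) auto
    also have "- A (x, g0 x) * H (x, g0 x) / B (x, g0 x) * \<zeta> x + - (e x - H (x, g0 x) * A (x, g0 x) * \<zeta> x) / (B (x, g0 x))\<^sup>2 * B (x, g0 x)
      = - e x / B (x, g0 x)" using B by (simp add: power2_eq_square field_simps)
    finally show "0 < B (x, g0 x) * \<zeta> x \<and>
      ((\<lambda>x. B (x, g0 x) * \<zeta> x) has_real_derivative - e x / B (x, g0 x)) (at x within {-s..s}) \<and>
      (e has_real_derivative K (x, g0 x) * (B (x, g0 x) * \<zeta> x) / B (x, g0 x)) (at x within {-s..s}) \<and>
      ((\<lambda>x. D (x, g0 x) * (B (x, g0 x) * \<zeta> x)) has_real_derivative c (x, g0 x) * (B (x, g0 x) * \<zeta> x) / B (x, g0 x)) (at x within {-s..s})"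
      using *[OF x] B by (simp add: mult.assoc)
  qed
qed

section \<open>Unit-speed characteristic curves\<close>

text \<open>In the rotated coordinates \<open>(B, - A)\<close> is the direction of
  \<open>Nperp\<close>, so these are its integral curves through the origin. The opposite
  orientation is treated later by reversing the parameter.\<close>

definition pcurve :: "real \<Rightarrow> (real \<Rightarrow> real) \<Rightarrow> (real \<Rightarrow> real) \<Rightarrow> bool" where
  "pcurve \<epsilon> x y \<longleftrightarrow> \<epsilon> > 0 \<and> x 0 = 0 \<and> y 0 = 0 \<and> (\<forall>t. \<bar>t\<bar> < \<epsilon> \<longrightarrow> (x t, y t) \<in> sq r \<and>
     (x has_real_derivative B (x t, y t)) (at t) \<and> (y has_real_derivative - A (x t, y t)) (at t))"

text \<open>The abscissa grows at the rate \<open>B \<ge> 1 / 2\<close> and can replace the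
  parameter. The last clause carries derivatives at \<open>0\<close> from the parameter over to the
  abscissa.\<close>

lemma pcurve_graph:
  assumes pc: "pcurve \<epsilon> x y"
  obtains d g where "d > 0" "g 0 = 0" "\<And>s. 0 \<le> s \<Longrightarrow> s < d \<Longrightarrow> ccurve s g"
    "\<And>t. \<bar>t\<bar> \<le> \<epsilon> / 2 \<Longrightarrow> g (x t) = y t"
    "\<And>F f'. ((\<lambda>t. F (x t)) has_real_derivative f') (at 0) \<Longrightarrow> (F has_real_derivative f' / B (0, 0)) (at 0)"
proof -
  have \<epsilon>: "\<epsilon> > 0" and xy0: "x 0 = 0" "y 0 = 0" using pc by (auto simp: pcurve_def)
  have p: "(x t, y t) \<in> sq r" "(x has_real_derivative B (x t, y t)) (at t)" "(y has_real_derivative - A (x t, y t)) (at t)"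
    if "t \<in> {-\<epsilon><..<\<epsilon>}" for t using pc that by (auto simp: pcurve_def)
  have Bp: "B (x t, y t) > 0" if "t \<in> {-\<epsilon><..<\<epsilon>}" for t using B_half[OF p(1)[OF that]] by simp
  obtain d T where d: "d > 0" and T0: "T (x 0) = 0"
    and T: "\<And>s. \<bar>s - x 0\<bar> < d \<Longrightarrow> T s \<in> {-\<epsilon><..<\<epsilon>} \<and> x (T s) = s \<and> (T has_real_derivative 1 / B (x (T s), y (T s))) (at s)"
    and Tx: "\<And>t. t \<in> {-\<epsilon>/2..\<epsilon>/2} \<Longrightarrow> T (x t) = t"
    using reparam[where x=x and x'="\<lambda>t. B (x t, y t)", OF \<epsilon> p(2) Bp] by blast
  have T: "T s \<in> {-\<epsilon><..<\<epsilon>}" "x (T s) = s" "(T has_real_derivative 1 / B (s, y (T s))) (at s)" if "\<bar>s\<bar> < d" for s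
    using T[of s] that xy0 by auto
  have T0: "T 0 = 0" using T0 xy0 by simp
  define g where "g s = y (T s)" for s
  have gd: "(g has_real_derivative - A (s, g s) / B (s, g s)) (at s)" if "\<bar>s\<bar> < d" for s
  proof -
    have "(y has_real_derivative - A (s, g s)) (at (T s))"
      using p(3)[OF T(1)[OF that]] T(2)[OF that] by (simp add: g_def)
    from DERIV_chain2[OF this T(3)[OF that]] show ?thesis by (simp add: g_def[abs_def])
  qed
  have gsq: "(s, g s) \<in> sq r" if "\<bar>s\<bar> < d" for s
    using p(1)[OF T(1)[OF that]] T(2)[OF that] by (simp add: g_def)
  have g0: "g 0 = 0" using T0 xy0 by (simp add: g_def)
  \<comment> \<open>With slopes at most \<open>2\<close>, the bound \<open>r / 4\<close> on
    \<open>s\<close> keeps the graph within height \<open>r / 2\<close>.\<close>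
  have cc: "ccurve s g" if s: "0 \<le> s" "s < min d (r / 4)" for s
    unfolding ccurve_def
  proof (intro ballI conjI)
    fix z assume z: "z \<in> {-s..s}"
    have gd': "(g has_real_derivative - A (z, g z) / B (z, g z)) (at z within {-s..s})" if "z \<in> {-s..s}" for z
      by (rule has_field_derivative_at_within[OF gd]) (use that s in auto)
    show "(g has_real_derivative - A (z, g z) / B (z, g z)) (at z within {-s..s})" by (rule gd'[OF z])
    have "norm (g z - g 0) \<le> 2 * norm (z - 0)"
    proof (rule field_differentiable_bound[of "{-s..s}" g "\<lambda>z. - A (z, g z) / B (z, g z)"])
      fix w assume w: "w \<in> {-s..s}"
      show "(g has_real_derivative - A (w, g w) / B (w, g w)) (at w within {-s..s})" by (rule gd'[OF w])
      have "\<bar>w\<bar> < d" using w s by auto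
      from A_div_B_le[OF gsq[OF this]] show "norm (- A (w, g w) / B (w, g w)) \<le> 2" by simp
    qed (use z s in auto)
    also have "\<dots> \<le> 2 * s" using z by auto
    finally show "g z \<in> {-r/2..r/2}" using s g0 unfolding atLeastAtMost_iff real_norm_def by linarith
  qed
  have gx: "g (x t) = y t" if "\<bar>t\<bar> \<le> \<epsilon> / 2" for t
  proof -
    have "t \<in> {-\<epsilon>/2..\<epsilon>/2}" using that unfolding atLeastAtMost_iff by linarith
    then show ?thesis using Tx[of t] by (simp add: g_def)
  qed
  show ?thesis
  proof (rule that[of "min d (r / 4)" g])
    fix F f' assume F: "((\<lambda>t. F (x t)) has_real_derivative f') (at 0)"
    have "((\<lambda>t. F (x t)) has_real_derivative f') (at (T 0))" using F T0 by simp
    from DERIV_chain2[where f="\<lambda>t. F (x t)" and g=T, OF this T(3)]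
    have "((\<lambda>s. F (x (T s))) has_real_derivative f' * (1 / B (0, y (T 0)))) (at 0)" using d by simp
    then have "((\<lambda>s. F (x (T s))) has_real_derivative f' / B (0, 0)) (at 0)" using T0 xy0 by simp
    then show "(F has_real_derivative f' / B (0, 0)) (at 0)"
      by (rule has_field_derivative_transform_within[where d=d]) (use d T(2) in \<open>auto simp: dist_real_def\<close>)
  qed (use d r_pos g0 cc gx in auto)
qed

text \<open>The statements on the graph are composed with \<open>x\<close>, and
  \<open>x' = B\<close> cancels the divisions by \<open>B\<close>: now \<open>j'' = - K * j\<close>
  holds in arc length.\<close>

lemma pcurve_jacobi:
  assumes pc: "pcurve \<epsilon> x y"
  obtains \<delta> j e where "\<delta> > 0" "\<And>t. \<bar>t\<bar> < \<delta> \<Longrightarrow> j t > 0 \<and> (j has_real_derivative - e t) (at t) \<and>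
    (e has_real_derivative K (x t, y t) * j t) (at t) \<and>
    ((\<lambda>t. D (x t, y t) * j t) has_real_derivative c (x t, y t) * j t) (at t)"
proof -
  have \<epsilon>: "\<epsilon> > 0" and xy0: "x 0 = 0" "y 0 = 0" using pc by (auto simp: pcurve_def)
  have p: "(x t, y t) \<in> sq r" "(x has_real_derivative B (x t, y t)) (at t)"
    if "\<bar>t\<bar> < \<epsilon>" for t using pc that by (auto simp: pcurve_def)
  obtain d g where d: "d > 0" and g0: "g 0 = 0" and cc: "\<And>s. 0 \<le> s \<Longrightarrow> s < d \<Longrightarrow> ccurve s g"
    and gx: "\<And>t. \<bar>t\<bar> \<le> \<epsilon> / 2 \<Longrightarrow> g (x t) = y t"
    using pcurve_graph[OF pc] by metis
  define s where "s = min (d / 2) (r / 16)"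
  have s: "0 < s" "16 * s \<le> r" "s < d" using d r_pos by (auto simp: s_def)
  have ccs: "ccurve s g" using cc s by simp
  obtain J E where JE: "\<And>x. x \<in> {-s..s} \<Longrightarrow> J x > 0 \<and>
    (J has_real_derivative - E x / B (x, g x)) (at x within {-s..s}) \<and>
    (E has_real_derivative K (x, g x) * J x / B (x, g x)) (at x within {-s..s}) \<and>
    ((\<lambda>x. D (x, g x) * J x) has_real_derivative c (x, g x) * J x / B (x, g x)) (at x within {-s..s})"
    by (rule ccurve_jacobi[OF ccs _ s(1,2)]) (use g0 r_pos in simp, blast)
  have "isCont x 0" using p(2)[of 0] \<epsilon> DERIV_isCont by auto
  then have "x \<midarrow>0\<rightarrow> 0" using xy0 by (simp add: isCont_def)
  then have "\<forall>\<^sub>F t in at 0. \<bar>x t\<bar> < s" using tendstoD[OF _ s(1)] by (fastforce simp: dist_real_def)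
  then obtain \<delta>' where \<delta>': "\<delta>' > 0" "\<And>t. t \<noteq> 0 \<Longrightarrow> \<bar>t\<bar> < \<delta>' \<Longrightarrow> \<bar>x t\<bar> < s"
    by (auto simp: eventually_at dist_real_def)
  define \<delta> where "\<delta> = min \<delta>' (\<epsilon> / 2)"
  have \<delta>: "\<delta> > 0" using \<delta>' \<epsilon> by (simp add: \<delta>_def)
  show ?thesis
  proof (rule that[of \<delta> "\<lambda>t. J (x t)" "\<lambda>t. E (x t)"])
    fix t assume t: "\<bar>t\<bar> < \<delta>"
    have t\<epsilon>: "\<bar>t\<bar> < \<epsilon>" using t \<epsilon> by (simp add: \<delta>_def)
    have xs: "\<bar>x t\<bar> < s" using \<delta>'(2)[of t] t xy0 s(1) by (cases "t = 0") (auto simp: \<delta>_def)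
    then have xs': "x t \<in> {-s..s}" "at (x t) within {-s..s} = at (x t)"
      using at_within_Icc_at[of "-s" "x t" s] by (auto simp: abs_less_iff)
    have gt: "g (x t) = y t" using gx[of t] t by (simp add: \<delta>_def)
    have B: "B (x t, y t) \<noteq> 0" by (rule B_nz[OF p(1)[OF t\<epsilon>]])
    note J = JE[OF xs'(1), unfolded xs'(2) gt]
    have ch: "((\<lambda>t. f (x t)) has_real_derivative f') (at t)" if "(f has_real_derivative f' / B (x t, y t)) (at (x t))" for f f'
      using DERIV_chain2[where f=f and g=x, OF that p(2)[OF t\<epsilon>]] B by simp
    have "((\<lambda>t. D (x t, g (x t)) * J (x t)) has_real_derivative c (x t, y t) * J (x t)) (at t)"
      by (rule ch[where f="\<lambda>x. D (x, g x) * J x"]) (use J in simp)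
    then have "((\<lambda>t. D (x t, y t) * J (x t)) has_real_derivative c (x t, y t) * J (x t)) (at t)"
      by (rule has_field_derivative_transform_within[where d="\<delta> - \<bar>t\<bar>"])
         (use t gx in \<open>auto simp: dist_real_def \<delta>_def\<close>)
    then show "0 < J (x t) \<and> ((\<lambda>t. J (x t)) has_real_derivative - E (x t)) (at t) \<and>
      ((\<lambda>t. E (x t)) has_real_derivative K (x t, y t) * J (x t)) (at t) \<and>
      ((\<lambda>t. D (x t, y t) * J (x t)) has_real_derivative c (x t, y t) * J (x t)) (at t)"
      using J ch[of J "- E (x t)"] ch[of E "K (x t, y t) * J (x t)"] by simp
  qed (rule \<delta>)
qed

text \<open>\<open>has_deriv_along\<close> asks for one derivative on all integral curves through
  the point. By \<open>ccurve_unique\<close> two such curves trace the same graph near the origin,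
  so the derivative is moved to that graph and back.\<close>

lemma pcurve_D_deriv_unique:
  assumes pc1: "pcurve \<epsilon>1 x1 y1" and pc2: "pcurve \<epsilon>2 x2 y2"
    and D1: "((\<lambda>t. D (x1 t, y1 t)) has_real_derivative d') (at 0)"
  shows "((\<lambda>t. D (x2 t, y2 t)) has_real_derivative d') (at 0)"
proof -
  have e: "\<epsilon>1 > 0" "\<epsilon>2 > 0" "x1 0 = 0" "x2 0 = 0" "y2 0 = 0" using pc1 pc2 by (auto simp: pcurve_def)
  have "(x2 has_real_derivative B (x2 0, y2 0)) (at 0)"
    using pc2 e(2) unfolding pcurve_def by (metis abs_zero)
  then have x2: "(x2 has_real_derivative B (0, 0)) (at 0)" using e by simp
  have 00: "(0, 0) \<in> sq r" using r_pos by auto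
  obtain d1 g1 where g1: "d1 > 0" "g1 0 = 0" "\<And>s. 0 \<le> s \<Longrightarrow> s < d1 \<Longrightarrow> ccurve s g1"
    "\<And>t. \<bar>t\<bar> \<le> \<epsilon>1 / 2 \<Longrightarrow> g1 (x1 t) = y1 t"
    and F1: "\<And>F f'. ((\<lambda>t. F (x1 t)) has_real_derivative f') (at 0) \<Longrightarrow> (F has_real_derivative f' / B (0, 0)) (at 0)"
    by (rule pcurve_graph[OF pc1]) blast
  obtain d2 g2 where g2: "d2 > 0" "g2 0 = 0" "\<And>s. 0 \<le> s \<Longrightarrow> s < d2 \<Longrightarrow> ccurve s g2"
    "\<And>t. \<bar>t\<bar> \<le> \<epsilon>2 / 2 \<Longrightarrow> g2 (x2 t) = y2 t"
    by (rule pcurve_graph[OF pc2]) blast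
  define s where "s = min (min d1 d2 / 2) r"
  have s: "0 < s" "s \<le> r" "s < d1" "s < d2" using g1(1) g2(1) r_pos by (auto simp: s_def)
  have g12: "g1 z = g2 z" if "\<bar>z\<bar> < s" for z
    by (rule ccurve_unique[OF s(2) g1(3) g2(3), of 0]) (use s that g1(2) g2(2) in auto)
  have "((\<lambda>t. D (x1 t, g1 (x1 t))) has_real_derivative d') (at 0)"
    by (rule has_field_derivative_transform_within[OF D1, of "\<epsilon>1 / 2"]) (use e g1(4) in \<open>auto simp: dist_real_def\<close>)
  then have "((\<lambda>z. D (z, g1 z)) has_real_derivative d' / B (0, 0)) (at 0)"
    by (rule F1[where F="\<lambda>z. D (z, g1 z)"])
  then have "((\<lambda>z. D (z, g2 z)) has_real_derivative d' / B (0, 0)) (at 0)"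
    by (rule has_field_derivative_transform_within[where d=s]) (use s g12 in \<open>auto simp: dist_real_def\<close>)
  then have "((\<lambda>z. D (z, g2 z)) has_real_derivative d' / B (0, 0)) (at (x2 0))" using e by simp
  from DERIV_chain2[where g=x2 and f="\<lambda>z. D (z, g2 z)", OF this x2]
  have "((\<lambda>t. D (x2 t, g2 (x2 t))) has_real_derivative d') (at 0)" using B_nz[OF 00] by simp
  then show ?thesis
    by (rule has_field_derivative_transform_within[of _ _ _ _ "\<epsilon>2 / 2"]) (use e g2(4) in \<open>auto simp: dist_real_def\<close>)
qed

end

section \<open>Test functions\<close>

text \<open>Level \<open>0\<close> demands nothing, not even continuity; continuity of the
  derivative of order \<open>k\<close> comes with level \<open>k + 1\<close>. This explains
  \<open>Suc k\<close> in \<open>tensor_Ck\<close>.\<close>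

primrec smooth_upto :: "nat \<Rightarrow> (real \<Rightarrow> real) \<Rightarrow> bool" where
  "smooth_upto 0 f \<longleftrightarrow> True"
| "smooth_upto (Suc n) f \<longleftrightarrow> (\<exists>f'. (\<forall>x. (f has_real_derivative f' x) (at x)) \<and> smooth_upto n f')"

lemma smooth_upto_SucD: "smooth_upto (Suc n) f \<Longrightarrow> smooth_upto n f"
  by (induction n arbitrary: f) auto

lemma smooth_upto_deriv:
  assumes "smooth_upto (Suc n) f" "\<And>x. (f has_real_derivative f' x) (at x)"
  shows "smooth_upto n f'"
proof -
  obtain g where g: "\<And>x. (f has_real_derivative g x) (at x)" "smooth_upto n g" using assms(1) by auto
  have "g = f'" using DERIV_unique[OF g(1) assms(2)] by auto
  then show ?thesis using g(2) by simp
qed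

lemma smooth_upto_add: "smooth_upto n f \<Longrightarrow> smooth_upto n g \<Longrightarrow> smooth_upto n (\<lambda>x. f x + g x)"
proof (induction n arbitrary: f g)
  case (Suc n)
  then obtain f' g' where "\<And>x. (f has_real_derivative f' x) (at x)" "smooth_upto n f'"
    "\<And>x. (g has_real_derivative g' x) (at x)" "smooth_upto n g'" by auto
  then show ?case using Suc.IH by (auto intro!: exI[of _ "\<lambda>x. f' x + g' x"] derivative_intros)
qed simp

lemma smooth_upto_cmult: "smooth_upto n f \<Longrightarrow> smooth_upto n (\<lambda>x. c * f x)"
proof (induction n arbitrary: f)
  case (Suc n)
  then obtain f' where "\<And>x. (f has_real_derivative f' x) (at x)" "smooth_upto n f'" by auto
  then show ?case using Suc.IH by (auto intro!: exI[of _ "\<lambda>x. c * f' x"] DERIV_cmult)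
qed simp

lemma smooth_upto_mult: "smooth_upto n f \<Longrightarrow> smooth_upto n g \<Longrightarrow> smooth_upto n (\<lambda>x. f x * g x)"
proof (induction n arbitrary: f g)
  case (Suc n)
  then obtain f' g' where fg: "\<And>x. (f has_real_derivative f' x) (at x)" "smooth_upto n f'"
    "\<And>x. (g has_real_derivative g' x) (at x)" "smooth_upto n g'" by auto
  have "smooth_upto n (\<lambda>x. f' x * g x + g' x * f x)"
    by (intro smooth_upto_add Suc.IH fg Suc.prems[THEN smooth_upto_SucD])
  then show ?case using fg by (auto intro!: exI[of _ "\<lambda>x. f' x * g x + g' x * f x"] DERIV_mult)
qed simp

lemma smooth_upto_affine: "smooth_upto n f \<Longrightarrow> smooth_upto n (\<lambda>x. f (a * x + b))"
proof (induction n arbitrary: f)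
  case (Suc n)
  then obtain f' where f': "\<And>x. (f has_real_derivative f' x) (at x)" "smooth_upto n f'" by auto
  have "((\<lambda>x. f (a * x + b)) has_real_derivative a * f' (a * x + b)) (at x)" for x
  proof -
    have "((\<lambda>x. a * x + b) has_real_derivative a) (at x)" by (auto intro!: derivative_eq_intros)
    from DERIV_chain2[where f=f and g="\<lambda>x. a * x + b", OF f'(1) this] show ?thesis by (simp add: mult.commute)
  qed
  then show ?case using Suc.IH[OF f'(2)]
    by (auto intro!: exI[of _ "\<lambda>x. a * f' (a * x + b)"] smooth_upto_cmult)
qed simp

text \<open>The polynomial factor makes the family closed under differentiation, so a single
  computation covers all derivatives of \<open>exp (- (1 / t))\<close> extended by zero.\<close>

definition flat_exp :: "real poly \<Rightarrow> real \<Rightarrow> real" where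
  "flat_exp p t = (if t > 0 then poly p (1 / t) * exp (- (1 / t)) else 0)"

lemma poly_exp_tendsto_0: "((\<lambda>s. poly p s * exp (- s)) \<longlongrightarrow> 0) (at_top :: real filter)"
proof -
  have "((\<lambda>s. \<Sum>i\<le>degree p. coeff p i * (s ^ i / exp s)) \<longlongrightarrow> (\<Sum>i\<le>degree p. coeff p i * 0)) (at_top :: real filter)"
    by (intro tendsto_sum tendsto_mult tendsto_const tendsto_power_div_exp_0)
  moreover have "(\<Sum>i\<le>degree p. coeff p i * (s ^ i / exp s)) = poly p s * exp (- s)" for s
    by (simp add: poly_altdef sum_distrib_right exp_minus divide_inverse mult.assoc)
  ultimately show ?thesis by simp
qed

lemma flat_exp_tendsto_0: "((\<lambda>t. flat_exp p t) \<longlongrightarrow> 0) (at 0)"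
proof -
  have inv: "filterlim (\<lambda>t::real. 1 / t) at_top (at_right 0)"
    by real_asymp
  have "((\<lambda>t. poly p (1 / t) * exp (- (1 / t))) \<longlongrightarrow> 0) (at_right 0)"
    by (rule filterlim_compose[OF poly_exp_tendsto_0 inv])
  then have "((\<lambda>t. flat_exp p t) \<longlongrightarrow> 0) (at_right 0)"
    by (rule Lim_transform_eventually) (auto simp: flat_exp_def eventually_at_right_field intro!: exI[of _ 1])
  moreover have "((\<lambda>t. flat_exp p t) \<longlongrightarrow> 0) (at_left 0)"
    by (rule Lim_transform_eventually[of "\<lambda>_. 0"]) (auto simp: flat_exp_def eventually_at_left_field intro!: exI[of _ "-1"])
  ultimately show ?thesis by (simp add: filterlim_split_at)
qed

text \<open>With \<open>s = 1 / t\<close> the derivative of \<open>poly p s * exp (- s)\<close> in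
  \<open>s\<close> is \<open>(p' - p) * exp (- s)\<close>, and \<open>ds/dt = - s\<^sup>2\<close>;
  hence the factor \<open>[:0, 0, 1:]\<close>.\<close>

lemma flat_exp_deriv:
  "(flat_exp p has_real_derivative flat_exp ([:0, 0, 1:] * (p - pderiv p)) t) (at t)"
proof -
  consider "t > 0" | "t = 0" | "t < 0" by linarith
  then show ?thesis
  proof cases
    case 1
    have d: "((\<lambda>t. 1 / t) has_real_derivative - (1 / t\<^sup>2)) (at t)"
      using 1 by (auto intro!: derivative_eq_intros simp: power2_eq_square)
    have "((\<lambda>s. poly p s * exp (- s)) has_real_derivative (poly (pderiv p) (1/t) - poly p (1/t)) * exp (- (1/t))) (at (1 / t))"
      by (auto intro!: derivative_eq_intros simp: algebra_simps)
    from DERIV_chain2[where f="\<lambda>s. poly p s * exp (- s)" and g="\<lambda>t. 1 / t", OF this d]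
    have "((\<lambda>t. poly p (1 / t) * exp (- (1 / t))) has_real_derivative flat_exp ([:0, 0, 1:] * (p - pderiv p)) t) (at t)"
      using 1 by (simp add: flat_exp_def algebra_simps power2_eq_square)
    then show ?thesis
      by (rule has_field_derivative_transform_within[where d=t]) (use 1 in \<open>auto simp: flat_exp_def dist_real_def\<close>)
  next
    case 2
    \<comment> \<open>Division by \<open>h\<close> multiplies the polynomial by its variable, so the
      difference quotient at \<open>0\<close> belongs to the family again and tends to
      \<open>0\<close>.\<close>
    have "(flat_exp p h - flat_exp p 0) / (h - 0) = flat_exp ([:0, 1:] * p) h" for h
      by (simp add: flat_exp_def)
    then show ?thesis
      unfolding 2 has_field_derivative_iff using flat_exp_tendsto_0[of "[:0, 1:] * p"]
      by (simp only:) (simp add: flat_exp_def)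
  next
    case 3
    have "((\<lambda>_. 0) has_real_derivative 0) (at t)" by simp
    then have "(flat_exp p has_real_derivative 0) (at t)"
      by (rule has_field_derivative_transform_within[where d="-t"]) (use 3 in \<open>auto simp: flat_exp_def dist_real_def\<close>)
    then show ?thesis using 3 by (simp add: flat_exp_def)
  qed
qed

lemma flat_exp_smooth: "smooth_upto n (flat_exp p)"
proof (induction n arbitrary: p)
  case (Suc n)
  then show ?case using flat_exp_deriv by auto
qed simp

text \<open>Each factor cuts off one half-line, leaving \<open>{-1<..<1}\<close>. The arguments are
  written as affine maps in the shape of \<open>smooth_upto_affine\<close>.\<close>

definition bump :: "real \<Rightarrow> real" where
  "bump t = flat_exp 1 (1 * t + 1) * flat_exp 1 ((-1) * t + 1)"

lemma bump_smooth: "smooth_upto n bump"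
  unfolding bump_def[abs_def] by (intro smooth_upto_mult smooth_upto_affine flat_exp_smooth)

lemma bump_nonneg: "0 \<le> bump t"
  by (simp add: bump_def flat_exp_def)

lemma bump_zero: "1 \<le> \<bar>t\<bar> \<Longrightarrow> bump t = 0"
  by (auto simp: bump_def flat_exp_def)

lemma bump_continuous: "continuous_on S bump"
proof -
  obtain b' where "\<And>x. (bump has_real_derivative b' x) (at x)" using bump_smooth[of 1] by auto
  then show ?thesis by (auto intro!: continuous_at_imp_continuous_on DERIV_isCont)
qed

text \<open>A smooth transition from \<open>0\<close> to the total mass \<open>step 1\<close> of the
  bump, which is not normalised to \<open>1\<close>.\<close>

definition step :: "real \<Rightarrow> real" where "step = SI bump (-1)"

lemma step_deriv: "(step has_real_derivative bump x) (at x)"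
proof -
  let ?a = "min (-2) (x - 1)" and ?b = "max 0 (x + 1)"
  have "(SI bump (-1) has_real_derivative bump x) (at x within {?a..?b})"
    by (rule SI_has_real_derivative[OF bump_continuous]) auto
  moreover have "at x within {?a..?b} = at x" by (rule at_within_Icc_at) auto
  ultimately show ?thesis by (simp add: step_def)
qed

lemma step_smooth: "smooth_upto n step"
  using step_deriv bump_smooth by (cases n) auto

lemma step_left: assumes "x \<le> -1" shows "step x = 0"
proof -
  have "SI bump (-1) x = SI (\<lambda>_. 0) (-1) x"
    by (rule SI_cong) (use assms bump_zero in \<open>auto simp: closed_segment_eq_real_ivl split: if_splits\<close>)
  then show ?thesis by (simp add: step_def)
qed

lemma step_right: assumes "1 \<le> x" shows "step x = step 1"
proof -
  have "SI bump (-1) 1 + SI bump 1 x = SI bump (-1) x"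
    by (rule SI_combine[where a="-1" and b=x, OF bump_continuous]) (use assms in auto)
  moreover have "SI bump 1 x = SI (\<lambda>_. 0) 1 x"
    by (rule SI_cong) (use assms bump_zero in \<open>auto simp: closed_segment_eq_real_ivl split: if_splits\<close>)
  ultimately show ?thesis by (simp add: step_def)
qed

lemma step_pos: "step 1 > 0"
proof -
  have m: "step a \<le> step b" if "a \<le> b" for a b
    by (rule DERIV_nonneg_imp_nondecreasing[OF that]) (use step_deriv bump_nonneg in blast)
  have "step (-1) \<le> step (1/2)" by (rule m) simp
  also have "step (1/2) < step (3/4)"
  proof (rule DERIV_pos_imp_increasing[where f=step and a="1/2" and b="3/4"])
    fix x :: real assume "1/2 \<le> x" "x \<le> 3/4"
    then have "bump x > 0" by (simp add: bump_def flat_exp_def)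
    then show "\<exists>y. (step has_real_derivative y) (at x) \<and> 0 < y" using step_deriv[of x] by blast
  qed simp
  also have "step (3/4) \<le> step 1" by (rule m) simp
  finally have "step (-1) < step 1" .
  then show ?thesis using step_left[of "-1"] by simp
qed

section \<open>The fundamental lemma of the calculus of variations\<close>

definition test1 :: "real \<Rightarrow> (real \<Rightarrow> real) \<Rightarrow> bool" where
  "test1 R \<eta> \<longleftrightarrow> (\<forall>n. smooth_upto n \<eta>) \<and> (\<exists>s<R. \<forall>x. s \<le> \<bar>x\<bar> \<longrightarrow> \<eta> x = 0)"

lemma test1_deriv: "test1 R \<eta> \<Longrightarrow> (\<eta> has_real_derivative deriv \<eta> x) (at x)"
  unfolding test1_def by (metis DERIV_imp_deriv smooth_upto.simps(2))

lemma test1_continuous: "test1 R \<eta> \<Longrightarrow> continuous_on S \<eta>"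
  using test1_deriv by (auto intro!: continuous_at_imp_continuous_on DERIV_isCont)

lemma test1_deriv_continuous: "test1 R \<eta> \<Longrightarrow> continuous_on S (deriv \<eta>)"
proof -
  assume t: "test1 R \<eta>"
  have "smooth_upto 1 (deriv \<eta>)"
    using smooth_upto_deriv[of 1 \<eta>] test1_deriv[OF t] t by (auto simp: test1_def simp del: smooth_upto.simps)
  then obtain f' where "\<And>x. (deriv \<eta> has_real_derivative f' x) (at x)" by auto
  then show ?thesis by (auto intro!: continuous_at_imp_continuous_on DERIV_isCont)
qed

lemma test1_deriv_zero:
  assumes t: "test1 R \<eta>" obtains s where "s < R" "\<And>x. s < \<bar>x\<bar> \<Longrightarrow> \<eta> x = 0 \<and> deriv \<eta> x = 0"
proof -
  obtain s where s: "s < R" "\<And>x. s \<le> \<bar>x\<bar> \<Longrightarrow> \<eta> x = 0" using t by (auto simp: test1_def)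
  show ?thesis
  proof (rule that[OF s(1)])
    fix x assume x: "s < \<bar>x\<bar>"
    have "((\<lambda>_. 0) has_real_derivative 0) (at x)" by simp
    then have "(\<eta> has_real_derivative 0) (at x)"
      by (rule has_field_derivative_transform_within[where d="\<bar>x\<bar> - s"])
         (use x s(2) in \<open>auto simp: dist_real_def\<close>)
    then show "\<eta> x = 0 \<and> deriv \<eta> x = 0" using s(2)[of x] x by (auto intro: DERIV_imp_deriv)
  qed
qed

text \<open>With \<open>G\<close> a primitive of \<open>g\<close>, integration by parts shows that
  \<open>h = f - G\<close> is orthogonal to every \<open>deriv \<eta>\<close>. For
  \<open>\<eta>\<close> a smoothed indicator of \<open>{x1..x2}\<close>, \<open>deriv \<eta>\<close>
  is a difference of two approximate point masses, so \<open>h x1 = h x2\<close>.\<close>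

lemma du_bois_reymond:
  assumes cf: "continuous_on {-R..R} f" and cg: "continuous_on {-R..R} g"
    and w: "\<And>\<eta>. test1 R \<eta> \<Longrightarrow> integral {-R..R} (\<lambda>x. f x * deriv \<eta> x) + integral {-R..R} (\<lambda>x. g x * \<eta> x) = 0"
    and x: "-R < x1" "x1 \<le> x2" "x2 < R"
  shows "f x2 - f x1 = integral {x1..x2} g"
proof -
  define G where "G x = integral {-R..x} g" for x
  have dG: "(G has_real_derivative g x) (at x within {-R..R})" if "x \<in> {-R..R}" for x
    unfolding G_def[abs_def] by (rule integral_has_real_derivative[OF cg that])
  have cG: "continuous_on {-R..R} G" by (rule DERIV_continuous_on[OF dG])
  define h where "h x = f x - G x" for x
  have ch: "continuous_on {-R..R} h" unfolding h_def by (intro continuous_intros cf cG)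
  have h0: "integral {-R..R} (\<lambda>x. h x * deriv \<eta> x) = 0" if t: "test1 R \<eta>" for \<eta>
  proof -
    have R: "-R \<le> R" using x by simp
    obtain s where s: "s < R" "\<And>x. s < \<bar>x\<bar> \<Longrightarrow> \<eta> x = 0 \<and> deriv \<eta> x = 0"
      using test1_deriv_zero[OF t] by blast
    have \<eta>0: "\<eta> R = 0" "\<eta> (-R) = 0" using s(2)[of R] s(2)[of "-R"] s(1) R by auto
    have i1: "(\<lambda>x. f x * deriv \<eta> x) integrable_on {-R..R}" "(\<lambda>x. G x * deriv \<eta> x) integrable_on {-R..R}" "(\<lambda>x. g x * \<eta> x) integrable_on {-R..R}"
      by (intro integrable_continuous_real continuous_intros cf cG cg test1_continuous[OF t] test1_deriv_continuous[OF t])+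
    have "((\<lambda>x. g x * \<eta> x + deriv \<eta> x * G x) has_integral (G R * \<eta> R - G (-R) * \<eta> (-R))) {-R..R}"
    proof (rule fundamental_theorem_of_calculus[OF R])
      fix z assume z: "z \<in> {-R..R}"
      have "((\<lambda>x. G x * \<eta> x) has_real_derivative g z * \<eta> z + deriv \<eta> z * G z) (at z within {-R..R})"
        by (rule DERIV_mult[OF dG[OF z] has_field_derivative_at_within[OF test1_deriv[OF t]]])
      then show "((\<lambda>x. G x * \<eta> x) has_vector_derivative g z * \<eta> z + deriv \<eta> z * G z) (at z within {-R..R})"
        by (simp add: has_real_derivative_iff_has_vector_derivative)
    qed
    then have "integral {-R..R} (\<lambda>x. g x * \<eta> x + G x * deriv \<eta> x) = 0"
      by (auto simp: \<eta>0 mult.commute dest: integral_unique)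
    then have "integral {-R..R} (\<lambda>x. g x * \<eta> x) + integral {-R..R} (\<lambda>x. G x * deriv \<eta> x) = 0"
      by (simp add: integral_add i1)
    then show ?thesis using w[OF t] by (simp add: h_def left_diff_distrib integral_diff i1)
  qed
  have "h x1 = h x2"
  proof (rule ccontr)
    assume ne: "h x1 \<noteq> h x2"
    \<comment> \<open>Each average of \<open>h\<close> is within \<open>e\<close> of the value at
      its centre, up to the factor \<open>step 1\<close>. The two errors make \<open>2 * e\<close>,
      half of the assumed difference, which is the contradiction.\<close>
    define e where "e = \<bar>h x1 - h x2\<bar> / 4"
    have e: "e > 0" using ne by (simp add: e_def)
    have xr: "x1 \<in> {-R..R}" "x2 \<in> {-R..R}" using x by auto
    have near: "\<exists>d>0. \<forall>y\<in>{-R..R}. \<bar>y - z\<bar> < d \<longrightarrow> \<bar>h y - h z\<bar> < e" if "z \<in> {-R..R}" for z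
      using ch that e unfolding continuous_on_iff dist_real_def by blast
    obtain d1 where d1: "d1 > 0" "\<And>y. y \<in> {-R..R} \<Longrightarrow> \<bar>y - x1\<bar> < d1 \<Longrightarrow> \<bar>h y - h x1\<bar> < e" using near[OF xr(1)] by blast
    obtain d2 where d2: "d2 > 0" "\<And>y. y \<in> {-R..R} \<Longrightarrow> \<bar>y - x2\<bar> < d2 \<Longrightarrow> \<bar>h y - h x2\<bar> < e" using near[OF xr(2)] by blast
    \<comment> \<open>The radius of the bumps is small enough for continuity at both points and for
      both bumps to lie inside \<open>{-R..R}\<close>.\<close>
    define \<delta> where "\<delta> = min (min d1 d2) (min (R + x1) (R - x2)) / 2"
    have \<delta>: "\<delta> > 0" "\<delta> < d1" "\<delta> < d2" "\<delta> < R + x1" "\<delta> < R - x2" using d1(1) d2(1) x by (auto simp: \<delta>_def)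
    define st where "st z x = step ((1 / \<delta>) * x + (- z / \<delta>))" for z x
    have std: "(st z has_real_derivative bump ((x - z) / \<delta>) / \<delta>) (at x)" for z x
    proof -
      have "((\<lambda>x. (1 / \<delta>) * x + (- z / \<delta>)) has_real_derivative 1 / \<delta>) (at x)"
        using \<delta>(1) by (auto intro!: derivative_eq_intros)
      from DERIV_chain2[where f=step and g="\<lambda>x. (1 / \<delta>) * x + (- z / \<delta>)", OF step_deriv this]
      show ?thesis by (simp add: st_def[abs_def] diff_divide_distrib)
    qed
    have st0: "st z x = 0" if "x \<le> z - \<delta>" for z x
    proof -
      have "(x - z) / \<delta> \<le> -1" using that \<delta> by (simp add: field_simps)
      then show ?thesis using step_left[of "(x - z) / \<delta>"] by (simp add: st_def diff_divide_distrib)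
    qed
    have st1: "st z x = step 1" if "z + \<delta> \<le> x" for z x
    proof -
      have "1 \<le> (x - z) / \<delta>" using that \<delta> by (simp add: field_simps)
      then show ?thesis using step_right[of "(x - z) / \<delta>"] by (simp add: st_def diff_divide_distrib)
    qed
    define \<eta> where "\<eta> x = st x1 x + (-1) * st x2 x" for x
    have t: "test1 R \<eta>"
      unfolding test1_def
    proof (intro conjI allI exI)
      show "smooth_upto n \<eta>" for n
        unfolding \<eta>_def[abs_def] st_def[abs_def]
        by (intro smooth_upto_add smooth_upto_cmult smooth_upto_affine step_smooth)
      show "max (\<delta> - x1) (x2 + \<delta>) < R" using \<delta> by auto
      show "max (\<delta> - x1) (x2 + \<delta>) \<le> \<bar>z\<bar> \<longrightarrow> \<eta> z = 0" for z
        using st0[of z x1] st0[of z x2] st1[of x1 z] st1[of x2 z] x by (auto simp: \<eta>_def abs_if split: if_splits)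
    qed
    have d\<eta>: "deriv \<eta> x = bump ((x - x1) / \<delta>) / \<delta> - bump ((x - x2) / \<delta>) / \<delta>" for x
    proof (rule DERIV_imp_deriv)
      have "(\<eta> has_real_derivative bump ((x - x1) / \<delta>) / \<delta> + (-1) * (bump ((x - x2) / \<delta>) / \<delta>)) (at x)"
        unfolding \<eta>_def[abs_def] by (intro DERIV_add DERIV_cmult std)
      then show "(\<eta> has_real_derivative bump ((x - x1) / \<delta>) / \<delta> - bump ((x - x2) / \<delta>) / \<delta>) (at x)" by simp
    qed
    have cb: "continuous_on S (\<lambda>x. bump ((x - z) / \<delta>) / \<delta>)" for S z
      by (intro continuous_intros continuous_on_compose2[OF bump_continuous]) (use \<delta> in auto)
    have R: "-R \<le> R" using x by simp
    have Ib: "integral {-R..R} (\<lambda>x. bump ((x - z) / \<delta>) / \<delta>) = step 1" if "z - \<delta> > -R" "z + \<delta> < R" for z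
    proof -
      have "((\<lambda>x. bump ((x - z) / \<delta>) / \<delta>) has_integral (st z R - st z (-R))) {-R..R}"
        by (rule fundamental_theorem_of_calculus[OF R])
           (use std in \<open>auto simp: has_real_derivative_iff_has_vector_derivative[symmetric] intro: has_field_derivative_at_within\<close>)
      then show ?thesis using st0[of "-R" z] st1[of z R] that by (auto dest: integral_unique)
    qed
    have key: "\<bar>integral {-R..R} (\<lambda>x. h x * (bump ((x - z) / \<delta>) / \<delta>)) - h z * step 1\<bar> \<le> e * step 1"
      if z: "z - \<delta> > -R" "z + \<delta> < R" and hz: "\<And>y. y \<in> {-R..R} \<Longrightarrow> \<bar>y - z\<bar> < \<delta> \<Longrightarrow> \<bar>h y - h z\<bar> < e" for z
    proof -
      have i: "(\<lambda>x. h x * (bump ((x - z) / \<delta>) / \<delta>)) integrable_on {-R..R}" "(\<lambda>x. h z * (bump ((x - z) / \<delta>) / \<delta>)) integrable_on {-R..R}"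
        "(\<lambda>x. (h x - h z) * (bump ((x - z) / \<delta>) / \<delta>)) integrable_on {-R..R}" "(\<lambda>x. e * (bump ((x - z) / \<delta>) / \<delta>)) integrable_on {-R..R}"
        by (intro integrable_continuous_real continuous_on_mult continuous_on_diff ch cb continuous_on_const)+
      have "integral {-R..R} (\<lambda>x. h x * (bump ((x - z) / \<delta>) / \<delta>)) - h z * step 1
        = integral {-R..R} (\<lambda>x. h x * (bump ((x - z) / \<delta>) / \<delta>)) - integral {-R..R} (\<lambda>x. h z * (bump ((x - z) / \<delta>) / \<delta>))"
        by (simp only: integral_mult_right Ib[OF z])
      also have "\<dots> = integral {-R..R} (\<lambda>x. (h x - h z) * (bump ((x - z) / \<delta>) / \<delta>))"
        unfolding left_diff_distrib by (rule integral_diff[symmetric, OF i(1,2)])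
      also have "norm \<dots> \<le> integral {-R..R} (\<lambda>x. e * (bump ((x - z) / \<delta>) / \<delta>))"
      proof (rule integral_norm_bound_integral[OF i(3,4)])
        fix y assume y: "y \<in> {-R..R}"
        show "norm ((h y - h z) * (bump ((y - z) / \<delta>) / \<delta>)) \<le> e * (bump ((y - z) / \<delta>) / \<delta>)"
        proof (cases "\<bar>y - z\<bar> < \<delta>")
          case True
          have "\<bar>h y - h z\<bar> \<le> e" using hz[OF y True] by simp
          then show ?thesis using bump_nonneg[of "(y - z) / \<delta>"] \<delta>(1)
            by (simp add: abs_mult) (intro divide_right_mono mult_right_mono, auto)
        next
          case False
          then have "1 \<le> \<bar>(y - z) / \<delta>\<bar>" using \<delta>(1) by (simp add: abs_divide)
          then show ?thesis by (simp add: bump_zero)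
        qed
      qed
      also have "\<dots> = e * step 1" by (simp only: integral_mult_right Ib[OF z])
      finally show ?thesis by simp
    qed
    have k1: "\<bar>integral {-R..R} (\<lambda>x. h x * (bump ((x - x1) / \<delta>) / \<delta>)) - h x1 * step 1\<bar> \<le> e * step 1"
      by (rule key) (use \<delta> d1 x in auto)
    have k2: "\<bar>integral {-R..R} (\<lambda>x. h x * (bump ((x - x2) / \<delta>) / \<delta>)) - h x2 * step 1\<bar> \<le> e * step 1"
      by (rule key) (use \<delta> d2 x in auto)
    have "integral {-R..R} (\<lambda>x. h x * deriv \<eta> x) = integral {-R..R} (\<lambda>x. h x * (bump ((x - x1) / \<delta>) / \<delta>)) - integral {-R..R} (\<lambda>x. h x * (bump ((x - x2) / \<delta>) / \<delta>))"
      unfolding d\<eta> right_diff_distrib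
      by (intro integral_diff integrable_continuous_real continuous_on_mult ch cb)
    then have "\<bar>h x1 * step 1 - h x2 * step 1\<bar> \<le> 2 * (e * step 1)"
      using k1 k2 h0[OF t] by linarith
    then have "\<bar>h x1 - h x2\<bar> * step 1 \<le> (2 * e) * step 1"
      using step_pos by (simp add: abs_mult left_diff_distrib[symmetric])
    then have "\<bar>h x1 - h x2\<bar> \<le> 2 * e" using step_pos by simp
    then show False using e by (simp add: e_def)
  qed
  moreover have "G x1 + integral {x1..x2} g = G x2"
    unfolding G_def
    by (rule Henstock_Kurzweil_Integration.integral_combine)
       (use x in \<open>auto intro!: integrable_continuous_real continuous_on_subset[OF cg]\<close>)
  ultimately show ?thesis by (simp add: h_def)
qed

section \<open>Rotated coordinates\<close>

lemma GDERIV_unique: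
  assumes "GDERIV f x :> D" "GDERIV f x :> D'" shows "D = D'"
proof -
  have "(\<lambda>h. h \<bullet> D) = (\<lambda>h. h \<bullet> D')"
    using has_derivative_unique assms unfolding gderiv_def by blast
  then have "h \<bullet> D = h \<bullet> D'" for h by meson
  then have "(D - D') \<bullet> (D - D') = 0" by (simp add: inner_diff_right)
  then show ?thesis by simp
qed

lemma grad_eqI: "GDERIV f x :> D \<Longrightarrow> grad f x = D"
  unfolding grad_def by (rule the_equality) (auto intro: GDERIV_unique)

lemma differentiable_GDERIV:
  fixes f :: "real^2 \<Rightarrow> real"
  assumes "f differentiable (at x)" shows "GDERIV f x :> grad f x"
proof -
  obtain f' where f': "(f has_derivative f') (at x)" using assms by (auto simp: differentiable_def)
  have "f' h = h \<bullet> adjoint f' 1" for h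
    using adjoint_works[of f' h 1] has_derivative_linear[OF f'] by (simp add: inner_commute)
  then have "f' = (\<lambda>h. h \<bullet> adjoint f' 1)" by blast
  then have "GDERIV f x :> adjoint f' 1" using f' unfolding gderiv_def by simp
  then show ?thesis using grad_eqI by metis
qed

lemma C1_onD:
  assumes "C1_on S f"
  shows "x \<in> S \<Longrightarrow> GDERIV f x :> grad f x" "continuous_on S (grad f)" "continuous_on S f"
proof -
  have d: "\<And>x. x \<in> S \<Longrightarrow> f differentiable (at x)" and c: "\<And>i. continuous_on S (\<lambda>x. grad f x $ i)"
    using assms unfolding C1_on_def One_nat_def Ck_on.simps by auto
  show "x \<in> S \<Longrightarrow> GDERIV f x :> grad f x" using d differentiable_GDERIV by blast
  have "continuous_on S (\<lambda>x. \<chi> i. grad f x $ i)" by (rule continuous_on_vec_lambda[OF c])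
  then show "continuous_on S (grad f)" by simp
  show "continuous_on S f"
    using d by (intro continuous_at_imp_continuous_on ballI differentiable_imp_continuous_within) auto
qed

lemma GDERIV_along:
  assumes f: "GDERIV f (\<gamma> t) :> D" and \<gamma>: "(\<gamma> has_vector_derivative \<gamma>') (at t within T)"
  shows "((\<lambda>t. f (\<gamma> t)) has_real_derivative D \<bullet> \<gamma>') (at t within T)"
proof -
  have "(f has_derivative (\<lambda>h. h \<bullet> D)) (at (\<gamma> t) within \<gamma> ` T)"
    using f unfolding gderiv_def by (rule has_derivative_at_withinI)
  from has_derivative_in_compose[OF \<gamma>[unfolded has_vector_derivative_def] this]
  show ?thesis unfolding has_field_derivative_def
    by (rule has_derivative_eq_rhs) (auto simp: inner_commute mult.commute)
qed

lemma Ck_on_UNIV_linear_combination: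
  assumes "Ck_on k UNIV f" "Ck_on k UNIV g"
  shows "Ck_on k UNIV (\<lambda>x. \<alpha> * f x + \<beta> * g x)"
  using assms
proof (induction k arbitrary: f g)
  case 0
  then show ?case by (auto intro!: continuous_intros)
next
  case (Suc k)
  have d: "f differentiable (at x)" "g differentiable (at x)" for x using Suc.prems by auto
  have gr: "grad (\<lambda>x. \<alpha> * f x + \<beta> * g x) x = \<alpha> *\<^sub>R grad f x + \<beta> *\<^sub>R grad g x" for x
  proof (rule grad_eqI)
    have "GDERIV (\<lambda>x. \<alpha> * f x + \<beta> * g x) x :> (\<alpha> *\<^sub>R grad f x + f x *\<^sub>R 0) + (\<beta> *\<^sub>R grad g x + g x *\<^sub>R 0)"
      by (intro GDERIV_add GDERIV_mult GDERIV_const differentiable_GDERIV d)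
    then show "GDERIV (\<lambda>x. \<alpha> * f x + \<beta> * g x) x :> \<alpha> *\<^sub>R grad f x + \<beta> *\<^sub>R grad g x" by simp
  qed
  have "Ck_on k UNIV (\<lambda>x. \<alpha> * (grad f x $ i) + \<beta> * (grad g x $ i))" for i
    by (rule Suc.IH) (use Suc.prems in auto)
  then show ?case using d by (auto simp: gr intro!: derivative_intros)
qed

section \<open>Product test functions along rotated axes\<close>

definition tensor :: "real^2 \<Rightarrow> real^2 \<Rightarrow> real^2 \<Rightarrow> (real \<Rightarrow> real) \<Rightarrow> (real \<Rightarrow> real) \<Rightarrow> real^2 \<Rightarrow> real" where
  "tensor q a b \<eta> \<zeta> p = \<eta> ((p - q) \<bullet> a) * \<zeta> ((p - q) \<bullet> b)"

lemma tensor_GDERIV: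
  assumes "\<And>x. (\<eta> has_real_derivative \<eta>' x) (at x)" "\<And>x. (\<zeta> has_real_derivative \<zeta>' x) (at x)"
  shows "GDERIV (tensor q a b \<eta> \<zeta>) p :> tensor q a b \<eta>' \<zeta> p *\<^sub>R a + tensor q a b \<eta> \<zeta>' p *\<^sub>R b"
proof -
  have i: "GDERIV (\<lambda>p. (p - q) \<bullet> a) p :> a" for a
    unfolding gderiv_def by (auto intro!: derivative_eq_intros)
  have "GDERIV (tensor q a b \<eta> \<zeta>) p :> \<eta> ((p - q) \<bullet> a) *\<^sub>R (\<zeta>' ((p - q) \<bullet> b) *\<^sub>R b) + \<zeta> ((p - q) \<bullet> b) *\<^sub>R (\<eta>' ((p - q) \<bullet> a) *\<^sub>R a)"
    unfolding tensor_def[abs_def] by (intro GDERIV_mult GDERIV_DERIV_compose[OF i] assms)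
  then show ?thesis by (simp add: tensor_def add.commute mult.commute)
qed

text \<open>The components of the gradient are linear combinations of tensors with one factor
  differentiated, so the class reproduces itself although \<open>Ck_on\<close> refers to the
  standard axes.\<close>

lemma tensor_Ck:
  assumes "smooth_upto (Suc k) \<eta>" "smooth_upto (Suc k) \<zeta>"
  shows "Ck_on k UNIV (tensor q a b \<eta> \<zeta>)"
  using assms
proof (induction k arbitrary: \<eta> \<zeta>)
  case 0
  then obtain \<eta>' \<zeta>' where d: "\<And>x. (\<eta> has_real_derivative \<eta>' x) (at x)" "\<And>x. (\<zeta> has_real_derivative \<zeta>' x) (at x)" by auto
  have "tensor q a b \<eta> \<zeta> differentiable (at x)" for x
    using tensor_GDERIV[OF d] unfolding gderiv_def differentiable_def by blast
  then show ?case by (auto intro!: continuous_at_imp_continuous_on differentiable_imp_continuous_within)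
next
  case (Suc k)
  then obtain \<eta>' \<zeta>' where d: "\<And>x. (\<eta> has_real_derivative \<eta>' x) (at x)" "smooth_upto (Suc k) \<eta>'"
    "\<And>x. (\<zeta> has_real_derivative \<zeta>' x) (at x)" "smooth_upto (Suc k) \<zeta>'"
    by (auto simp only: smooth_upto.simps(2)[of "Suc k"])
  note G = tensor_GDERIV[OF d(1,3), of q a b]
  have "tensor q a b \<eta> \<zeta> differentiable (at x)" for x
    using G unfolding gderiv_def differentiable_def by blast
  moreover have "Ck_on k UNIV (\<lambda>p. grad (tensor q a b \<eta> \<zeta>) p $ i)" for i
  proof -
    have "Ck_on k UNIV (\<lambda>p. (a $ i) * tensor q a b \<eta>' \<zeta> p + (b $ i) * tensor q a b \<eta> \<zeta>' p)"
      by (intro Ck_on_UNIV_linear_combination Suc.IH d Suc.prems[THEN smooth_upto_SucD])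
    then show ?thesis by (simp add: grad_eqI[OF G] mult.commute)
  qed
  ultimately show ?case by simp
qed

definition rot :: "real^2 \<Rightarrow> real^2" where "rot v = vector [v $ 2, - (v $ 1)]"

lemma inner_2: "(v :: real^2) \<bullet> w = v $ 1 * w $ 1 + v $ 2 * w $ 2"
  by (simp add: inner_vec_def sum_2)

lemma rot_nth [simp]: "rot v $ 1 = v $ 2" "rot v $ 2 = - (v $ 1)"
  by (simp_all add: rot_def)

section \<open>Lebesgue measure in rotated coordinates\<close>

definition vec2 :: "real \<times> real \<Rightarrow> real^2" where "vec2 z = vector [fst z, snd z]"

lemma vec2_eq: "vec2 z = fst z *\<^sub>R axis 1 1 + snd z *\<^sub>R axis 2 1"
  by (auto simp: vec_eq_iff vec2_def forall_2 axis_def)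

lemma vec2_measurable: "vec2 \<in> borel \<rightarrow>\<^sub>M borel"
proof (rule borel_measurable_continuous_onI)
  show "continuous_on UNIV vec2" unfolding vec2_eq[abs_def] by (intro continuous_intros)
qed

lemma distr_vec2: "distr lborel borel vec2 = lborel"
proof (rule lborel_eqI[symmetric])
  note m = vec2_measurable
  fix l u :: "real^2" assume le: "\<And>b. b \<in> Basis \<Longrightarrow> l \<bullet> b \<le> u \<bullet> b"
  have le': "l $ i \<le> u $ i" for i using le[of "axis i 1"] by (simp add: inner_axis axis_in_Basis_iff)
  have "vec2 -` box l u = {l $ 1<..<u $ 1} \<times> {l $ 2<..<u $ 2}"
    by (auto simp: vec2_def mem_box_cart forall_2)
  then have "emeasure (distr lborel borel vec2) (box l u) = emeasure lborel ({l $ 1<..<u $ 1} \<times> {l $ 2<..<u $ 2})"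
    using m by (subst emeasure_distr) auto
  also have "\<dots> = emeasure lborel {l $ 1<..<u $ 1} * emeasure lborel {l $ 2<..<u $ 2}"
    by (simp add: lborel_prod[symmetric] lborel.emeasure_pair_measure_Times)
  also have "\<dots> = ennreal ((u $ 1 - l $ 1) * (u $ 2 - l $ 2))"
    using le' by (simp add: ennreal_mult)
  also have "(u $ 1 - l $ 1) * (u $ 2 - l $ 2) = (\<Prod>i\<in>UNIV. (u - l) $ i)"
    by (simp add: UNIV_2)
  also have "\<dots> = (\<Prod>b\<in>Basis. (u - l) \<bullet> b)"
  proof -
    have "inj (\<lambda>i. axis i (1::real) :: real^2)" by (auto simp: inj_on_def axis_eq_axis)
    moreover have B: "Basis = range (\<lambda>i. axis i (1::real) :: real^2)" by (auto simp: Basis_vec_def)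
    ultimately show ?thesis unfolding B by (simp add: prod.reindex o_def inner_axis)
  qed
  finally show "emeasure (distr lborel borel vec2) (box l u) = ennreal (\<Prod>b\<in>Basis. (u - l) \<bullet> b)" .
qed simp

text \<open>Images under orthogonal maps keep their Lebesgue measure. Applied to the inverse map,
  this gives the measure of preimages of boxes, which determines \<open>lborel\<close>.\<close>

lemma distr_orthogonal:
  fixes L :: "real^2 \<Rightarrow> real^2"
  assumes L: "orthogonal_transformation L"
  shows "distr lborel borel L = lborel"
proof (rule lborel_eqI[symmetric])
  have lin: "linear L" by (rule orthogonal_transformation_linear[OF L])
  have m: "L \<in> borel \<rightarrow>\<^sub>M borel"
    using linear_continuous_on[of L UNIV] lin by (intro borel_measurable_continuous_onI) (simp add: linear_conv_bounded_linear)
  have bij: "bij L" by (rule orthogonal_transformation_bij[OF L])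
  have Li: "orthogonal_transformation (inv L)" by (rule orthogonal_transformation_inv[OF L])
  fix l u :: "real^2" assume le: "\<And>b. b \<in> Basis \<Longrightarrow> l \<bullet> b \<le> u \<bullet> b"
  have pre: "L -` box l u = inv L ` box l u" using bij by (simp add: bij_vimage_eq_inv_image)
  have lm: "inv L ` box l u \<in> lmeasurable" and me: "measure lebesgue (inv L ` box l u) = measure lebesgue (box l u)"
    using measurable_orthogonal_image[OF Li, of "box l u"] measure_orthogonal_image[OF Li, of "box l u"] by auto
  have ob: "L -` box l u \<in> sets borel"
    using measurable_sets[OF m, of "box l u"] by simp
  have "emeasure (distr lborel borel L) (box l u) = emeasure lborel (L -` box l u)"
    using m by (subst emeasure_distr) auto
  also have "emeasure lborel (L -` box l u) = emeasure lebesgue (inv L ` box l u)"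
    using ob by (simp add: pre[symmetric])
  also have "emeasure lebesgue (inv L ` box l u) = ennreal (measure lebesgue (inv L ` box l u))"
    by (rule emeasure_eq_measure2[OF lm])
  also have "\<dots> = emeasure lebesgue (box l u)"
    unfolding me by (rule emeasure_eq_measure2[symmetric]) simp
  also have "\<dots> = emeasure lborel (box l u)" by simp
  also have "\<dots> = ennreal (\<Prod>b\<in>Basis. (u - l) \<bullet> b)" by (rule emeasure_lborel_box[OF le])
  finally show "emeasure (distr lborel borel L) (box l u) = ennreal (\<Prod>b\<in>Basis. (u - l) \<bullet> b)" .
qed simp

section \<open>Orthonormal frames and the weak equation in them\<close>

locale frame =
  fixes q v :: "real^2"
  assumes v_unit: "norm v = 1"
begin

text \<open>\<open>(rot v, v)\<close> is the standard basis turned so that its second vector is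
  \<open>v\<close>. Orientation is preserved, as the sign of the curl requires.\<close>

definition P :: "real \<times> real \<Rightarrow> real^2" where
  "P z = q + (fst z *\<^sub>R rot v + snd z *\<^sub>R v)"

lemma v_sq: "(v $ 1)\<^sup>2 + (v $ 2)\<^sup>2 = 1"
  using v_unit by (simp add: norm_eq_1 inner_2 power2_eq_square)

lemma frame_inner [simp]: "v \<bullet> v = 1" "rot v \<bullet> rot v = 1" "rot v \<bullet> v = 0" "v \<bullet> rot v = 0"
  using v_sq by (auto simp: inner_2 power2_eq_square)

lemma P_coords [simp]: "(P z - q) \<bullet> rot v = fst z" "(P z - q) \<bullet> v = snd z"
  by (simp_all add: P_def inner_add_left)

lemma frame_decomp: "w = (w \<bullet> rot v) *\<^sub>R rot v + (w \<bullet> v) *\<^sub>R v"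
proof -
  have "w $ 1 * ((v $ 1)\<^sup>2 + (v $ 2)\<^sup>2) = w $ 1" "w $ 2 * ((v $ 1)\<^sup>2 + (v $ 2)\<^sup>2) = w $ 2"
    by (simp_all add: v_sq)
  then show ?thesis
    by (auto simp: vec_eq_iff forall_2 inner_2 algebra_simps power2_eq_square)
qed

lemma P_inv: "P ((p - q) \<bullet> rot v, (p - q) \<bullet> v) = p"
  using frame_decomp[of "p - q"] by (simp add: P_def)

lemma frame_inner_decomp: "w \<bullet> w' = (w \<bullet> rot v) * (w' \<bullet> rot v) + (w \<bullet> v) * (w' \<bullet> v)"
proof -
  have "w \<bullet> w' = ((w \<bullet> rot v) *\<^sub>R rot v + (w \<bullet> v) *\<^sub>R v) \<bullet> w'" using frame_decomp[of w] by simp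
  also have "\<dots> = (w \<bullet> rot v) * (rot v \<bullet> w') + (w \<bullet> v) * (v \<bullet> w')" by (simp add: inner_add_left)
  finally show ?thesis by (simp only: inner_commute[of w'])
qed

lemma P_continuous: "continuous_on S P"
  unfolding P_def[abs_def] by (intro continuous_intros)

lemma P_inj: "inj P"
  by (rule injI) (metis P_coords prod.expand)

lemma P_vector_derivative:
  assumes "(x has_real_derivative x') (at t within T)" "(y has_real_derivative y') (at t within T)"
  shows "((\<lambda>t. P (x t, y t)) has_vector_derivative x' *\<^sub>R rot v + y' *\<^sub>R v) (at t within T)"
  unfolding P_def[abs_def]
  using assms unfolding has_real_derivative_iff_has_vector_derivative
  by (auto intro!: derivative_eq_intros simp: has_real_derivative_iff_has_vector_derivative[symmetric])

lemma distr_P: "distr lborel borel P = lborel"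
proof -
  define L where "L w = (w $ 1) *\<^sub>R rot v + (w $ 2) *\<^sub>R v" for w :: "real^2"
  have lin: "linear L" unfolding L_def[abs_def] by (rule linearI) (simp_all add: algebra_simps)
  have "L a \<bullet> L b = a \<bullet> b" for a b
    by (simp add: L_def inner_add_left inner_add_right inner_2[of a b])
  then have L: "orthogonal_transformation L" using lin by (simp add: orthogonal_transformation_def)
  have mL: "L \<in> borel \<rightarrow>\<^sub>M borel"
    using linear_continuous_on[of L UNIV] lin by (intro borel_measurable_continuous_onI) (simp add: linear_conv_bounded_linear)
  note mv = vec2_measurable
  \<comment> \<open>Identification of pairs with vectors, rotation and translation each preserve
    Lebesgue measure.\<close>
  have "P = ((+) q \<circ> L) \<circ> vec2" by (auto simp: fun_eq_iff P_def L_def vec2_def)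
  then have "distr lborel borel P = distr (distr (distr lborel borel vec2) borel L) borel ((+) q)"
    using mL mv by (simp add: distr_distr o_assoc)
  then show ?thesis by (simp add: distr_vec2 distr_orthogonal[OF L] lborel_distr_plus)
qed

lemma integral_frame:
  fixes g :: "real^2 \<Rightarrow> real"
  assumes R: "0 \<le> R" and g: "continuous_on (P ` sq R) g"
  shows "(LINT p:P ` sq R|lborel. g p) = integral {-R..R} (\<lambda>x. integral {-R..R} (\<lambda>y. g (P (x, y))))"
proof -
  have csq: "compact (sq R)" by (auto intro!: compact_Times)
  have cP: "compact (P ` sq R)" by (rule compact_continuous_image[OF P_continuous csq])
  have cgP: "continuous_on (sq R) (\<lambda>z. g (P z))"
    by (rule continuous_on_compose2[OF g P_continuous]) auto
  have mP: "P \<in> borel \<rightarrow>\<^sub>M borel" by (rule borel_measurable_continuous_onI[OF P_continuous])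
  have bs: "P ` sq R \<in> sets borel" using cP by (simp add: borel_compact)
  have mg: "(\<lambda>p. indicator (P ` sq R) p *\<^sub>R g p) \<in> borel_measurable borel"
    by (rule borel_measurable_continuous_on_indicator[OF bs g])
  have "(LINT p:P ` sq R|lborel. g p) = integral\<^sup>L (distr lborel borel P) (\<lambda>p. indicator (P ` sq R) p *\<^sub>R g p)"
    by (simp add: set_lebesgue_integral_def distr_P)
  also have "\<dots> = integral\<^sup>L lborel (\<lambda>z. indicator (P ` sq R) (P z) *\<^sub>R g (P z))"
    by (rule integral_distr) (use mP mg in auto)
  also have "(\<lambda>z. indicator (P ` sq R) (P z) *\<^sub>R g (P z)) = (\<lambda>z. indicator (sq R) z *\<^sub>R g (P z))"
    using P_inj by (auto simp: fun_eq_iff indicator_def inj_image_mem_iff)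
  also have "integral\<^sup>L lborel \<dots> = (LINT z:sq R|lborel. g (P z))" by (simp add: set_lebesgue_integral_def)
  also have "\<dots> = integral (sq R) (\<lambda>z. g (P z))"
  proof (rule set_borel_integral_eq_integral(2))
    have "integrable lborel (\<lambda>z. indicator (sq R) z *\<^sub>R g (P z))"
      by (rule borel_integrable_compact[OF csq cgP])
    then show "set_integrable lborel (sq R) (\<lambda>z. g (P z))" by (simp add: set_integrable_def)
  qed
  also have "\<dots> = integral {-R..R} (\<lambda>x. integral {-R..R} (\<lambda>y. g (P (x, y))))"
  proof -
    have "cbox (-R, -R) (R, R) = sq R" by (auto simp: cbox_Pair_eq)
    then show ?thesis
      using integral_prod_continuous[of "-R" "-R" R R "\<lambda>z. g (P z)"] cgP by simp
  qed
  finally show ?thesis .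
qed

lemma tensor_zero:
  assumes "test1 R \<eta>" "test1 R \<zeta>"
  obtains s where "s < R" "\<And>p. tensor q (rot v) v \<eta> \<zeta> p \<noteq> 0 \<Longrightarrow> p \<in> P ` sq s"
    "\<And>p. tensor q (rot v) v (deriv \<eta>) \<zeta> p \<noteq> 0 \<Longrightarrow> p \<in> P ` sq s"
    "\<And>p. tensor q (rot v) v \<eta> (deriv \<zeta>) p \<noteq> 0 \<Longrightarrow> p \<in> P ` sq s"
proof -
  obtain s1 where s1: "s1 < R" "\<And>x. s1 < \<bar>x\<bar> \<Longrightarrow> \<eta> x = 0 \<and> deriv \<eta> x = 0" using test1_deriv_zero[OF assms(1)] by metis
  obtain s2 where s2: "s2 < R" "\<And>x. s2 < \<bar>x\<bar> \<Longrightarrow> \<zeta> x = 0 \<and> deriv \<zeta> x = 0" using test1_deriv_zero[OF assms(2)] by metis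
  have "p \<in> P ` sq (max s1 s2)" if "\<not> s1 < \<bar>(p - q) \<bullet> rot v\<bar>" "\<not> s2 < \<bar>(p - q) \<bullet> v\<bar>" for p
    by (rule image_eqI[where x="((p - q) \<bullet> rot v, (p - q) \<bullet> v)"]) (use that in \<open>auto simp: P_inv\<close>)
  then show ?thesis using that[of "max s1 s2"] s1 s2 unfolding tensor_def by (metis max_less_iff_conj mult_eq_0_iff)
qed

lemma tensor_test_function:
  assumes "test1 R \<eta>" "test1 R \<zeta>" "P ` sq R \<subseteq> \<Omega>"
  shows "test_function \<Omega> (\<lambda>p. c * tensor q (rot v) v \<eta> \<zeta> p)"
proof -
  let ?\<phi> = "tensor q (rot v) v \<eta> \<zeta>"
  obtain s where s: "s < R" "\<And>p. ?\<phi> p \<noteq> 0 \<Longrightarrow> p \<in> P ` sq s" using tensor_zero[OF assms(1,2)] by metis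
  have cP: "compact (P ` sq s)"
    by (rule compact_continuous_image[OF P_continuous]) (auto intro!: compact_Times)
  have sub: "closure {x. c * ?\<phi> x \<noteq> 0} \<subseteq> P ` sq s"
    by (rule closure_minimal) (use s(2) compact_imp_closed[OF cP] in auto)
  have "Ck_on k UNIV (\<lambda>p. c * ?\<phi> p + 0 * ?\<phi> p)" for k
    using assms(1,2) by (intro Ck_on_UNIV_linear_combination tensor_Ck) (auto simp: test1_def simp del: smooth_upto.simps)
  then have "Ck_on k UNIV (\<lambda>p. c * ?\<phi> p)" for k by simp
  moreover have "compact (closure {x. c * ?\<phi> x \<noteq> 0})"
    using compact_Int_closed[OF cP closed_closure, of "{x. c * ?\<phi> x \<noteq> 0}"] sub by (simp add: Int_absorb1)
  moreover have "P ` sq s \<subseteq> \<Omega>" using assms(3) s(1) by (auto simp: image_subset_iff)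
  ultimately show ?thesis using sub unfolding test_function_def by blast
qed

text \<open>The test function is supported in a square of nonsingular points, so the integral over
  the singular set vanishes. What remains is linear in the test function, and testing with both
  signs turns the weak inequality into an equation.\<close>

lemma weak_tensor:
  assumes ws: "weak_solution \<Omega> F H u" and sub: "P ` sq R \<subseteq> \<Omega> - singular_set \<Omega> F u" and R: "0 \<le> R"
    and cN: "continuous_on (P ` sq R) (N_field F u)" and cH: "continuous_on (P ` sq R) H"
    and t: "test1 R \<eta>" "test1 R \<zeta>"
  shows "integral {-R..R} (\<lambda>x. integral {-R..R} (\<lambda>y. (N_field F u (P (x, y)) \<bullet> rot v) * (deriv \<eta> x * \<zeta> y)
     + (N_field F u (P (x, y)) \<bullet> v) * (\<eta> x * deriv \<zeta> y) + H (P (x, y)) * (\<eta> x * \<zeta> y))) = 0"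
proof -
  let ?S = "singular_set \<Omega> F u" and ?\<phi> = "tensor q (rot v) v \<eta> \<zeta>" and ?N = "N_field F u"
  define \<psi> where "\<psi> p = tensor q (rot v) v (deriv \<eta>) \<zeta> p *\<^sub>R rot v + tensor q (rot v) v \<eta> (deriv \<zeta>) p *\<^sub>R v" for p
  have G: "GDERIV ?\<phi> p :> \<psi> p" for p
    unfolding \<psi>_def by (rule tensor_GDERIV) (use test1_deriv t in blast)+
  have gr: "grad (\<lambda>p. c * ?\<phi> p) p = c *\<^sub>R \<psi> p" for c p
    using GDERIV_mult[OF GDERIV_const G, of c p] by (intro grad_eqI) simp
  obtain s where s: "s < R" "\<And>p. ?\<phi> p \<noteq> 0 \<Longrightarrow> p \<in> P ` sq s"
    "\<And>p. tensor q (rot v) v (deriv \<eta>) \<zeta> p \<noteq> 0 \<Longrightarrow> p \<in> P ` sq s"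
    "\<And>p. tensor q (rot v) v \<eta> (deriv \<zeta>) p \<noteq> 0 \<Longrightarrow> p \<in> P ` sq s"
    using tensor_zero[OF t] by metis
  have sR: "P ` sq s \<subseteq> P ` sq R" using s(1) by (intro image_mono) auto
  have z\<psi>: "\<psi> p = 0" and z\<phi>: "?\<phi> p = 0" if "p \<notin> P ` sq R" for p
  proof -
    have "p \<notin> P ` sq s" using that sR by blast
    then have "?\<phi> p = 0" "tensor q (rot v) v (deriv \<eta>) \<zeta> p = 0" "tensor q (rot v) v \<eta> (deriv \<zeta>) p = 0"
      using s(2-4) by blast+
    then show "\<psi> p = 0" "?\<phi> p = 0" unfolding \<psi>_def by simp_all
  qed
  have restrict: "(LINT p:T|lborel. g p) = (LINT p:P ` sq R|lborel. g p)"
    if "P ` sq R \<subseteq> T" "\<And>p. p \<notin> P ` sq R \<Longrightarrow> g p = 0" for T and g :: "real^2 \<Rightarrow> real"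
  proof -
    have "(\<lambda>p. indicator T p *\<^sub>R g p) = (\<lambda>p. indicator (P ` sq R) p *\<^sub>R g p)"
    proof
      fix p show "indicator T p *\<^sub>R g p = indicator (P ` sq R) p *\<^sub>R g p"
        using that by (cases "p \<in> P ` sq R") auto
    qed
    then show ?thesis by (simp add: set_lebesgue_integral_def)
  qed
  define I1 where "I1 = (LINT p:P ` sq R|lborel. ?N p \<bullet> \<psi> p)"
  define I2 where "I2 = (LINT p:P ` sq R|lborel. H p * ?\<phi> p)"
  have key: "0 \<le> c * (I1 + I2)" for c
  proof -
    have tf: "test_function \<Omega> (\<lambda>p. c * ?\<phi> p)" by (rule tensor_test_function[OF t]) (use sub in auto)
    have "(LINT x:?S|lborel. norm (grad (\<lambda>p. c * ?\<phi> p) x)) = 0"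
    proof -
      have "(\<lambda>p. indicator ?S p *\<^sub>R norm (c *\<^sub>R \<psi> p)) = (\<lambda>_. 0)"
      proof
        fix p show "indicator ?S p *\<^sub>R norm (c *\<^sub>R \<psi> p) = 0"
          using z\<psi>[of p] sub by (cases "p \<in> ?S") auto
      qed
      then show ?thesis unfolding gr set_lebesgue_integral_def by simp
    qed
    moreover have "(LINT x:\<Omega> - ?S|lborel. ?N x \<bullet> grad (\<lambda>p. c * ?\<phi> p) x) = c * I1"
      unfolding I1_def gr using restrict[OF sub, of "\<lambda>p. ?N p \<bullet> (c *\<^sub>R \<psi> p)"] z\<psi> by simp
    moreover have "(LINT x:\<Omega>|lborel. H x * (c * ?\<phi> x)) = c * I2"
    proof -
      have "P ` sq R \<subseteq> \<Omega>" using sub by auto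
      from restrict[OF this, of "\<lambda>p. c * (H p * ?\<phi> p)"] show ?thesis
        using z\<phi> by (simp add: I2_def mult.left_commute)
    qed
    moreover have "(LINT x:?S|lborel. norm (grad (\<lambda>p. c * ?\<phi> p) x))
        + (LINT x:\<Omega> - ?S|lborel. ?N x \<bullet> grad (\<lambda>p. c * ?\<phi> p) x)
        + (LINT x:\<Omega>|lborel. H x * (c * ?\<phi> x)) \<ge> 0"
      using ws tf unfolding weak_solution_def by blast
    ultimately show ?thesis by (simp add: distrib_left)
  qed
  have "I1 + I2 = 0" using key[of 1] key[of "-1"] by simp
  have c1: "continuous_on T (\<lambda>p. \<eta> ((p - q) \<bullet> rot v))" "continuous_on T (\<lambda>p. deriv \<eta> ((p - q) \<bullet> rot v))"
    "continuous_on T (\<lambda>p. \<zeta> ((p - q) \<bullet> v))" "continuous_on T (\<lambda>p. deriv \<zeta> ((p - q) \<bullet> v))" for T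
    by (rule continuous_on_compose2[OF test1_continuous[OF t(1), of UNIV]]
             continuous_on_compose2[OF test1_deriv_continuous[OF t(1), of UNIV]]
             continuous_on_compose2[OF test1_continuous[OF t(2), of UNIV]]
             continuous_on_compose2[OF test1_deriv_continuous[OF t(2), of UNIV]];
        auto intro!: continuous_intros)+
  have k1: "continuous_on (P ` sq R) (\<lambda>p. ?N p \<bullet> \<psi> p)" "continuous_on (P ` sq R) (\<lambda>p. H p * ?\<phi> p)"
    unfolding \<psi>_def tensor_def by (intro continuous_intros cN cH c1)+
  have csum: "continuous_on (P ` sq R) (\<lambda>p. ?N p \<bullet> \<psi> p + H p * ?\<phi> p)"
    by (intro continuous_on_add k1)
  have cP: "compact (P ` sq R)" by (rule compact_continuous_image[OF P_continuous]) (auto intro!: compact_Times)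
  have "I1 + I2 = (LINT p:P ` sq R|lborel. ?N p \<bullet> \<psi> p + H p * ?\<phi> p)"
    unfolding I1_def I2_def
    by (rule set_integral_add(2)[symmetric]; unfold set_integrable_def; rule borel_integrable_compact[OF cP]; rule k1)
  also have "\<dots> = integral {-R..R} (\<lambda>x. integral {-R..R} (\<lambda>y. ?N (P (x, y)) \<bullet> \<psi> (P (x, y)) + H (P (x, y)) * ?\<phi> (P (x, y))))"
    by (rule integral_frame[OF R csum])
  finally show ?thesis
    using \<open>I1 + I2 = 0\<close> by (simp add: \<psi>_def tensor_def inner_add_right mult.commute mult.left_commute)
qed

end

text \<open>\<open>du_bois_reymond\<close> is applied twice: for fixed \<open>\<zeta>\<close> it
  removes the test in \<open>x\<close>, leaving an identity between the lines at \<open>x1\<close>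
  and \<open>x2\<close>; then it removes \<open>\<zeta>\<close> in \<open>y\<close>. The loss from
  \<open>R\<close> to \<open>r\<close> comes from its restriction to interior points.\<close>

lemma flux_id_of_tensor_tests:
  fixes a b k :: "real \<times> real \<Rightarrow> real"
  assumes c: "continuous_on (sq R) a" "continuous_on (sq R) b" "continuous_on (sq R) k"
    and w: "\<And>\<eta> \<zeta>. test1 R \<eta> \<Longrightarrow> test1 R \<zeta> \<Longrightarrow> integral {-R..R} (\<lambda>x. integral {-R..R} (\<lambda>y.
      a (x, y) * (deriv \<eta> x * \<zeta> y) + b (x, y) * (\<eta> x * deriv \<zeta> y) + k (x, y) * (\<eta> x * \<zeta> y))) = 0"
    and r: "0 < r" "r < R"
  shows "flux_id r a b k"
  unfolding flux_id_def
proof (intro allI impI)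
  fix x1 x2 y1 y2 :: real
  assume h: "x1 \<in> {-r..r} \<and> x2 \<in> {-r..r} \<and> x1 \<le> x2 \<and> y1 \<in> {-r..r} \<and> y2 \<in> {-r..r} \<and> y1 \<le> y2"
  have R: "0 \<le> R" using r by simp
  have xR: "x1 \<in> {-R..R}" "x2 \<in> {-R..R}" "y1 \<in> {-R..R}" "y2 \<in> {-R..R}" using h r by auto
  have inner: "continuous_on {-R..R} (\<lambda>x. integral {-R..R} (\<lambda>y. f (x, y)))" if "continuous_on (sq R) f" for f :: "real \<times> real \<Rightarrow> real"
    using SI_param_continuous_fixed[OF that, of "-R" R] R by (simp add: SI_def)
  have step1: "integral {-R..R} (\<lambda>y. (a (x2, y) - a (x1, y)) * \<zeta> y)
      = integral {x1..x2} (\<lambda>x. integral {-R..R} (\<lambda>y. b (x, y) * deriv \<zeta> y + k (x, y) * \<zeta> y))"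
    if t: "test1 R \<zeta>" for \<zeta>
  proof -
    have cz: "continuous_on (sq R) (\<lambda>z. \<zeta> (snd z))" "continuous_on (sq R) (\<lambda>z. deriv \<zeta> (snd z))"
      by (rule continuous_on_compose2[OF test1_continuous[OF t, of UNIV]]
            continuous_on_compose2[OF test1_deriv_continuous[OF t, of UNIV]]; auto intro!: continuous_intros)+
    have ca: "continuous_on (sq R) (\<lambda>z. a z * \<zeta> (snd z))"
      and cb: "continuous_on (sq R) (\<lambda>z. b z * deriv \<zeta> (snd z) + k z * \<zeta> (snd z))"
      by (intro continuous_intros c cz)+
    let ?A = "\<lambda>x. integral {-R..R} (\<lambda>y. a (x, y) * \<zeta> y)"
    let ?B = "\<lambda>x. integral {-R..R} (\<lambda>y. b (x, y) * deriv \<zeta> y + k (x, y) * \<zeta> y)"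
    have cA: "continuous_on {-R..R} ?A" and cB: "continuous_on {-R..R} ?B"
      using inner[OF ca] inner[OF cb] by simp_all
    have ia: "(\<lambda>y. a (x, y) * \<zeta> y) integrable_on {-R..R}" and ib: "(\<lambda>y. b (x, y) * deriv \<zeta> y + k (x, y) * \<zeta> y) integrable_on {-R..R}"
      if "x \<in> {-R..R}" for x
      using continuous_on_slice(1)[OF ca that] continuous_on_slice(1)[OF cb that] by (auto intro: integrable_continuous_real)
    have "?A x2 - ?A x1 = integral {x1..x2} ?B"
    proof (rule du_bois_reymond[OF cA cB])
      fix \<eta> assume \<eta>: "test1 R \<eta>"
      have "integral {-R..R} (\<lambda>x. ?A x * deriv \<eta> x) + integral {-R..R} (\<lambda>x. ?B x * \<eta> x)
        = integral {-R..R} (\<lambda>x. ?A x * deriv \<eta> x + ?B x * \<eta> x)"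
        by (intro integral_add[symmetric] integrable_continuous_real continuous_on_mult cA cB test1_continuous[OF \<eta>] test1_deriv_continuous[OF \<eta>])
      also have "\<dots> = integral {-R..R} (\<lambda>x. integral {-R..R} (\<lambda>y.
          a (x, y) * (deriv \<eta> x * \<zeta> y) + b (x, y) * (\<eta> x * deriv \<zeta> y) + k (x, y) * (\<eta> x * \<zeta> y)))"
      proof (rule integral_cong)
        fix x assume x: "x \<in> {-R..R}"
        have "?A x * deriv \<eta> x + ?B x * \<eta> x = integral {-R..R} (\<lambda>y. a (x, y) * \<zeta> y * deriv \<eta> x)
            + integral {-R..R} (\<lambda>y. (b (x, y) * deriv \<zeta> y + k (x, y) * \<zeta> y) * \<eta> x)"
          by (simp only: integral_mult_left)
        also have "\<dots> = integral {-R..R} (\<lambda>y. a (x, y) * \<zeta> y * deriv \<eta> x + (b (x, y) * deriv \<zeta> y + k (x, y) * \<zeta> y) * \<eta> x)"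
          by (intro integral_add[symmetric] integrable_on_mult_left ia ib x)
        also have "\<dots> = integral {-R..R} (\<lambda>y. a (x, y) * (deriv \<eta> x * \<zeta> y) + b (x, y) * (\<eta> x * deriv \<zeta> y) + k (x, y) * (\<eta> x * \<zeta> y))"
          by (rule integral_cong) (simp add: algebra_simps)
        finally show "?A x * deriv \<eta> x + ?B x * \<eta> x = \<dots>" .
      qed
      also have "\<dots> = 0" by (rule w[OF \<eta> t])
      finally show "integral {-R..R} (\<lambda>x. ?A x * deriv \<eta> x) + integral {-R..R} (\<lambda>x. ?B x * \<eta> x) = 0" .
    qed (use h r in auto)
    moreover have "?A x2 - ?A x1 = integral {-R..R} (\<lambda>y. (a (x2, y) - a (x1, y)) * \<zeta> y)"
      unfolding left_diff_distrib by (rule integral_diff[symmetric, OF ia[OF xR(2)] ia[OF xR(1)]])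
    ultimately show ?thesis by simp
  qed
  let ?f = "\<lambda>y. integral {x1..x2} (\<lambda>x. b (x, y))"
  let ?g = "\<lambda>y. integral {x1..x2} (\<lambda>x. k (x, y)) - (a (x2, y) - a (x1, y))"
  have col: "continuous_on {-R..R} (\<lambda>y. integral {x1..x2} (\<lambda>x. f (x, y)))" if "continuous_on (sq R) f" for f :: "real \<times> real \<Rightarrow> real"
    using SI_param_continuous_fixed[OF continuous_on_swp[OF that] xR(1,2)] h by (simp add: SI_def)
  have cf: "continuous_on {-R..R} ?f" and ck: "continuous_on {-R..R} (\<lambda>y. integral {x1..x2} (\<lambda>x. k (x, y)))"
    and cda: "continuous_on {-R..R} (\<lambda>y. a (x2, y) - a (x1, y))"
    by (intro col c continuous_on_diff continuous_on_slice xR)+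
  have "?f y2 - ?f y1 = integral {y1..y2} ?g"
  proof (rule du_bois_reymond[OF cf continuous_on_diff[OF ck cda]])
    fix \<zeta> assume t: "test1 R \<zeta>"
    note ct = test1_continuous[OF t] test1_deriv_continuous[OF t]
    have cz: "continuous_on (sq R) (\<lambda>z. b z * deriv \<zeta> (snd z) + k z * \<zeta> (snd z))"
      by (intro continuous_intros c continuous_on_compose2[OF ct(1)[of UNIV]] continuous_on_compose2[OF ct(2)[of UNIV]]) auto
    have "integral {x1..x2} (\<lambda>x. integral {-R..R} (\<lambda>y. b (x, y) * deriv \<zeta> y + k (x, y) * \<zeta> y))
       = integral {-R..R} (\<lambda>y. integral {x1..x2} (\<lambda>x. b (x, y) * deriv \<zeta> y + k (x, y) * \<zeta> y))"
      using integral_slice_swap[OF cz, of x1 x2 "-R" R] xR by auto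
    also have "\<dots> = integral {-R..R} (\<lambda>y. ?f y * deriv \<zeta> y + integral {x1..x2} (\<lambda>x. k (x, y)) * \<zeta> y)"
    proof (rule integral_cong)
      fix y assume y: "y \<in> {-R..R}"
      have i: "(\<lambda>x. b (x, y)) integrable_on {x1..x2}" "(\<lambda>x. k (x, y)) integrable_on {x1..x2}"
        using continuous_on_slice(2)[OF c(2) y] continuous_on_slice(2)[OF c(3) y] xR
        by (auto intro!: integrable_continuous_real elim: continuous_on_subset)
      have "integral {x1..x2} (\<lambda>x. b (x, y) * deriv \<zeta> y + k (x, y) * \<zeta> y)
        = integral {x1..x2} (\<lambda>x. b (x, y) * deriv \<zeta> y) + integral {x1..x2} (\<lambda>x. k (x, y) * \<zeta> y)"
        by (intro integral_add integrable_on_mult_left i)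
      then show "integral {x1..x2} (\<lambda>x. b (x, y) * deriv \<zeta> y + k (x, y) * \<zeta> y) = ?f y * deriv \<zeta> y + integral {x1..x2} (\<lambda>x. k (x, y)) * \<zeta> y"
        by (simp only: integral_mult_left)
    qed
    finally have e: "integral {-R..R} (\<lambda>y. (a (x2, y) - a (x1, y)) * \<zeta> y) = integral {-R..R} (\<lambda>y. ?f y * deriv \<zeta> y + integral {x1..x2} (\<lambda>x. k (x, y)) * \<zeta> y)"
      using step1[OF t] by simp
    have i1: "(\<lambda>y. ?f y * deriv \<zeta> y) integrable_on {-R..R}" "(\<lambda>y. integral {x1..x2} (\<lambda>x. k (x, y)) * \<zeta> y) integrable_on {-R..R}"
      "(\<lambda>y. (a (x2, y) - a (x1, y)) * \<zeta> y) integrable_on {-R..R}"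
      by (intro integrable_continuous_real continuous_on_mult cf ck cda ct)+
    have "integral {-R..R} (\<lambda>y. ?g y * \<zeta> y) = integral {-R..R} (\<lambda>y. integral {x1..x2} (\<lambda>x. k (x, y)) * \<zeta> y) - integral {-R..R} (\<lambda>y. (a (x2, y) - a (x1, y)) * \<zeta> y)"
      unfolding left_diff_distrib[of "integral _ _"] by (rule integral_diff[OF i1(2,3)])
    then show "integral {-R..R} (\<lambda>y. ?f y * deriv \<zeta> y) + integral {-R..R} (\<lambda>y. ?g y * \<zeta> y) = 0"
      using e integral_add[OF i1(1,2)] by simp
  qed (use h r in auto)
  moreover have "integral {y1..y2} ?g = integral {y1..y2} (\<lambda>y. integral {x1..x2} (\<lambda>x. k (x, y))) - integral {y1..y2} (\<lambda>y. a (x2, y) - a (x1, y))"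
    by (rule integral_diff) (use ck cda xR in \<open>auto intro!: integrable_continuous_real elim: continuous_on_subset\<close>)
  moreover have "integral {x1..x2} (\<lambda>x. integral {y1..y2} (\<lambda>y. k (x, y))) = integral {y1..y2} (\<lambda>y. integral {x1..x2} (\<lambda>x. k (x, y)))"
    by (rule integral_slice_swap[OF c(3)]) (use xR in auto)
  moreover have "integral {x1..x2} (\<lambda>x. b (x, y2) - b (x, y1)) = ?f y2 - ?f y1"
    by (rule integral_diff) (use continuous_on_slice(2)[OF c(2) xR(3)] continuous_on_slice(2)[OF c(2) xR(4)] xR in
      \<open>auto intro!: integrable_continuous_real elim: continuous_on_subset\<close>)
  ultimately show "integral {y1..y2} (\<lambda>y. a (x2, y) - a (x1, y)) + integral {x1..x2} (\<lambda>x. b (x, y2) - b (x, y1))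
     = integral {x1..x2} (\<lambda>x. integral {y1..y2} (\<lambda>y. k (x, y)))" by simp
qed

section \<open>Weak solutions\<close>

lemma flux_id_mono: "flux_id r a b k \<Longrightarrow> s \<le> r \<Longrightarrow> flux_id s a b k"
  unfolding flux_id_def by (meson atLeastAtMost_iff neg_le_iff_le order_trans)

lemma flux_id_cong:
  assumes fl: "flux_id r a b k" and eq: "\<And>z. z \<in> sq r \<Longrightarrow> a z = a' z \<and> b z = b' z"
  shows "flux_id r a' b' k"
  unfolding flux_id_def
proof (intro allI impI)
  fix x1 x2 y1 y2
  assume h: "x1 \<in> {-r..r} \<and> x2 \<in> {-r..r} \<and> x1 \<le> x2 \<and> y1 \<in> {-r..r} \<and> y2 \<in> {-r..r} \<and> y1 \<le> y2"
  have "integral {y1..y2} (\<lambda>y. a' (x2, y) - a' (x1, y)) = integral {y1..y2} (\<lambda>y. a (x2, y) - a (x1, y))"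
    "integral {x1..x2} (\<lambda>x. b' (x, y2) - b' (x, y1)) = integral {x1..x2} (\<lambda>x. b (x, y2) - b (x, y1))"
    by (rule integral_cong; use h eq in auto)+
  then show "integral {y1..y2} (\<lambda>y. a' (x2, y) - a' (x1, y)) + integral {x1..x2} (\<lambda>x. b' (x, y2) - b' (x, y1))
     = integral {x1..x2} (\<lambda>x. integral {y1..y2} (\<lambda>y. k (x, y)))"
    using fl h unfolding flux_id_def by simp
qed

lemma sq_mono: "s \<le> r \<Longrightarrow> sq s \<subseteq> sq r"
  by auto

context frame begin

lemma P_partial:
  assumes "GDERIV f (P (x, y)) :> D"
  shows "((\<lambda>x. f (P (x, y))) has_real_derivative D \<bullet> rot v) (at x within T)"
    "((\<lambda>y. f (P (x, y))) has_real_derivative D \<bullet> v) (at y within T')"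
proof -
  have "((\<lambda>t. P (t, y)) has_vector_derivative 1 *\<^sub>R rot v + 0 *\<^sub>R v) (at x within T)"
    by (rule P_vector_derivative) (auto intro!: derivative_eq_intros)
  from GDERIV_along[where \<gamma>="\<lambda>t. P (t, y)", OF assms this]
  show "((\<lambda>x. f (P (x, y))) has_real_derivative D \<bullet> rot v) (at x within T)" by simp
  have "((\<lambda>t. P (x, t)) has_vector_derivative 0 *\<^sub>R rot v + 1 *\<^sub>R v) (at y within T')"
    by (rule P_vector_derivative) (auto intro!: derivative_eq_intros)
  from GDERIV_along[where \<gamma>="\<lambda>t. P (x, t)", OF assms this]
  show "((\<lambda>y. f (P (x, y))) has_real_derivative D \<bullet> v) (at y within T')" by simp
qed

lemma integral_partial:
  assumes "a \<le> b" and d: "\<And>t. t \<in> {a..b} \<Longrightarrow> (f has_real_derivative f' t) (at t within {a..b})"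
  shows "integral {a..b} f' = f b - (f a :: real)"
  by (rule integral_unique[OF fundamental_theorem_of_calculus[OF assms(1)]])
     (use d in \<open>auto simp: has_real_derivative_iff_has_vector_derivative\<close>)

text \<open>Invariance of the curl under rotation of the frame, with \<open>a\<close> and
  \<open>b\<close> the gradients of the two components of the field.\<close>

lemma curl_frame:
  "(v $ 1) * (a \<bullet> rot v) + (v $ 2) * (b \<bullet> rot v) - ((rot v $ 1) * (a \<bullet> v) + (rot v $ 2) * (b \<bullet> v)) = b $ 1 - a $ 2"
proof -
  have "b $ 1 - a $ 2 = (b $ 1 - a $ 2) * ((v $ 1)\<^sup>2 + (v $ 2)\<^sup>2)" by (simp add: v_sq)
  then show ?thesis by (simp add: inner_2 algebra_simps power2_eq_square)
qed

text \<open>The left-hand side is the circulation of \<open>grad u + F\<close> around a rectangle.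
  Each side turns \<open>grad u\<close> into a difference of values of \<open>u\<close>, and these
  cancel, so no second derivative of \<open>u\<close> is involved. For \<open>F\<close>, the
  fundamental theorem and a change of the order of integration produce the curl.\<close>

lemma curl_flux:
  assumes F: "C1_field_on \<Omega> F" and u: "C1_on \<Omega> u" and sub: "P ` sq R \<subseteq> \<Omega>"
  shows "flux_id R (\<lambda>z. (grad u (P z) + F (P z)) \<bullet> v) (\<lambda>z. - ((grad u (P z) + F (P z)) \<bullet> rot v)) (\<lambda>z. curl F (P z))"
  unfolding flux_id_def
proof (intro allI impI)
  fix x1 x2 y1 y2 :: real
  assume h: "x1 \<in> {-R..R} \<and> x2 \<in> {-R..R} \<and> x1 \<le> x2 \<and> y1 \<in> {-R..R} \<and> y2 \<in> {-R..R} \<and> y1 \<le> y2"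
  have xR: "x1 \<in> {-R..R}" "x2 \<in> {-R..R}" "y1 \<in> {-R..R}" "y2 \<in> {-R..R}" "x1 \<le> x2" "y1 \<le> y2" using h by auto
  have sx: "{x1..x2} \<subseteq> {-R..R}" and sy: "{y1..y2} \<subseteq> {-R..R}" using xR by auto
  have FC: "C1_on \<Omega> (\<lambda>x. F x $ i)" for i using F by (simp add: C1_field_on_def)
  have PO: "P (x, y) \<in> \<Omega>" if "x \<in> {-R..R}" "y \<in> {-R..R}" for x y using sub that by (auto simp: image_subset_iff)
  have cP: "continuous_on (sq R) (\<lambda>z. f (P z))" if "continuous_on \<Omega> f" for f :: "real^2 \<Rightarrow> 'a::topological_space"
    by (rule continuous_on_compose2[OF that P_continuous]) (use sub in auto)
  have cu: "continuous_on (sq R) (\<lambda>z. grad u (P z))" by (rule cP[OF C1_onD(2)[OF u]])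
  have cF: "continuous_on (sq R) (\<lambda>z. F (P z) $ i)" for i by (rule cP[OF C1_onD(3)[OF FC]])
  have cG: "continuous_on (sq R) (\<lambda>z. grad (\<lambda>x. F x $ i) (P z))" for i by (rule cP[OF C1_onD(2)[OF FC]])
  define Fw where "Fw w z = (w $ 1) * F (P z) $ 1 + (w $ 2) * F (P z) $ 2" for w :: "real^2" and z
  define G where "G w w' z = (w $ 1) * (grad (\<lambda>x. F x $ 1) (P z) \<bullet> w') + (w $ 2) * (grad (\<lambda>x. F x $ 2) (P z) \<bullet> w')" for w :: "real^2" and w' z
  have inner: "F p \<bullet> w = (w $ 1) * F p $ 1 + (w $ 2) * F p $ 2" for p and w :: "real^2"
    by (simp add: inner_2 mult.commute)
  have cFw: "continuous_on (sq R) (Fw w)" for w unfolding Fw_def by (intro continuous_intros cF)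
  have cGw: "continuous_on (sq R) (G w w')" for w w' unfolding G_def by (intro continuous_intros cG)
  have cuw: "continuous_on (sq R) (\<lambda>z. grad u (P z) \<bullet> w)" for w by (intro continuous_intros cu)
  have Gx: "integral {x1..x2} (\<lambda>x. G w (rot v) (x, y)) = Fw w (x2, y) - Fw w (x1, y)" if y: "y \<in> {-R..R}" for w y
  proof (rule integral_partial[OF xR(5)])
    fix x assume "x \<in> {x1..x2}"
    then have x: "x \<in> {-R..R}" using sx by auto
    show "((\<lambda>x. Fw w (x, y)) has_real_derivative G w (rot v) (x, y)) (at x within {x1..x2})"
      unfolding Fw_def G_def by (intro DERIV_add DERIV_cmult P_partial C1_onD(1)[OF FC] PO x y)
  qed
  have Gy: "integral {y1..y2} (\<lambda>y. G w v (x, y)) = Fw w (x, y2) - Fw w (x, y1)" if x: "x \<in> {-R..R}" for w x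
  proof (rule integral_partial[OF xR(6)])
    fix y assume "y \<in> {y1..y2}"
    then have y: "y \<in> {-R..R}" using sy by auto
    show "((\<lambda>y. Fw w (x, y)) has_real_derivative G w v (x, y)) (at y within {y1..y2})"
      unfolding Fw_def G_def by (intro DERIV_add DERIV_cmult P_partial C1_onD(1)[OF FC] PO x y)
  qed
  have ux: "integral {x1..x2} (\<lambda>x. grad u (P (x, y)) \<bullet> rot v) = u (P (x2, y)) - u (P (x1, y))" if y: "y \<in> {-R..R}" for y
    by (rule integral_partial[OF xR(5)]) (use sx in \<open>auto intro!: P_partial C1_onD(1)[OF u] PO y\<close>)
  have uy: "integral {y1..y2} (\<lambda>y. grad u (P (x, y)) \<bullet> v) = u (P (x, y2)) - u (P (x, y1))" if x: "x \<in> {-R..R}" for x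
    by (rule integral_partial[OF xR(6)]) (use sy in \<open>auto intro!: P_partial C1_onD(1)[OF u] PO x\<close>)
  have ix: "(\<lambda>x. f (x, y)) integrable_on {x1..x2}" if "continuous_on (sq R) f" "y \<in> {-R..R}" for y and f :: "real \<times> real \<Rightarrow> real"
    by (rule integrable_continuous_real[OF continuous_on_subset[OF continuous_on_slice(2)[OF that] sx]])
  have iy: "(\<lambda>y. f (x, y)) integrable_on {y1..y2}" if "continuous_on (sq R) f" "x \<in> {-R..R}" for x and f :: "real \<times> real \<Rightarrow> real"
    by (rule integrable_continuous_real[OF continuous_on_subset[OF continuous_on_slice(1)[OF that] sy]])
  have L: "integral {y1..y2} (\<lambda>y. (grad u (P (x2, y)) + F (P (x2, y))) \<bullet> v - (grad u (P (x1, y)) + F (P (x1, y))) \<bullet> v)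
    = (u (P (x2, y2)) - u (P (x2, y1))) - (u (P (x1, y2)) - u (P (x1, y1))) + integral {y1..y2} (\<lambda>y. integral {x1..x2} (\<lambda>x. G v (rot v) (x, y)))"
  proof -
    have "integral {y1..y2} (\<lambda>y. integral {x1..x2} (\<lambda>x. G v (rot v) (x, y))) = integral {y1..y2} (\<lambda>y. Fw v (x2, y) - Fw v (x1, y))"
      by (rule integral_cong) (use Gx sy in auto)
    moreover have "integral {y1..y2} (\<lambda>y. (grad u (P (x2, y)) \<bullet> v - grad u (P (x1, y)) \<bullet> v) + (Fw v (x2, y) - Fw v (x1, y)))
      = (integral {y1..y2} (\<lambda>y. grad u (P (x2, y)) \<bullet> v) - integral {y1..y2} (\<lambda>y. grad u (P (x1, y)) \<bullet> v))
        + integral {y1..y2} (\<lambda>y. Fw v (x2, y) - Fw v (x1, y))"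
      using integral_add[OF integrable_diff[OF iy[OF cuw[of v] xR(2)] iy[OF cuw[of v] xR(1)]] integrable_diff[OF iy[OF cFw[of v] xR(2)] iy[OF cFw[of v] xR(1)]]]
        integral_diff[OF iy[OF cuw[of v] xR(2)] iy[OF cuw[of v] xR(1)]] by (simp only:)
    ultimately show ?thesis
      using uy[OF xR(1)] uy[OF xR(2)] by (simp add: inner_add_left inner Fw_def add_diff_add)
  qed
  \<comment> \<open>The sides parallel to \<open>rot v\<close> give the corner values of
    \<open>u\<close> with signs opposite to those in \<open>L\<close>.\<close>
  have M: "integral {x1..x2} (\<lambda>x. - ((grad u (P (x, y2)) + F (P (x, y2))) \<bullet> rot v) - - ((grad u (P (x, y1)) + F (P (x, y1))) \<bullet> rot v))
    = (u (P (x2, y1)) - u (P (x1, y1))) - (u (P (x2, y2)) - u (P (x1, y2))) - integral {x1..x2} (\<lambda>x. integral {y1..y2} (\<lambda>y. G (rot v) v (x, y)))"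
  proof -
    have "integral {x1..x2} (\<lambda>x. integral {y1..y2} (\<lambda>y. G (rot v) v (x, y))) = integral {x1..x2} (\<lambda>x. Fw (rot v) (x, y2) - Fw (rot v) (x, y1))"
      by (rule integral_cong) (use Gy sx in auto)
    moreover have "integral {x1..x2} (\<lambda>x. (grad u (P (x, y1)) \<bullet> rot v - grad u (P (x, y2)) \<bullet> rot v) - (Fw (rot v) (x, y2) - Fw (rot v) (x, y1)))
      = (integral {x1..x2} (\<lambda>x. grad u (P (x, y1)) \<bullet> rot v) - integral {x1..x2} (\<lambda>x. grad u (P (x, y2)) \<bullet> rot v))
        - integral {x1..x2} (\<lambda>x. Fw (rot v) (x, y2) - Fw (rot v) (x, y1))"
      using integral_diff[OF integrable_diff[OF ix[OF cuw[of "rot v"] xR(3)] ix[OF cuw[of "rot v"] xR(4)]] integrable_diff[OF ix[OF cFw[of "rot v"] xR(4)] ix[OF cFw[of "rot v"] xR(3)]]]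
        integral_diff[OF ix[OF cuw[of "rot v"] xR(3)] ix[OF cuw[of "rot v"] xR(4)]] by (simp only:)
    moreover have "- ((grad u (P (x, y2)) + F (P (x, y2))) \<bullet> rot v) - - ((grad u (P (x, y1)) + F (P (x, y1))) \<bullet> rot v)
      = (grad u (P (x, y1)) \<bullet> rot v - grad u (P (x, y2)) \<bullet> rot v) - (Fw (rot v) (x, y2) - Fw (rot v) (x, y1))" for x
      unfolding inner_add_left inner Fw_def by simp
    ultimately show ?thesis
      using ux[OF xR(3)] ux[OF xR(4)] by simp
  qed
  have sw: "integral {y1..y2} (\<lambda>y. integral {x1..x2} (\<lambda>x. G v (rot v) (x, y))) = integral {x1..x2} (\<lambda>x. integral {y1..y2} (\<lambda>y. G v (rot v) (x, y)))"
    by (rule integral_slice_swap[OF cGw sx sy, symmetric])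
  have "integral {x1..x2} (\<lambda>x. integral {y1..y2} (\<lambda>y. curl F (P (x, y))))
    = integral {x1..x2} (\<lambda>x. integral {y1..y2} (\<lambda>y. G v (rot v) (x, y)) - integral {y1..y2} (\<lambda>y. G (rot v) v (x, y)))"
  proof (rule integral_cong)
    fix x assume "x \<in> {x1..x2}"
    then have x: "x \<in> {-R..R}" using sx by auto
    have "curl F (P z) = G v (rot v) z - G (rot v) v z" for z
      using curl_frame[of "grad (\<lambda>x. F x $ 1) (P z)" "grad (\<lambda>x. F x $ 2) (P z)"] by (simp add: curl_def G_def)
    then show "integral {y1..y2} (\<lambda>y. curl F (P (x, y))) = integral {y1..y2} (\<lambda>y. G v (rot v) (x, y)) - integral {y1..y2} (\<lambda>y. G (rot v) v (x, y))"
      using integral_diff[OF iy[OF cGw[of v "rot v"] x] iy[OF cGw[of "rot v" v] x]] by (simp only:)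
  qed
  also have "\<dots> = integral {x1..x2} (\<lambda>x. integral {y1..y2} (\<lambda>y. G v (rot v) (x, y))) - integral {x1..x2} (\<lambda>x. integral {y1..y2} (\<lambda>y. G (rot v) v (x, y)))"
  proof (rule integral_diff)
    have "(\<lambda>x. integral {y1..y2} (\<lambda>y. f (x, y))) integrable_on {x1..x2}" if "continuous_on (sq R) f" for f :: "real \<times> real \<Rightarrow> real"
      using SI_param_continuous_fixed[OF that xR(3,4)] xR(6)
      by (intro integrable_continuous_real continuous_on_subset[OF _ sx]) (simp add: SI_def)
    then show "(\<lambda>x. integral {y1..y2} (\<lambda>y. G v (rot v) (x, y))) integrable_on {x1..x2}"
      "(\<lambda>x. integral {y1..y2} (\<lambda>y. G (rot v) v (x, y))) integrable_on {x1..x2}" using cGw by blast+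
  qed
  finally show "integral {y1..y2} (\<lambda>y. (grad u (P (x2, y)) + F (P (x2, y))) \<bullet> v - (grad u (P (x1, y)) + F (P (x1, y))) \<bullet> v)
      + integral {x1..x2} (\<lambda>x. - ((grad u (P (x, y2)) + F (P (x, y2))) \<bullet> rot v) - - ((grad u (P (x, y1)) + F (P (x, y1))) \<bullet> rot v))
    = integral {x1..x2} (\<lambda>x. integral {y1..y2} (\<lambda>y. curl F (P (x, y))))"
    unfolding L M sw by simp
qed

end

section \<open>Jacobi fields along characteristic curves in the domain\<close>

text \<open>\<open>h\<close> is the continuous extension of \<open>N(H)\<close>, fixed on all of
  \<open>\<Omega>\<close>. Its continuity at singular points is what bounds \<open>K\<close> near
  the end point of a characteristic curve.\<close>

locale weak_graph =
  fixes \<Omega> :: "(real^2) set" and F :: "real^2 \<Rightarrow> real^2" and H u h :: "real^2 \<Rightarrow> real"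
  assumes open_\<Omega>: "open \<Omega>" and F_C1: "C1_field_on \<Omega> F" and H_cont: "continuous_on \<Omega> H" and u_C1: "C1_on \<Omega> u"
    and weak: "weak_solution \<Omega> F H u"
    and h_cont: "continuous_on \<Omega> h"
    and h_deriv: "\<And>q. q \<in> \<Omega> - singular_set \<Omega> F u \<Longrightarrow> has_deriv_along H (N_field F u) (\<Omega> - singular_set \<Omega> F u) q (h q)"
begin

abbreviation "U \<equiv> \<Omega> - singular_set \<Omega> F u"
abbreviation "N \<equiv> N_field F u"
abbreviation "Nperp \<equiv> Nperp_field F u"
abbreviation "D \<equiv> D_fun F u"

definition K :: "real^2 \<Rightarrow> real" where "K p = h p + H p * H p"

lemma F_cont: "continuous_on \<Omega> F"
proof -
  have "continuous_on \<Omega> (\<lambda>x. \<chi> i. F x $ i)"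
    by (intro continuous_on_vec_lambda C1_onD(3)) (use F_C1 in \<open>simp add: C1_field_on_def\<close>)
  then show ?thesis by simp
qed

lemma curl_cont: "continuous_on \<Omega> (curl F)"
  unfolding curl_def[abs_def]
  by (intro continuous_intros C1_onD(2)) (use F_C1 in \<open>simp_all add: C1_field_on_def\<close>)

lemma grad_F_cont: "continuous_on \<Omega> (\<lambda>p. grad u p + F p)"
  by (intro continuous_intros F_cont C1_onD(2)[OF u_C1])

lemma D_cont: "continuous_on \<Omega> D"
  unfolding D_fun_def[abs_def] by (intro continuous_intros grad_F_cont)

lemma K_cont: "continuous_on \<Omega> K"
  unfolding K_def[abs_def] by (intro continuous_intros h_cont H_cont)

lemma U_nonzero: "p \<in> U \<Longrightarrow> grad u p + F p \<noteq> 0"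
  by (auto simp: singular_set_def)

lemma D_pos: "p \<in> U \<Longrightarrow> D p > 0"
  using U_nonzero by (auto simp: D_fun_def)

lemma open_U: "open U"
proof -
  have "U = \<Omega> \<inter> (\<lambda>p. grad u p + F p) -` (- {0})" by (auto simp: singular_set_def)
  then show ?thesis
    using continuous_open_preimage[OF grad_F_cont open_\<Omega>, of "- {0}"] by auto
qed

lemma N_cont: "continuous_on U N"
  unfolding N_field_def[abs_def]
  by (intro continuous_intros continuous_on_subset[OF grad_F_cont]) (use U_nonzero in auto)

lemma N_norm: "p \<in> U \<Longrightarrow> norm (N p) = 1"
  using U_nonzero[of p] by (simp add: N_field_def)

lemma D_N: "p \<in> U \<Longrightarrow> D p *\<^sub>R N p = grad u p + F p"
  using U_nonzero[of p] by (simp add: N_field_def D_fun_def)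

lemma Nperp_eq: "Nperp p = rot (N p)"
  by (simp add: Nperp_field_def rot_def)

text \<open>The symmetric interval matches the integral curves over which
  \<open>has_deriv_along\<close> quantifies.\<close>

definition ic :: "real \<Rightarrow> (real \<Rightarrow> real^2) \<Rightarrow> bool" where
  "ic \<epsilon> \<gamma> \<longleftrightarrow> \<epsilon> > 0 \<and> integral_curve Nperp U {-\<epsilon><..<\<epsilon>} \<gamma>"

text \<open>With second axis \<open>N q\<close>, the component of \<open>N\<close> along it is
  \<open>1\<close> at \<open>q\<close> and exceeds \<open>1/2\<close> nearby. Three nested squares
  occur: on \<open>R\<close> the weak equation is tested, on \<open>r\<close> its flux balance
  holds, and on \<open>s\<close> also the balance of \<open>H N\<close>, which costs the factor
  \<open>8\<close> demanded by \<open>flux_product\<close>.\<close>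

lemma local_char_frame:
  assumes q: "q \<in> U"
  obtains r where "frame (N q)"
    "char_frame r (\<lambda>z. N (frame.P q (N q) z) \<bullet> rot (N q)) (\<lambda>z. N (frame.P q (N q) z) \<bullet> N q) (\<lambda>z. H (frame.P q (N q) z))
      (\<lambda>z. D (frame.P q (N q) z)) (\<lambda>z. curl F (frame.P q (N q) z)) (\<lambda>z. K (frame.P q (N q) z))"
    "frame.P q (N q) ` sq r \<subseteq> U"
proof -
  define v where "v = N q"
  interpret frame q v by unfold_locales (simp add: v_def N_norm[OF q])
  have P0: "P (0, 0) = q" by (simp add: P_def)
  have "open (U \<inter> (\<lambda>p. N p \<bullet> v) -` {1/2<..})"
    by (rule continuous_open_preimage[OF _ open_U]) (auto intro!: continuous_intros N_cont)
  then have "open (P -` (U \<inter> (\<lambda>p. N p \<bullet> v) -` {1/2<..}))"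
    by (rule open_vimage[OF _ P_continuous])
  moreover have "(0, 0) \<in> P -` (U \<inter> (\<lambda>p. N p \<bullet> v) -` {1/2<..})"
    using q by (simp add: P0 v_def[symmetric])
  ultimately obtain e where e: "e > 0" "ball (0, 0) e \<subseteq> P -` (U \<inter> (\<lambda>p. N p \<bullet> v) -` {1/2<..})"
    by (rule openE)
  \<comment> \<open>Coordinates of size at most \<open>e / 3\<close> add up to less than
    \<open>e\<close>, so the square lies in the ball.\<close>
  define R where "R = e / 3"
  have R: "R > 0" using e by (simp add: R_def)
  have sqR: "P z \<in> U \<and> 1 / 2 < N (P z) \<bullet> v" if "z \<in> sq R" for z
  proof -
    have "dist (0, 0) z \<le> \<bar>fst z\<bar> + \<bar>snd z\<bar>"
      by (cases z) (simp add: dist_Pair_Pair dist_real_def, rule order_trans[OF sqrt_sum_squares_le_sum_abs], simp)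
    also have "\<dots> < e" using that e(1) by (auto simp: R_def abs_le_iff abs_if)
    finally have "z \<in> ball (0, 0) e" by simp
    then have "z \<in> P -` (U \<inter> (\<lambda>p. N p \<bullet> v) -` {1/2<..})" using e(2) by blast
    then show ?thesis by simp
  qed
  have sub: "P ` sq R \<subseteq> U" using sqR by auto
  have cP: "continuous_on (sq R) (\<lambda>z. f (P z))" if "continuous_on U f" for f :: "real^2 \<Rightarrow> 'a::topological_space"
    by (rule continuous_on_compose2[OF that P_continuous sub])
  have cPO: "continuous_on (sq R) (\<lambda>z. f (P z))" if "continuous_on \<Omega> f" for f :: "real^2 \<Rightarrow> 'a::topological_space"
    by (rule cP[OF continuous_on_subset[OF that]]) auto
  define A where "A z = N (P z) \<bullet> rot v" for z
  define B where "B z = N (P z) \<bullet> v" for z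
  have cA: "continuous_on (sq R) A" and cB: "continuous_on (sq R) B"
    unfolding A_def B_def by (intro continuous_intros cP N_cont)+
  note cH = cPO[OF H_cont] and ch = cPO[OF h_cont]
  define r where "r = R / 2"
  have r: "0 < r" "r < R" using R by (auto simp: r_def)
  have flux: "flux_id r A B (\<lambda>z. H (P z))"
  proof (rule flux_id_of_tensor_tests[OF cA cB cH _ r])
    fix \<eta> \<zeta> assume t: "test1 R \<eta>" "test1 R \<zeta>"
    show "integral {-R..R} (\<lambda>x. integral {-R..R} (\<lambda>y. A (x, y) * (deriv \<eta> x * \<zeta> y) + B (x, y) * (\<eta> x * deriv \<zeta> y) + H (P (x, y)) * (\<eta> x * \<zeta> y))) = 0"
      unfolding A_def B_def
      by (rule weak_tensor[OF weak sub _ continuous_on_subset[OF N_cont sub] continuous_on_subset[OF H_cont] t]) (use R sub in auto)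
  qed
  have unit: "(A z)\<^sup>2 + (B z)\<^sup>2 = 1" if "z \<in> sq R" for z
  proof -
    have "N (P z) \<bullet> N (P z) = 1" using N_norm[of "P z"] sqR[OF that] by (simp add: norm_eq_1)
    then show ?thesis using frame_inner_decomp[of "N (P z)" "N (P z)"] by (simp add: A_def B_def power2_eq_square)
  qed
  have fr: "flux_frame t A B (\<lambda>z. H (P z))" if t: "0 < t" "t \<le> r" for t
  proof
    have st: "sq t \<subseteq> sq R" using t r by (intro sq_mono) auto
    show "continuous_on (sq t) A" "continuous_on (sq t) B" "continuous_on (sq t) (\<lambda>z. H (P z))"
      by (rule continuous_on_subset[OF _ st], fact)+
    show "(A p)\<^sup>2 + (B p)\<^sup>2 = 1" "1 / 2 \<le> B p" if "p \<in> sq t" for p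
      using that st unit[of p] sqR[of p] by (auto simp: B_def)
    show "flux_id t A B (\<lambda>z. H (P z))" by (rule flux_id_mono[OF flux t(2)])
  qed (use t in auto)
  interpret fl: flux_frame r A B "\<lambda>z. H (P z)" by (rule fr) (use r in auto)
  define s where "s = r / 8"
  have s: "0 < s" "8 * s \<le> r" "s \<le> r" "s \<le> R" using r by (auto simp: s_def)
  have srR: "sq r \<subseteq> sq R" "sq s \<subseteq> sq R" using r s by (auto intro!: sq_mono)
  have fp: "flux_product r A B (\<lambda>z. H (P z)) s (\<lambda>z. H (P z)) (\<lambda>z. h (P z))"
  proof
    fix X y assume X: "fl.ncurve s X" and y: "y \<in> {-s<..<s}"
    show "((\<lambda>y. H (P (X y, y))) has_real_derivative h (P (X y, y)) / B (X y, y)) (at y)"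
    proof (rule fl.ncurve_field_derivative[where f="\<lambda>z. H (P z)" and h="\<lambda>z. h (P z)", OF _ X s(3) y])
      fix x y e assume e: "e > (0::real)" and xy: "\<And>t. \<bar>t\<bar> < e \<Longrightarrow> (x t, y t) \<in> sq r \<and>
        (x has_real_derivative A (x t, y t)) (at t) \<and> (y has_real_derivative B (x t, y t)) (at t)"
      have "integral_curve N U {-e<..<e} (\<lambda>t. P (x t, y t))"
        unfolding integral_curve_def
      proof (intro ballI conjI)
        fix t assume "t \<in> {-e<..<e}"
        then have t: "\<bar>t\<bar> < e" by auto
        have z: "(x t, y t) \<in> sq R" using xy[OF t] srR by blast
        show "P (x t, y t) \<in> U" using sqR[OF z] by simp
        have "((\<lambda>t. P (x t, y t)) has_vector_derivative A (x t, y t) *\<^sub>R rot v + B (x t, y t) *\<^sub>R v) (at t)"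
          by (rule P_vector_derivative) (use xy[OF t] in auto)
        then show "((\<lambda>t. P (x t, y t)) has_vector_derivative N (P (x t, y t))) (at t)"
          unfolding A_def B_def frame_decomp[symmetric] .
      qed
      moreover have "P (x 0, y 0) \<in> U"
      proof -
        have "(x 0, y 0) \<in> sq r" using xy[of 0] e by (metis abs_zero)
        then show ?thesis using sqR srR by blast
      qed
      ultimately show "((\<lambda>t. H (P (x t, y t))) has_real_derivative h (P (x 0, y 0))) (at 0)"
        using h_deriv[of "P (x 0, y 0)"] e unfolding has_deriv_along_def by blast
    qed
  qed (use s srR in \<open>auto intro: continuous_on_subset[OF cH] continuous_on_subset[OF ch]\<close>)
  interpret fps: flux_frame s A B "\<lambda>z. H (P z)" by (rule fr) (use s in auto)
  have "char_frame s A B (\<lambda>z. H (P z)) (\<lambda>z. D (P z)) (\<lambda>z. curl F (P z)) (\<lambda>z. K (P z))"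
  proof
    show "continuous_on (sq s) (\<lambda>z. D (P z))" "continuous_on (sq s) (\<lambda>z. curl F (P z))" "continuous_on (sq s) (\<lambda>z. K (P z))"
      by (rule continuous_on_subset[OF cPO srR(2)], rule D_cont curl_cont K_cont)+
    show "D (P p) > 0" if "p \<in> sq s" for p
      using that srR sqR by (intro D_pos) blast
    show "flux_id s (\<lambda>z. H (P z) * A z) (\<lambda>z. H (P z) * B z) (\<lambda>z. K (P z))"
      using flux_product.flux_product[OF fp] by (simp add: K_def)
    have "flux_id s (\<lambda>z. (grad u (P z) + F (P z)) \<bullet> v) (\<lambda>z. - ((grad u (P z) + F (P z)) \<bullet> rot v)) (\<lambda>z. curl F (P z))"
      by (rule curl_flux[OF F_C1 u_C1]) (use sub srR in blast)
    then show "flux_id s (\<lambda>z. D (P z) * B z) (\<lambda>z. - (D (P z) * A z)) (\<lambda>z. curl F (P z))"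
    proof (rule flux_id_cong)
      fix z assume "z \<in> sq s"
      then have "P z \<in> U" using sqR srR by blast
      from D_N[OF this, symmetric]
      show "(grad u (P z) + F (P z)) \<bullet> v = D (P z) * B z \<and> - ((grad u (P z) + F (P z)) \<bullet> rot v) = - (D (P z) * A z)"
        by (simp add: A_def B_def)
    qed
  qed
  then show ?thesis
    using that[of s] frame_axioms sub srR(2) unfolding A_def B_def v_def by blast
qed

lemma ic_shift:
  assumes "ic \<epsilon> \<gamma>" "\<bar>t\<bar> < \<epsilon>"
  shows "ic (\<epsilon> - \<bar>t\<bar>) (\<lambda>s. \<gamma> (t + s))"
  unfolding ic_def integral_curve_def
proof (intro conjI ballI)
  fix s assume s: "s \<in> {-(\<epsilon> - \<bar>t\<bar>)<..<\<epsilon> - \<bar>t\<bar>}"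
  then have ts: "t + s \<in> {-\<epsilon><..<\<epsilon>}" unfolding greaterThanLessThan_iff by linarith
  show "\<gamma> (t + s) \<in> U" using assms(1) ts unfolding ic_def integral_curve_def by blast
  have "(\<gamma> has_vector_derivative Nperp (\<gamma> (t + s))) (at (t + s))"
    using assms(1) ts unfolding ic_def integral_curve_def by blast
  moreover have "((\<lambda>s. t + s) has_vector_derivative 1) (at s)" by (auto intro!: derivative_eq_intros)
  ultimately have "(\<gamma> \<circ> (\<lambda>s. t + s) has_vector_derivative 1 *\<^sub>R Nperp (\<gamma> (t + s))) (at s)"
    by (intro vector_diff_chain_at)
  then show "((\<lambda>s. \<gamma> (t + s)) has_vector_derivative Nperp (\<gamma> (t + s))) (at s)" by (simp add: o_def)
qed (use assms in auto)

lemma ic_in: "ic \<epsilon> \<gamma> \<Longrightarrow> \<bar>t\<bar> < \<epsilon> \<Longrightarrow> \<gamma> t \<in> U"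
  unfolding ic_def integral_curve_def by (simp add: abs_less_iff)

lemma ic_pcurve:
  assumes q: "q \<in> U" and \<gamma>: "ic \<epsilon> \<gamma>" "\<gamma> 0 = q"
    and fr: "frame (N q)"
    and cf: "char_frame r (\<lambda>z. N (frame.P q (N q) z) \<bullet> rot (N q)) (\<lambda>z. N (frame.P q (N q) z) \<bullet> N q) (\<lambda>z. H (frame.P q (N q) z))
      (\<lambda>z. D (frame.P q (N q) z)) (\<lambda>z. curl F (frame.P q (N q) z)) (\<lambda>z. K (frame.P q (N q) z))"
  obtains \<epsilon>' where "char_frame.pcurve r (\<lambda>z. N (frame.P q (N q) z) \<bullet> rot (N q)) (\<lambda>z. N (frame.P q (N q) z) \<bullet> N q) \<epsilon>'
      (\<lambda>t. (\<gamma> t - q) \<bullet> rot (N q)) (\<lambda>t. (\<gamma> t - q) \<bullet> N q)"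
    "\<And>t. frame.P q (N q) ((\<gamma> t - q) \<bullet> rot (N q), (\<gamma> t - q) \<bullet> N q) = \<gamma> t"
proof -
  define v where "v = N q"
  interpret frame q v using fr by (simp add: v_def)
  interpret char_frame r "\<lambda>z. N (P z) \<bullet> rot v" "\<lambda>z. N (P z) \<bullet> v" "\<lambda>z. H (P z)" "\<lambda>z. D (P z)" "\<lambda>z. curl F (P z)" "\<lambda>z. K (P z)"
    using cf by (simp add: v_def)
  define x where "x t = (\<gamma> t - q) \<bullet> rot v" for t
  define y where "y t = (\<gamma> t - q) \<bullet> v" for t
  have Pxy: "P (x t, y t) = \<gamma> t" for t unfolding x_def y_def by (rule P_inv)
  have \<epsilon>: "\<epsilon> > 0" using \<gamma>(1) by (simp add: ic_def)
  have d\<gamma>: "(\<gamma> has_vector_derivative rot (N (\<gamma> t))) (at t)" if "\<bar>t\<bar> < \<epsilon>" for t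
    using \<gamma>(1) that unfolding ic_def integral_curve_def Nperp_eq by (simp add: abs_less_iff)
  have dinner: "((\<lambda>t. (\<gamma> t - q) \<bullet> w) has_real_derivative rot (N (\<gamma> t)) \<bullet> w) (at t)" if "\<bar>t\<bar> < \<epsilon>" for t w
  proof -
    have "((\<lambda>t. (\<gamma> t - q) \<bullet> w) has_derivative (\<lambda>h. (h *\<^sub>R rot (N (\<gamma> t)) - 0) \<bullet> w)) (at t)"
      using d\<gamma>[OF that] unfolding has_vector_derivative_def
      by (intro has_derivative_inner_left has_derivative_diff has_derivative_const)
    then show ?thesis unfolding has_field_derivative_def
      by (rule has_derivative_eq_rhs) (auto simp: mult.commute)
  qed
  \<comment> \<open>The quarter turn is skew and squares to minus the identity; hence the velocity
    \<open>rot (N (\<gamma> t))\<close> has the coordinates \<open>(B, - A)\<close>.\<close>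
  have rr: "rot (rot w) = - w" "rot w \<bullet> w' = - (w \<bullet> rot w')" for w w'
    by (simp_all add: inner_2 vec_eq_iff forall_2)
  have dx: "(x has_real_derivative N (P (x t, y t)) \<bullet> v) (at t)" and dy: "(y has_real_derivative - (N (P (x t, y t)) \<bullet> rot v)) (at t)"
    if "\<bar>t\<bar> < \<epsilon>" for t
    using dinner[OF that, of "rot v"] dinner[OF that, of v] unfolding x_def[abs_def] y_def[abs_def] Pxy[unfolded x_def y_def]
    by (simp_all add: rr)
  have x0: "x 0 = 0" "y 0 = 0" using \<gamma>(2) by (auto simp: x_def y_def)
  have "isCont x 0" "isCont y 0" using DERIV_isCont dx[of 0] dy[of 0] \<epsilon> by auto
  then have "x \<midarrow>0\<rightarrow> 0" "y \<midarrow>0\<rightarrow> 0" using x0 by (auto simp: isCont_def)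
  then have "\<forall>\<^sub>F t in at 0. \<bar>x t\<bar> < r \<and> \<bar>y t\<bar> < r"
    using tendstoD[of x 0 "at 0" r] tendstoD[of y 0 "at 0" r] r_pos by (simp add: dist_real_def eventually_conj_iff)
  then obtain d where d: "d > 0" "\<And>t. t \<noteq> 0 \<Longrightarrow> \<bar>t\<bar> < d \<Longrightarrow> \<bar>x t\<bar> < r \<and> \<bar>y t\<bar> < r"
    by (auto simp: eventually_at dist_real_def)
  have pc: "pcurve (min d \<epsilon>) x y"
    unfolding pcurve_def
  proof (intro conjI allI impI)
    fix t :: real assume t: "\<bar>t\<bar> < min d \<epsilon>"
    have "\<bar>x t\<bar> < r \<and> \<bar>y t\<bar> < r" using d(2)[of t] t x0 r_pos by (cases "t = 0") auto
    then show "(x t, y t) \<in> sq r" by (auto simp: abs_less_iff)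
    show "(x has_real_derivative N (P (x t, y t)) \<bullet> v) (at t)" using dx t by simp
    show "(y has_real_derivative - (N (P (x t, y t)) \<bullet> rot v)) (at t)" using dy t by simp
  qed (use d \<epsilon> x0 in auto)
  show ?thesis
    by (rule that[of "min d \<epsilon>"]) (use pc Pxy in \<open>simp_all add: x_def[abs_def] y_def[abs_def] v_def\<close>)
qed

lemma ic_jacobi:
  assumes \<gamma>: "ic \<epsilon> \<gamma>"
  obtains \<delta> j e where "\<delta> > 0" "\<And>t. \<bar>t\<bar> < \<delta> \<Longrightarrow> j t > 0 \<and> (j has_real_derivative - e t) (at t) \<and>
    (e has_real_derivative K (\<gamma> t) * j t) (at t) \<and>
    ((\<lambda>t. D (\<gamma> t) * j t) has_real_derivative curl F (\<gamma> t) * j t) (at t)"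
proof -
  have q: "\<gamma> 0 \<in> U" using ic_in[OF \<gamma>, of 0] \<gamma> by (simp add: ic_def)
  show ?thesis
  proof (rule local_char_frame[OF q])
    fix r
    assume fr: "frame (N (\<gamma> 0))"
      and cf: "char_frame r (\<lambda>z. N (frame.P (\<gamma> 0) (N (\<gamma> 0)) z) \<bullet> rot (N (\<gamma> 0))) (\<lambda>z. N (frame.P (\<gamma> 0) (N (\<gamma> 0)) z) \<bullet> N (\<gamma> 0)) (\<lambda>z. H (frame.P (\<gamma> 0) (N (\<gamma> 0)) z))
      (\<lambda>z. D (frame.P (\<gamma> 0) (N (\<gamma> 0)) z)) (\<lambda>z. curl F (frame.P (\<gamma> 0) (N (\<gamma> 0)) z)) (\<lambda>z. K (frame.P (\<gamma> 0) (N (\<gamma> 0)) z))"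
    show thesis
    proof (rule ic_pcurve[OF q \<gamma> refl fr cf])
      fix \<epsilon>'
      assume pc: "char_frame.pcurve r (\<lambda>z. N (frame.P (\<gamma> 0) (N (\<gamma> 0)) z) \<bullet> rot (N (\<gamma> 0))) (\<lambda>z. N (frame.P (\<gamma> 0) (N (\<gamma> 0)) z) \<bullet> N (\<gamma> 0)) \<epsilon>'
          (\<lambda>t. (\<gamma> t - \<gamma> 0) \<bullet> rot (N (\<gamma> 0))) (\<lambda>t. (\<gamma> t - \<gamma> 0) \<bullet> N (\<gamma> 0))"
        and Pxy: "\<And>t. frame.P (\<gamma> 0) (N (\<gamma> 0)) ((\<gamma> t - \<gamma> 0) \<bullet> rot (N (\<gamma> 0)), (\<gamma> t - \<gamma> 0) \<bullet> N (\<gamma> 0)) = \<gamma> t"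
      show thesis
      proof (rule char_frame.pcurve_jacobi[OF cf pc], unfold Pxy)
        fix \<delta> j e
        assume \<delta>: "\<delta> > 0" and j: "\<And>t. \<bar>t\<bar> < \<delta> \<Longrightarrow> j t > 0 \<and> (j has_real_derivative - e t) (at t) \<and>
          (e has_real_derivative K (\<gamma> t) * j t) (at t) \<and>
          ((\<lambda>t. D (\<gamma> t) * j t) has_real_derivative curl F (\<gamma> t) * j t) (at t)"
        show thesis by (rule that[OF \<delta> j])
      qed
    qed
  qed
qed

lemma D_deriv_unique:
  assumes \<gamma>: "ic \<epsilon>1 \<gamma>1" "ic \<epsilon>2 \<gamma>2" "\<gamma>1 0 = \<gamma>2 0" and d: "((\<lambda>t. D (\<gamma>1 t)) has_real_derivative d) (at 0)"
  shows "((\<lambda>t. D (\<gamma>2 t)) has_real_derivative d) (at 0)"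
proof -
  define q where "q = \<gamma>1 0"
  have q: "q \<in> U" using ic_in[OF \<gamma>(1), of 0] \<gamma>(1) by (simp add: ic_def q_def)
  have q12: "\<gamma>1 0 = q" "\<gamma>2 0 = q" using \<gamma>(3) by (simp_all add: q_def)
  obtain r where fr: "frame (N q)"
      and cf: "char_frame r (\<lambda>z. N (frame.P q (N q) z) \<bullet> rot (N q)) (\<lambda>z. N (frame.P q (N q) z) \<bullet> N q) (\<lambda>z. H (frame.P q (N q) z))
      (\<lambda>z. D (frame.P q (N q) z)) (\<lambda>z. curl F (frame.P q (N q) z)) (\<lambda>z. K (frame.P q (N q) z))"
    by (rule local_char_frame[OF q]) blast
  obtain e1 where 1: "char_frame.pcurve r (\<lambda>z. N (frame.P q (N q) z) \<bullet> rot (N q)) (\<lambda>z. N (frame.P q (N q) z) \<bullet> N q) e1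
      (\<lambda>t. (\<gamma>1 t - q) \<bullet> rot (N q)) (\<lambda>t. (\<gamma>1 t - q) \<bullet> N q)"
    "\<And>t. frame.P q (N q) ((\<gamma>1 t - q) \<bullet> rot (N q), (\<gamma>1 t - q) \<bullet> N q) = \<gamma>1 t"
    by (rule ic_pcurve[OF q \<gamma>(1) q12(1) fr cf]) blast
  obtain e2 where 2: "char_frame.pcurve r (\<lambda>z. N (frame.P q (N q) z) \<bullet> rot (N q)) (\<lambda>z. N (frame.P q (N q) z) \<bullet> N q) e2
      (\<lambda>t. (\<gamma>2 t - q) \<bullet> rot (N q)) (\<lambda>t. (\<gamma>2 t - q) \<bullet> N q)"
    "\<And>t. frame.P q (N q) ((\<gamma>2 t - q) \<bullet> rot (N q), (\<gamma>2 t - q) \<bullet> N q) = \<gamma>2 t"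
    by (rule ic_pcurve[OF q \<gamma>(2) q12(2) fr cf]) blast
  from char_frame.pcurve_D_deriv_unique[OF cf 1(1) 2(1), of d] d show ?thesis
    by (simp add: 1(2) 2(2))
qed

text \<open>\<open>D\<close> is the quotient of \<open>D * j\<close> by \<open>j\<close>, and both
  are differentiable along the curve. This is how \<open>D'\<close> comes to exist although
  \<open>D\<close> is only continuous.\<close>

lemma has_deriv_along_D:
  assumes ex: "ic \<epsilon> \<gamma>"
  shows "\<exists>d. has_deriv_along D Nperp U (\<gamma> 0) d"
proof -
  obtain \<delta> j e where \<delta>: "\<delta> > 0" and j: "\<And>t. \<bar>t\<bar> < \<delta> \<Longrightarrow> j t > 0 \<and> (j has_real_derivative - e t) (at t) \<and>
    (e has_real_derivative K (\<gamma> t) * j t) (at t) \<and>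
    ((\<lambda>t. D (\<gamma> t) * j t) has_real_derivative curl F (\<gamma> t) * j t) (at t)"
    by (rule ic_jacobi[OF ex]) blast
  have j0: "j 0 \<noteq> 0" "(j has_real_derivative - e 0) (at 0)" "((\<lambda>t. D (\<gamma> t) * j t) has_real_derivative curl F (\<gamma> 0) * j 0) (at 0)"
    using j[of 0] \<delta> by auto
  from DERIV_divide[OF j0(3,2,1)]
  obtain d where "((\<lambda>t. D (\<gamma> t) * j t / j t) has_real_derivative d) (at 0)" by blast
  then have d: "((\<lambda>t. D (\<gamma> t)) has_real_derivative d) (at 0)"
    by (rule has_field_derivative_transform_within[where d=\<delta>]) (use \<delta> j in \<open>force simp: dist_real_def\<close>)+
  have "has_deriv_along D Nperp U (\<gamma> 0) d"
    unfolding has_deriv_along_def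
    using ex D_deriv_unique[OF ex _ _ d] unfolding ic_def by (metis (no_types, lifting))
  then show ?thesis ..
qed

text \<open>Defined for points, independently of any curve; \<open>has_deriv_along\<close> admits at
  most one value.\<close>

definition D' :: "real^2 \<Rightarrow> real" where
  "D' q = (SOME d. has_deriv_along D Nperp U q d)"

lemma D'_deriv:
  assumes \<gamma>: "ic \<epsilon> \<gamma>" and t: "\<bar>t\<bar> < \<epsilon>"
  shows "has_deriv_along D Nperp U (\<gamma> t) (D' (\<gamma> t))" "((\<lambda>t. D (\<gamma> t)) has_real_derivative D' (\<gamma> t)) (at t)"
proof -
  have sh: "ic (\<epsilon> - \<bar>t\<bar>) (\<lambda>s. \<gamma> (t + s))" by (rule ic_shift[OF \<gamma> t])
  show h: "has_deriv_along D Nperp U (\<gamma> t) (D' (\<gamma> t))"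
    using someI_ex[OF has_deriv_along_D[OF sh]] by (simp add: D'_def)
  have all: "((\<lambda>s. D (\<gamma>' s)) has_real_derivative D' (\<gamma> t)) (at 0)" if "ic \<epsilon>' \<gamma>'" "\<gamma>' 0 = \<gamma> t" for \<epsilon>' \<gamma>'
    using h that unfolding has_deriv_along_def ic_def by blast
  have "((\<lambda>s. D (\<gamma> (t + s))) has_real_derivative D' (\<gamma> t)) (at 0)"
    by (rule all[OF sh]) simp
  then have "((\<lambda>s. D (\<gamma> (s + t))) has_real_derivative D' (\<gamma> t)) (at 0)" by (simp add: add.commute)
  then show "((\<lambda>t. D (\<gamma> t)) has_real_derivative D' (\<gamma> t)) (at t)"
    using DERIV_shift[of "\<lambda>t. D (\<gamma> t)" "D' (\<gamma> t)" 0 t] by simp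
qed

text \<open>Expanding \<open>(D * j)' = curl F * j\<close> gives
  \<open>j' / j = (curl F - D') / D\<close>. The right-hand side does not mention \<open>j\<close>,
  so local Jacobi fields with unrelated normalisations yield one function on the whole
  curve.\<close>

definition w :: "real^2 \<Rightarrow> real" where "w q = (curl F q - D' q) / D q"

text \<open>The logarithmic derivative \<open>w\<close> of the Jacobi fields does not depend on the choice of the field.\<close>

lemma riccati:
  assumes \<gamma>: "ic \<epsilon> \<gamma>"
  shows "((\<lambda>t. w (\<gamma> t)) has_real_derivative - K (\<gamma> 0) - (w (\<gamma> 0))\<^sup>2) (at 0)"
proof -
  have \<epsilon>: "\<epsilon> > 0" using \<gamma> by (simp add: ic_def)
  obtain \<delta> j e where \<delta>: "\<delta> > 0" and j: "\<And>t. \<bar>t\<bar> < \<delta> \<Longrightarrow> j t > 0 \<and> (j has_real_derivative - e t) (at t) \<and>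
    (e has_real_derivative K (\<gamma> t) * j t) (at t) \<and>
    ((\<lambda>t. D (\<gamma> t) * j t) has_real_derivative curl F (\<gamma> t) * j t) (at t)"
    by (rule ic_jacobi[OF \<gamma>]) blast
  \<comment> \<open>Here \<open>- e\<close> is the derivative of \<open>j\<close>; comparing two
    expressions for the derivative of \<open>D * j\<close> identifies the quotient with
    \<open>w\<close>.\<close>
  have weq: "w (\<gamma> t) = - e t / j t" if t: "\<bar>t\<bar> < min \<delta> \<epsilon>" for t
  proof -
    have jt: "j t > 0" "(j has_real_derivative - e t) (at t)" "((\<lambda>t. D (\<gamma> t) * j t) has_real_derivative curl F (\<gamma> t) * j t) (at t)"
      using j[of t] t by auto
    have "((\<lambda>t. D (\<gamma> t) * j t) has_real_derivative D' (\<gamma> t) * j t + - e t * D (\<gamma> t)) (at t)"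
      by (rule DERIV_mult[OF D'_deriv(2)[OF \<gamma>] jt(2)]) (use t in simp)
    then have "curl F (\<gamma> t) * j t = D' (\<gamma> t) * j t + - e t * D (\<gamma> t)"
      using jt(3) DERIV_unique by blast
    then have "(curl F (\<gamma> t) - D' (\<gamma> t)) * j t = - e t * D (\<gamma> t)" by (simp add: left_diff_distrib)
    moreover have "D (\<gamma> t) > 0" by (rule D_pos[OF ic_in[OF \<gamma>]]) (use t in simp)
    ultimately show ?thesis using jt(1) unfolding w_def by (subst frac_eq_eq) auto
  qed
  have j0: "j 0 > 0" "(j has_real_derivative - e 0) (at 0)" "(e has_real_derivative K (\<gamma> 0) * j 0) (at 0)"
    using j[of 0] \<delta> by auto
  have w0: "w (\<gamma> 0) = - e 0 / j 0" using weq[of 0] \<delta> \<epsilon> by simp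
  have "((\<lambda>t. - e t / j t) has_real_derivative (- (K (\<gamma> 0) * j 0) * j 0 - - e 0 * - e 0) / (j 0 * j 0)) (at 0)"
    by (rule DERIV_divide[OF DERIV_minus[OF j0(3)] j0(2)]) (use j0(1) in simp)
  also have "(- (K (\<gamma> 0) * j 0) * j 0 - - e 0 * - e 0) / (j 0 * j 0) = - K (\<gamma> 0) - (w (\<gamma> 0))\<^sup>2"
    using j0(1) by (simp add: w0 field_simps power2_eq_square)
  finally show ?thesis
    by (rule has_field_derivative_transform_within[where d="min \<delta> \<epsilon>"]) (use \<delta> \<epsilon> weq in \<open>auto simp: dist_real_def\<close>)
qed

section \<open>Behaviour at a singular end point\<close>

text \<open>\<open>\<sigma>\<close> is the orientation of \<open>\<Gamma>\<close> relative to
  \<open>Nperp\<close>. The Riccati equation for \<open>w\<close> holds on all of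
  \<open>{0<..<r}\<close>, and \<open>J = exp (\<sigma> * W)\<close> assembles a single Jacobi field
  reaching up to the singular point. \<open>endpoint_asymptotics\<close> then applies, since
  \<open>D' = curl F - D * V / J\<close>.\<close>

lemma char_curve_limit:
  assumes p: "p \<in> singular_set \<Omega> F u" and r: "r > 0" and \<Gamma>c: "continuous_on {0..<r} \<Gamma>" and \<Gamma>\<Omega>: "\<Gamma> ` {0..<r} \<subseteq> \<Omega>"
    and \<Gamma>0: "\<Gamma> 0 = p" and \<sigma>: "\<sigma> = 1 \<or> \<sigma> = -1"
    and \<Gamma>: "integral_curve (\<lambda>x. \<sigma> *\<^sub>R Nperp x) U {0<..<r} \<Gamma>" and c0: "curl F p \<noteq> 0"
  shows "\<forall>\<rho>\<in>{0<..<r}. has_deriv_along D Nperp U (\<Gamma> \<rho>) (D' (\<Gamma> \<rho>))"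
    and "\<sigma> * curl F p > 0"
    and "((\<lambda>\<rho>. D' (\<Gamma> \<rho>)) \<longlongrightarrow> curl F p / 2) (at_right 0) \<or> ((\<lambda>\<rho>. D' (\<Gamma> \<rho>)) \<longlongrightarrow> curl F p) (at_right 0)"
proof -
  have \<sigma>1: "\<bar>\<sigma>\<bar> = 1" "\<sigma> * \<sigma> = 1" using \<sigma> by auto
  \<comment> \<open>The factor \<open>\<sigma>\<close> in the parameter gives an integral curve of
    \<open>Nperp\<close> itself, centred at \<open>\<rho>\<close>; its radius is the distance of
    \<open>\<rho>\<close> from the ends of the interval.\<close>
  have ic: "ic (min \<rho> (r - \<rho>)) (\<lambda>t. \<Gamma> (\<rho> + \<sigma> * t))" if \<rho>: "\<rho> \<in> {0<..<r}" for \<rho>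
    unfolding ic_def integral_curve_def
  proof (intro conjI ballI)
    fix t assume "t \<in> {- min \<rho> (r - \<rho>)<..<min \<rho> (r - \<rho>)}"
    then have t: "\<rho> + \<sigma> * t \<in> {0<..<r}" using \<sigma> by auto
    show "\<Gamma> (\<rho> + \<sigma> * t) \<in> U" using \<Gamma> t unfolding integral_curve_def by blast
    have "(\<Gamma> has_vector_derivative \<sigma> *\<^sub>R Nperp (\<Gamma> (\<rho> + \<sigma> * t))) (at (\<rho> + \<sigma> * t))"
      using \<Gamma> t unfolding integral_curve_def by blast
    moreover have "((\<lambda>t. \<rho> + \<sigma> * t) has_vector_derivative \<sigma>) (at t)"
      by (auto intro!: derivative_eq_intros simp: has_real_derivative_iff_has_vector_derivative[symmetric])
    ultimately have "(\<Gamma> \<circ> (\<lambda>t. \<rho> + \<sigma> * t) has_vector_derivative \<sigma> *\<^sub>R (\<sigma> *\<^sub>R Nperp (\<Gamma> (\<rho> + \<sigma> * t)))) (at t)"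
      by (intro vector_diff_chain_at)
    then show "((\<lambda>t. \<Gamma> (\<rho> + \<sigma> * t)) has_vector_derivative Nperp (\<Gamma> (\<rho> + \<sigma> * t))) (at t)"
      by (simp add: o_def \<sigma>1)
  qed (use \<rho> in auto)
  have \<Gamma>U: "\<Gamma> \<rho> \<in> U" if "\<rho> \<in> {0<..<r}" for \<rho> using \<Gamma> that unfolding integral_curve_def by blast
  show da: "\<forall>\<rho>\<in>{0<..<r}. has_deriv_along D Nperp U (\<Gamma> \<rho>) (D' (\<Gamma> \<rho>))"
  proof
    fix \<rho> assume \<rho>: "\<rho> \<in> {0<..<r}"
    show "has_deriv_along D Nperp U (\<Gamma> \<rho>) (D' (\<Gamma> \<rho>))"
      using D'_deriv(1)[OF ic[OF \<rho>], of 0] \<rho> by simp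
  qed
  have pull: "((\<lambda>s. f (\<Gamma> s)) has_real_derivative \<sigma> * d) (at \<rho>)"
    if "((\<lambda>t. f (\<Gamma> (\<rho> + \<sigma> * t))) has_real_derivative d) (at 0)" for f :: "real^2 \<Rightarrow> real" and d \<rho>
  proof -
    have lin: "((\<lambda>s. \<sigma> * (s - \<rho>)) has_real_derivative \<sigma>) (at \<rho>)" by (auto intro!: derivative_eq_intros)
    have "((\<lambda>t. f (\<Gamma> (\<rho> + \<sigma> * t))) has_real_derivative d) (at (\<sigma> * (\<rho> - \<rho>)))" using that by simp
    from DERIV_chain2[where f="\<lambda>t. f (\<Gamma> (\<rho> + \<sigma> * t))" and g="\<lambda>s. \<sigma> * (s - \<rho>)", OF this lin]
    have "((\<lambda>s. f (\<Gamma> (\<rho> + \<sigma> * (\<sigma> * (s - \<rho>))))) has_real_derivative d * \<sigma>) (at \<rho>)" .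
    then show ?thesis by (simp only: mult.assoc[symmetric] \<sigma>1(2)) (simp add: mult.commute)
  qed
  have dD: "((\<lambda>s. D (\<Gamma> s)) has_real_derivative \<sigma> * D' (\<Gamma> \<rho>)) (at \<rho>)" if \<rho>: "\<rho> \<in> {0<..<r}" for \<rho>
    by (rule pull) (use D'_deriv(2)[OF ic[OF \<rho>], of 0] \<rho> in simp)
  have dw: "((\<lambda>s. w (\<Gamma> s)) has_real_derivative \<sigma> * (- K (\<Gamma> \<rho>) - (w (\<Gamma> \<rho>))\<^sup>2)) (at \<rho>)" if \<rho>: "\<rho> \<in> {0<..<r}" for \<rho>
    by (rule pull) (use riccati[OF ic[OF \<rho>]] in simp)
  define s where "s = r / 2"
  have s: "0 < s" "s < r" using r by (auto simp: s_def)
  \<comment> \<open>The primitive starts at the interior point \<open>s\<close>, as \<open>w\<close>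
    may be unbounded near \<open>0\<close>, where its denominator \<open>D\<close> tends to
    zero.\<close>
  define W where "W \<rho> = SI (\<lambda>s. w (\<Gamma> s)) s \<rho>" for \<rho>
  have dW: "(W has_real_derivative w (\<Gamma> \<rho>)) (at \<rho>)" if \<rho>: "\<rho> \<in> {0<..s}" for \<rho>
  proof -
    let ?a = "\<rho> / 2" and ?b = "(s + r) / 2"
    have sub: "{?a..?b} \<subseteq> {0<..<r}" using \<rho> s by auto
    have "continuous_on {?a..?b} (\<lambda>s. w (\<Gamma> s))"
      by (rule continuous_at_imp_continuous_on) (use dw sub in \<open>blast intro: DERIV_isCont\<close>)
    then have "(SI (\<lambda>s. w (\<Gamma> s)) s has_real_derivative w (\<Gamma> \<rho>)) (at \<rho> within {?a..?b})"
      by (rule SI_has_real_derivative) (use \<rho> s in auto)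
    moreover have "at \<rho> within {?a..?b} = at \<rho>" by (rule at_within_Icc_at) (use \<rho> s in auto)
    ultimately show ?thesis by (simp add: W_def[abs_def])
  qed
  define J where "J \<rho> = exp (\<sigma> * W \<rho>)" for \<rho>
  define V where "V \<rho> = w (\<Gamma> \<rho>) * J \<rho>" for \<rho>
  have in_r: "\<rho> \<in> {0<..<r}" if "\<rho> \<in> {0<..s}" for \<rho> using that s by auto
  have dJ: "(J has_real_derivative \<sigma> * V \<rho>) (at \<rho>)" if \<rho>: "\<rho> \<in> {0<..s}" for \<rho>
  proof -
    have "(J has_real_derivative exp (\<sigma> * W \<rho>) * (\<sigma> * w (\<Gamma> \<rho>))) (at \<rho>)"
      unfolding J_def[abs_def] by (intro DERIV_fun_exp DERIV_cmult dW[OF \<rho>])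
    then show ?thesis by (simp add: V_def J_def ac_simps)
  qed
  have dV: "(V has_real_derivative - \<sigma> * K (\<Gamma> \<rho>) * J \<rho>) (at \<rho>)" if \<rho>: "\<rho> \<in> {0<..s}" for \<rho>
  proof -
    \<comment> \<open>The quadratic term of the Riccati equation cancels against the derivative of
      \<open>J\<close>, leaving a linear equation.\<close>
    have "(V has_real_derivative \<sigma> * (- K (\<Gamma> \<rho>) - (w (\<Gamma> \<rho>))\<^sup>2) * J \<rho> + \<sigma> * V \<rho> * w (\<Gamma> \<rho>)) (at \<rho>)"
      unfolding V_def[abs_def] using DERIV_mult[OF dw[OF in_r[OF \<rho>]] dJ[OF \<rho>]] by (simp add: V_def)
    then show ?thesis by (simp add: V_def algebra_simps power2_eq_square)
  qed
  have Dp: "D (\<Gamma> \<rho>) > 0" if "\<rho> \<in> {0<..s}" for \<rho> using D_pos[OF \<Gamma>U[OF in_r[OF that]]] .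
  have cDw: "curl F (\<Gamma> \<rho>) - D (\<Gamma> \<rho>) * w (\<Gamma> \<rho>) = D' (\<Gamma> \<rho>)" if "\<rho> \<in> {0<..s}" for \<rho>
    using Dp[OF that] by (simp add: w_def)
  have dDJ: "((\<lambda>x. D (\<Gamma> x) * J x) has_real_derivative \<sigma> * curl F (\<Gamma> \<rho>) * J \<rho>) (at \<rho>)" if \<rho>: "\<rho> \<in> {0<..s}" for \<rho>
  proof -
    have "\<sigma> * curl F (\<Gamma> \<rho>) * J \<rho> = \<sigma> * D' (\<Gamma> \<rho>) * J \<rho> + \<sigma> * V \<rho> * D (\<Gamma> \<rho>)"
      unfolding cDw[OF \<rho>, symmetric] by (simp add: V_def algebra_simps)
    then show ?thesis using DERIV_mult[OF dD[OF in_r[OF \<rho>]] dJ[OF \<rho>]] by simp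
  qed
  have sub: "{0..s} \<subseteq> {0..<r}" using s by auto
  have cont: "continuous_on {0..s} (\<lambda>x. f (\<Gamma> x))" if "continuous_on \<Omega> f" for f :: "real^2 \<Rightarrow> real"
    by (rule continuous_on_compose2[OF that continuous_on_subset[OF \<Gamma>c sub]]) (use \<Gamma>\<Omega> sub in blast)
  have lim: "((\<lambda>x. f (\<Gamma> x)) \<longlongrightarrow> f p) (at_right 0)" if "continuous_on \<Omega> f" for f :: "real^2 \<Rightarrow> real"
    using continuous_on_Icc_at_rightD[OF cont[OF that] s(1)] \<Gamma>0 by simp
  \<comment> \<open>The interval includes \<open>0\<close>: the bound uses continuity of
    \<open>K\<close> at the singular point itself.\<close>
  have "compact ((\<lambda>x. K (\<Gamma> x)) ` {0..s})" by (rule compact_continuous_image[OF cont[OF K_cont]]) simp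
  from bounded_pos[THEN iffD1, OF compact_imp_bounded[OF this]]
  obtain M where "\<forall>x\<in>{0..s}. \<bar>K (\<Gamma> x)\<bar> \<le> M" by auto
  then have M: "\<And>x. x \<in> {0..s} \<Longrightarrow> \<bar>K (\<Gamma> x)\<bar> \<le> M" by blast
  have D0: "((\<lambda>x. D (\<Gamma> x)) \<longlongrightarrow> 0) (at_right 0)"
  proof -
    have "D p = 0" using p by (simp add: singular_set_def D_fun_def)
    then show ?thesis using lim[OF D_cont] by simp
  qed
  have Jpos: "J x > 0" for x by (simp add: J_def)
  note ea = endpoint_asymptotics[where J=J and V=V and K="\<lambda>x. K (\<Gamma> x)" and D="\<lambda>x. D (\<Gamma> x)" and c="\<lambda>x. curl F (\<Gamma> x)" and M=M,
      OF s(1) \<sigma>1(1) dJ dV dDJ _ Jpos Dp lim[OF curl_cont] c0 D0]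
  show "\<sigma> * curl F p > 0" by (rule ea(1)) (use M in auto)
  have "((\<lambda>x. curl F (\<Gamma> x) - D (\<Gamma> x) * V x / J x) \<longlongrightarrow> curl F p / 2) (at_right 0) \<or>
     ((\<lambda>x. curl F (\<Gamma> x) - D (\<Gamma> x) * V x / J x) \<longlongrightarrow> curl F p) (at_right 0)"
    by (rule ea(2)) (use M in auto)
  moreover have ev: "\<forall>\<^sub>F x in at_right 0. curl F (\<Gamma> x) - D (\<Gamma> x) * V x / J x = D' (\<Gamma> x)"
    unfolding eventually_at_right_field
  proof (intro exI[of _ s] conjI allI impI)
    fix x assume "0 < x" "x < s"
    then have "x \<in> {0<..s}" by simp
    from cDw[OF this] show "curl F (\<Gamma> x) - D (\<Gamma> x) * V x / J x = D' (\<Gamma> x)"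
      using Jpos[of x] by (simp add: V_def)
  qed (rule s(1))
  ultimately show "((\<lambda>\<rho>. D' (\<Gamma> \<rho>)) \<longlongrightarrow> curl F p / 2) (at_right 0) \<or> ((\<lambda>\<rho>. D' (\<Gamma> \<rho>)) \<longlongrightarrow> curl F p) (at_right 0)"
    using Lim_transform_eventually[OF _ ev] by blast
qed

lemma char_curve_orientation:
  assumes "characteristic_curve \<Omega> F u I \<Gamma>"
  obtains \<sigma> :: real where "\<sigma> = 1 \<or> \<sigma> = -1" "integral_curve (\<lambda>x. \<sigma> *\<^sub>R Nperp x) U I \<Gamma>"
proof -
  have "integral_curve (\<lambda>x. 1 *\<^sub>R Nperp x) U I \<Gamma> \<or> integral_curve (\<lambda>x. (-1) *\<^sub>R Nperp x) U I \<Gamma>"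
    using assms unfolding characteristic_curve_def by simp
  then show ?thesis using that by blast
qed

lemma C1_curve_on_continuous: "C1_curve_on I \<Gamma> \<Longrightarrow> continuous_on I \<Gamma>"
  unfolding C1_curve_on_def continuous_on_eq_continuous_within
  using has_vector_derivative_continuous by blast

end

theorem theoremB:
  fixes \<Omega> :: "(real^2) set" and F :: "real^2 \<Rightarrow> real^2"
    and H u :: "real^2 \<Rightarrow> real"
  assumes "open \<Omega>" and "connected \<Omega>"
    and "C1_field_on \<Omega> F"
    and "continuous_on \<Omega> H"
    and "C1_on \<Omega> u"
    and "weak_solution \<Omega> F H u"
    and "deriv_along_extends (curl F) (Nperp_field F u) (\<Omega> - singular_set \<Omega> F u) \<Omega>"
    and "deriv_along_extends H (N_field F u) (\<Omega> - singular_set \<Omega> F u) \<Omega>"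
  shows
    "(\<forall>p r \<Gamma>.
        p \<in> singular_set \<Omega> F u \<and> r > 0 \<and> C1_curve_on {0..<r} \<Gamma> \<and> \<Gamma> ` {0..<r} \<subseteq> \<Omega> \<and> \<Gamma> 0 = p \<and>
        characteristic_curve \<Omega> F u {0<..<r} \<Gamma> \<and> curl F p \<noteq> 0 \<longrightarrow>
        (\<exists>D'. (\<forall>\<rho>\<in>{0<..<r}. has_deriv_along (D_fun F u) (Nperp_field F u)
                              (\<Omega> - singular_set \<Omega> F u) (\<Gamma> \<rho>) (D' (\<Gamma> \<rho>))) \<and>
              (((\<lambda>\<rho>. D' (\<Gamma> \<rho>)) \<longlongrightarrow> curl F p / 2) (at_right 0) \<or>
               ((\<lambda>\<rho>. D' (\<Gamma> \<rho>)) \<longlongrightarrow> curl F p) (at_right 0))) \<and>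
        (curl F p > 0 \<longrightarrow>
           (\<forall>\<rho>\<in>{0<..<r}. (\<Gamma> has_vector_derivative Nperp_field F u (\<Gamma> \<rho>)) (at \<rho>))) \<and>
        (curl F p < 0 \<longrightarrow>
           (\<forall>\<rho>\<in>{0<..<r}. (\<Gamma> has_vector_derivative - Nperp_field F u (\<Gamma> \<rho>)) (at \<rho>)))) \<and>
     (\<forall>p q. p \<in> singular_set \<Omega> F u \<and> q \<in> singular_set \<Omega> F u \<and> p \<noteq> q \<and>
        (\<forall>x\<in>\<Omega>. curl F x \<noteq> 0) \<longrightarrow>
        \<not> (\<exists>r \<Gamma>. r > 0 \<and> C1_curve_on {0..r} \<Gamma> \<and> \<Gamma> ` {0..r} \<subseteq> \<Omega> \<and>
              characteristic_curve \<Omega> F u {0<..<r} \<Gamma> \<and> \<Gamma> 0 = p \<and> \<Gamma> r = q))"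
proof -
  obtain h where h: "continuous_on \<Omega> h"
    "\<And>q. q \<in> \<Omega> - singular_set \<Omega> F u \<Longrightarrow> has_deriv_along H (N_field F u) (\<Omega> - singular_set \<Omega> F u) q (h q)"
    using assms(8) unfolding deriv_along_extends_def by blast
  interpret weak_graph \<Omega> F H u h by unfold_locales (use assms h in auto)
  show ?thesis
  proof (intro conjI allI impI notI)
    fix p r \<Gamma>
    assume A: "p \<in> singular_set \<Omega> F u \<and> r > 0 \<and> C1_curve_on {0..<r} \<Gamma> \<and> \<Gamma> ` {0..<r} \<subseteq> \<Omega> \<and> \<Gamma> 0 = p \<and>
        characteristic_curve \<Omega> F u {0<..<r} \<Gamma> \<and> curl F p \<noteq> 0"
    obtain \<sigma> :: real where \<sigma>: "\<sigma> = 1 \<or> \<sigma> = -1" and \<Gamma>: "integral_curve (\<lambda>x. \<sigma> *\<^sub>R Nperp x) U {0<..<r} \<Gamma>"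
      by (rule char_curve_orientation) (use A in blast)
    have \<Gamma>c: "continuous_on {0..<r} \<Gamma>" using C1_curve_on_continuous A by blast
    note L = char_curve_limit[OF _ _ \<Gamma>c _ _ \<sigma> \<Gamma>, of p]
    show "\<exists>D'. (\<forall>\<rho>\<in>{0<..<r}. has_deriv_along D Nperp U (\<Gamma> \<rho>) (D' (\<Gamma> \<rho>))) \<and>
              (((\<lambda>\<rho>. D' (\<Gamma> \<rho>)) \<longlongrightarrow> curl F p / 2) (at_right 0) \<or>
               ((\<lambda>\<rho>. D' (\<Gamma> \<rho>)) \<longlongrightarrow> curl F p) (at_right 0))"
      using L(1,3) A by blast
    have sg: "\<sigma> * curl F p > 0" using L(2) A by blast
    have d: "\<forall>\<rho>\<in>{0<..<r}. (\<Gamma> has_vector_derivative \<sigma> *\<^sub>R Nperp (\<Gamma> \<rho>)) (at \<rho>)"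
      using \<Gamma> unfolding integral_curve_def by blast
    show "\<forall>\<rho>\<in>{0<..<r}. (\<Gamma> has_vector_derivative Nperp (\<Gamma> \<rho>)) (at \<rho>)" if "curl F p > 0"
      using d sg \<sigma> that by auto
    show "\<forall>\<rho>\<in>{0<..<r}. (\<Gamma> has_vector_derivative - Nperp (\<Gamma> \<rho>)) (at \<rho>)" if "curl F p < 0"
      using d sg \<sigma> that by auto
  next
    fix p q
    assume A: "p \<in> singular_set \<Omega> F u \<and> q \<in> singular_set \<Omega> F u \<and> p \<noteq> q \<and> (\<forall>x\<in>\<Omega>. curl F x \<noteq> 0)"
    assume "\<exists>r \<Gamma>. r > 0 \<and> C1_curve_on {0..r} \<Gamma> \<and> \<Gamma> ` {0..r} \<subseteq> \<Omega> \<and>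
              characteristic_curve \<Omega> F u {0<..<r} \<Gamma> \<and> \<Gamma> 0 = p \<and> \<Gamma> r = q"
    then obtain r \<Gamma> where r: "r > 0" and C: "C1_curve_on {0..r} \<Gamma>" and sub: "\<Gamma> ` {0..r} \<subseteq> \<Omega>"
      and ch: "characteristic_curve \<Omega> F u {0<..<r} \<Gamma>" and e: "\<Gamma> 0 = p" "\<Gamma> r = q" by blast
    have pq: "p \<in> \<Omega>" "q \<in> \<Omega>" using A by (auto simp: singular_set_def)
    obtain \<sigma> :: real where \<sigma>: "\<sigma> = 1 \<or> \<sigma> = -1" and \<Gamma>: "integral_curve (\<lambda>x. \<sigma> *\<^sub>R Nperp x) U {0<..<r} \<Gamma>"
      by (rule char_curve_orientation[OF ch])
    have c: "continuous_on {0..r} \<Gamma>" by (rule C1_curve_on_continuous[OF C])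
    have s1: "\<sigma> * curl F p > 0"
      by (rule char_curve_limit(2)[OF _ r continuous_on_subset[OF c] _ e(1) \<sigma> \<Gamma>]) (use A sub pq in auto)
    \<comment> \<open>Read backwards from \<open>q\<close> the curve has the opposite orientation,
      so the sign condition at \<open>q\<close> is opposite to that at \<open>p\<close>.\<close>
    have \<sigma>': "- \<sigma> = 1 \<or> - \<sigma> = -1" using \<sigma> by auto
    have \<Gamma>': "integral_curve (\<lambda>x. (- \<sigma>) *\<^sub>R Nperp x) U {0<..<r} (\<lambda>t. \<Gamma> (r - t))"
      unfolding integral_curve_def
    proof (intro ballI conjI)
      fix t assume "t \<in> {0<..<r}"
      then have t: "r - t \<in> {0<..<r}" by auto
      show "\<Gamma> (r - t) \<in> U" using \<Gamma> t unfolding integral_curve_def by blast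
      have "(\<Gamma> has_vector_derivative \<sigma> *\<^sub>R Nperp (\<Gamma> (r - t))) (at (r - t))"
        using \<Gamma> t unfolding integral_curve_def by blast
      moreover have "((\<lambda>t. r - t) has_vector_derivative -1) (at t)"
        by (auto intro!: derivative_eq_intros)
      ultimately have "(\<Gamma> \<circ> (\<lambda>t. r - t) has_vector_derivative (-1) *\<^sub>R (\<sigma> *\<^sub>R Nperp (\<Gamma> (r - t)))) (at t)"
        by (intro vector_diff_chain_at)
      then show "((\<lambda>t. \<Gamma> (r - t)) has_vector_derivative (- \<sigma>) *\<^sub>R Nperp (\<Gamma> (r - t))) (at t)" by (simp add: o_def)
    qed
    have c': "continuous_on {0..<r} (\<lambda>t. \<Gamma> (r - t))"
      by (rule continuous_on_compose2[OF c]) (auto intro!: continuous_intros)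
    have "- \<sigma> * curl F q > 0"
      by (rule char_curve_limit(2)[OF _ r c' _ _ \<sigma>' \<Gamma>']) (use A sub e pq in auto)
    then have opp: "\<sigma> * curl F q < 0" by simp
    \<comment> \<open>The curl takes values of both signs on the connected set
      \<open>\<Omega>\<close>, so it vanishes somewhere, against the assumption.\<close>
    have "connected (curl F ` \<Omega>)" by (rule connected_continuous_image[OF curl_cont assms(2)])
    moreover have "curl F p \<in> curl F ` \<Omega>" "curl F q \<in> curl F ` \<Omega>" using pq by auto
    moreover have "curl F p \<le> 0 \<and> 0 \<le> curl F q \<or> curl F q \<le> 0 \<and> 0 \<le> curl F p"
      using s1 opp \<sigma> by auto
    ultimately have "0 \<in> curl F ` \<Omega>" by (meson connectedD_interval)
    then show False using A by auto
  qed
qed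

end
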